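(* Let $\mathcal{P}$ be a finite-dimensional Poisson algebra over an arbitrary field $\mathbb{F}$, let $B$ be a subideal of $\mathcal{P}$, and let $C$ be an ideal of $B$ with $C\subseteq\phi(\mathcal{P})$. If $B/C$ is nilpotent, then $B$ is nilpotent; and if $B/C$ is supersolvable, then $B$ is supersolvable.
   Context: A Poisson algebra $(\mathcal{P},\cdot,[\cdot,\cdot])$ over $\mathbb{F}$ is a vector space with two bilinear products such that $(\mathcal{P},\cdot)$ is a commutative associative algebra (not necessarily unital), $(\mathcal{P},[\cdot,\cdot])$ is a Lie algebra, and $[x\cdot y,z]=[x,z]\cdot y+x\cdot[y,z]$ for all $x,y,z$. A subalgebra is a subspace closed under both products; an ideal is a subspace $I$ with $I\cdot\mathcal{P}+[I,\mathcal{P}]\subseteq I$. A subideal of $\mathcal{P}$ is a subalgebra $B$ for which there is a chain of subalgebras $B=B_0\subseteq B_1\subseteq\dots\subseteq B_r=\mathcal{P}$ with $B_i$ an ideal of $B_{i+1}$ for $0\le i\le r-1$. The Frattini subalgebra $F(\mathcal{P})$ is the intersection of the maximal (proper) subalgebras of $\mathcal{P}$, and the Frattini ideal $\phi(\mathcal{P})$ is the largest ideal of $\mathcal{P}$ contained in $F(\mathcal{P})$. A Poisson algebra $A$ is nilpotent if $A^m=0$ for some $m$, where $A^1=A$ and $A^{n+1}=\sum_{i=1}^{n}(A^i\cdot A^{n+1-i}+[A^i,A^{n+1-i}])$ (products of subspaces are linear spans). $A$ is supersolvable if there is a flag $0=A_0\subset A_1\subset\dots\subset A_n=A$ where $A_i$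 is an $i$-dimensional ideal of $A$ for each $1\le i\le n$. *)

theory Defs
  imports "HOL-Algebra.QuotRing" "Jordan_Normal_Form.Missing_VectorSpace"
begin

text \<open>The field \<open>one\<close> inherited from \<^type>\<open>ring\<close> records carries no meaning here:
  the commutative product need not have a unit, and no axiom or definition below depends on it.\<close>

record ('a, 'b) poisson = "('a, 'b) module" +
  bracket :: "'b \<Rightarrow> 'b \<Rightarrow> 'b" (\<open>\<lbrakk>_,_\<rbrakk>\<index>\<close>)

locale poisson_algebra = vectorspace F P
  for F :: "('f, 'm) ring_scheme" (structure) and P :: "('f, 'p, 'n) poisson_scheme" (structure) +
  assumes mult_closed: "\<lbrakk>x \<in> carrier P; y \<in> carrier P\<rbrakk> \<Longrightarrow> x \<otimes>\<^bsub>P\<^esub> y \<in> carrier P"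
    and mult_add_left:
      "\<lbrakk>x \<in> carrier P; y \<in> carrier P; z \<in> carrier P\<rbrakk>
        \<Longrightarrow> (x \<oplus>\<^bsub>P\<^esub> y) \<otimes>\<^bsub>P\<^esub> z = x \<otimes>\<^bsub>P\<^esub> z \<oplus>\<^bsub>P\<^esub> y \<otimes>\<^bsub>P\<^esub> z"
    and mult_smult_left:
      "\<lbrakk>a \<in> carrier F; x \<in> carrier P; y \<in> carrier P\<rbrakk>
        \<Longrightarrow> (a \<odot>\<^bsub>P\<^esub> x) \<otimes>\<^bsub>P\<^esub> y = a \<odot>\<^bsub>P\<^esub> (x \<otimes>\<^bsub>P\<^esub> y)"
    and mult_comm: "\<lbrakk>x \<in> carrier P; y \<in> carrier P\<rbrakk> \<Longrightarrow> x \<otimes>\<^bsub>P\<^esub> y = y \<otimes>\<^bsub>P\<^esub> x"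
    and mult_assoc:
      "\<lbrakk>x \<in> carrier P; y \<in> carrier P; z \<in> carrier P\<rbrakk>
        \<Longrightarrow> (x \<otimes>\<^bsub>P\<^esub> y) \<otimes>\<^bsub>P\<^esub> z = x \<otimes>\<^bsub>P\<^esub> (y \<otimes>\<^bsub>P\<^esub> z)"
    and bracket_closed: "\<lbrakk>x \<in> carrier P; y \<in> carrier P\<rbrakk> \<Longrightarrow> \<lbrakk>x,y\<rbrakk>\<^bsub>P\<^esub> \<in> carrier P"
    and bracket_add_left:
      "\<lbrakk>x \<in> carrier P; y \<in> carrier P; z \<in> carrier P\<rbrakk>
        \<Longrightarrow> \<lbrakk>x \<oplus>\<^bsub>P\<^esub> y, z\<rbrakk>\<^bsub>P\<^esub> = \<lbrakk>x,z\<rbrakk>\<^bsub>P\<^esub> \<oplus>\<^bsub>P\<^esub> \<lbrakk>y,z\<rbrakk>\<^bsub>P\<^esub>"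
    and bracket_add_right:
      "\<lbrakk>x \<in> carrier P; y \<in> carrier P; z \<in> carrier P\<rbrakk>
        \<Longrightarrow> \<lbrakk>x, y \<oplus>\<^bsub>P\<^esub> z\<rbrakk>\<^bsub>P\<^esub> = \<lbrakk>x,y\<rbrakk>\<^bsub>P\<^esub> \<oplus>\<^bsub>P\<^esub> \<lbrakk>x,z\<rbrakk>\<^bsub>P\<^esub>"
    and bracket_smult_left:
      "\<lbrakk>a \<in> carrier F; x \<in> carrier P; y \<in> carrier P\<rbrakk>
        \<Longrightarrow> \<lbrakk>a \<odot>\<^bsub>P\<^esub> x, y\<rbrakk>\<^bsub>P\<^esub> = a \<odot>\<^bsub>P\<^esub> \<lbrakk>x,y\<rbrakk>\<^bsub>P\<^esub>"
    and bracket_smult_right: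
      "\<lbrakk>a \<in> carrier F; x \<in> carrier P; y \<in> carrier P\<rbrakk>
        \<Longrightarrow> \<lbrakk>x, a \<odot>\<^bsub>P\<^esub> y\<rbrakk>\<^bsub>P\<^esub> = a \<odot>\<^bsub>P\<^esub> \<lbrakk>x,y\<rbrakk>\<^bsub>P\<^esub>"
    and bracket_alternating: "x \<in> carrier P \<Longrightarrow> \<lbrakk>x,x\<rbrakk>\<^bsub>P\<^esub> = \<zero>\<^bsub>P\<^esub>"
    and jacobi:
      "\<lbrakk>x \<in> carrier P; y \<in> carrier P; z \<in> carrier P\<rbrakk>
        \<Longrightarrow> \<lbrakk>x, \<lbrakk>y,z\<rbrakk>\<^bsub>P\<^esub>\<rbrakk>\<^bsub>P\<^esub> \<oplus>\<^bsub>P\<^esub> \<lbrakk>y, \<lbrakk>z,x\<rbrakk>\<^bsub>P\<^esub>\<rbrakk>\<^bsub>P\<^esub> \<oplus>\<^bsub>P\<^esub> \<lbrakk>z, \<lbrakk>x,y\<rbrakk>\<^bsub>P\<^esub>\<rbrakk>\<^bsub>P\<^esub> = \<zero>\<^bsub>P\<^esub>"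
    and leibniz:
      "\<lbrakk>x \<in> carrier P; y \<in> carrier P; z \<in> carrier P\<rbrakk>
        \<Longrightarrow> \<lbrakk>x \<otimes>\<^bsub>P\<^esub> y, z\<rbrakk>\<^bsub>P\<^esub> = \<lbrakk>x,z\<rbrakk>\<^bsub>P\<^esub> \<otimes>\<^bsub>P\<^esub> y \<oplus>\<^bsub>P\<^esub> x \<otimes>\<^bsub>P\<^esub> \<lbrakk>y,z\<rbrakk>\<^bsub>P\<^esub>"

definition poisson_subalgebra ::
    "('f, 'm) ring_scheme \<Rightarrow> ('f, 'p, 'n) poisson_scheme \<Rightarrow> 'p set \<Rightarrow> bool" where
  "poisson_subalgebra F P S \<longleftrightarrow>
     VectorSpace.subspace F S P \<and> (\<forall>x\<in>S. \<forall>y\<in>S. x \<otimes>\<^bsub>P\<^esub> y \<in> S \<and> \<lbrakk>x,y\<rbrakk>\<^bsub>P\<^esub> \<in> S)"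

definition poisson_ideal ::
    "('f, 'm) ring_scheme \<Rightarrow> ('f, 'p, 'n) poisson_scheme \<Rightarrow> 'p set \<Rightarrow> bool" where
  "poisson_ideal F P I \<longleftrightarrow>
     VectorSpace.subspace F I P \<and>
     (\<forall>x\<in>I. \<forall>y\<in>carrier P. x \<otimes>\<^bsub>P\<^esub> y \<in> I \<and> \<lbrakk>x,y\<rbrakk>\<^bsub>P\<^esub> \<in> I)"

definition poisson_subideal ::
    "('f, 'm) ring_scheme \<Rightarrow> ('f, 'p, 'n) poisson_scheme \<Rightarrow> 'p set \<Rightarrow> bool" where
  "poisson_subideal F P B \<longleftrightarrow>
     (\<exists>r (Bs :: nat \<Rightarrow> 'p set). Bs 0 = B \<and> Bs r = carrier P \<and>
        (\<forall>i\<le>r. poisson_subalgebra F P (Bs i)) \<and>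
        (\<forall>i<r. Bs i \<subseteq> Bs (Suc i) \<and> poisson_ideal F (P\<lparr>carrier := Bs (Suc i)\<rparr>) (Bs i)))"

definition maximal_subalgebra ::
    "('f, 'm) ring_scheme \<Rightarrow> ('f, 'p, 'n) poisson_scheme \<Rightarrow> 'p set \<Rightarrow> bool" where
  "maximal_subalgebra F P M \<longleftrightarrow>
     poisson_subalgebra F P M \<and> M \<noteq> carrier P \<and>
     (\<forall>S. poisson_subalgebra F P S \<longrightarrow> M \<subseteq> S \<longrightarrow> S = M \<or> S = carrier P)"

text \<open>An empty intersection is taken within \<open>P\<close>: a Poisson algebra without maximal
  subalgebras is its own Frattini subalgebra.\<close>

definition frattini_subalgebra ::
    "('f, 'm) ring_scheme \<Rightarrow> ('f, 'p, 'n) poisson_scheme \<Rightarrow> 'p set" where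
  "frattini_subalgebra F P = carrier P \<inter> \<Inter>{M. maximal_subalgebra F P M}"

definition frattini_ideal ::
    "('f, 'm) ring_scheme \<Rightarrow> ('f, 'p, 'n) poisson_scheme \<Rightarrow> 'p set" where
  "frattini_ideal F P = (GREATEST I. poisson_ideal F P I \<and> I \<subseteq> frattini_subalgebra F P)"

definition mult_span ::
    "('f, 'm) ring_scheme \<Rightarrow> ('f, 'p, 'n) poisson_scheme \<Rightarrow> 'p set \<Rightarrow> 'p set \<Rightarrow> 'p set" where
  "mult_span F P S T = module.span F P {x \<otimes>\<^bsub>P\<^esub> y | x y. x \<in> S \<and> y \<in> T}"

definition bracket_span ::
    "('f, 'm) ring_scheme \<Rightarrow> ('f, 'p, 'n) poisson_scheme \<Rightarrow> 'p set \<Rightarrow> 'p set \<Rightarrow> 'p set" where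
  "bracket_span F P S T = module.span F P {\<lbrakk>x,y\<rbrakk>\<^bsub>P\<^esub> | x y. x \<in> S \<and> y \<in> T}"

text \<open>The powers \<open>A\<^sup>n\<close>, \<open>n \<ge> 1\<close>; a sum of subspaces is written as the span of their union.
  The value at \<open>0\<close> is a placeholder and is never used.\<close>

fun poisson_power ::
    "('f, 'm) ring_scheme \<Rightarrow> ('f, 'p, 'n) poisson_scheme \<Rightarrow> nat \<Rightarrow> 'p set" where
  "poisson_power F A 0 = carrier A"
| "poisson_power F A (Suc 0) = carrier A"
| "poisson_power F A (Suc (Suc n)) =
     module.span F A
       (\<Union>i\<in>{1..Suc n}.
          mult_span F A (poisson_power F A i) (poisson_power F A (Suc (Suc n) - i)) \<union>
          bracket_span F A (poisson_power F A i) (poisson_power F A (Suc (Suc n) - i)))"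

definition poisson_nilpotent ::
    "('f, 'm) ring_scheme \<Rightarrow> ('f, 'p, 'n) poisson_scheme \<Rightarrow> bool" where
  "poisson_nilpotent F A \<longleftrightarrow> (\<exists>m\<ge>1. poisson_power F A m = {\<zero>\<^bsub>A\<^esub>})"

definition poisson_supersolvable ::
    "('f, 'm) ring_scheme \<Rightarrow> ('f, 'p, 'n) poisson_scheme \<Rightarrow> bool" where
  "poisson_supersolvable F A \<longleftrightarrow>
     (\<exists>n (As :: nat \<Rightarrow> 'p set). As 0 = {\<zero>\<^bsub>A\<^esub>} \<and> As n = carrier A \<and>
        (\<forall>i<n. As i \<subset> As (Suc i)) \<and>
        (\<forall>i\<in>{1..n}. poisson_ideal F A (As i) \<and>
           vectorspace.fin_dim F (A\<lparr>carrier := As i\<rparr>) \<and>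
           vectorspace.dim F (A\<lparr>carrier := As i\<rparr>) = i))"

definition poisson_quotient ::
    "('f, 'p, 'n) poisson_scheme \<Rightarrow> 'p set \<Rightarrow> ('f, 'p set) poisson" where
  "poisson_quotient P I =
     \<lparr>carrier = a_rcosets\<^bsub>P\<^esub> I, mult = rcoset_mult P I, one = I +>\<^bsub>P\<^esub> \<one>\<^bsub>P\<^esub>,
      zero = I, add = set_add P,
      smult = (\<lambda>a X. \<Union>x\<in>X. I +>\<^bsub>P\<^esub> (a \<odot>\<^bsub>P\<^esub> x)),
      bracket = (\<lambda>X Y. \<Union>x\<in>X. \<Union>y\<in>Y. I +>\<^bsub>P\<^esub> \<lbrakk>x,y\<rbrakk>\<^bsub>P\<^esub>)\<rparr>"

end

theory Submission
  imports Defs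
begin

text \<open>Let \<open>x \<in> B\<close>, and let \<open>T\<close> be one of the two maps \<open>v \<mapsto> x v\<close> and \<open>v \<mapsto> [x,v]\<close> on \<open>P\<close>. The proof
  rests on four ideas.

  \<^item> Nilpotency and supersolvability are conditions on the spectra of multiplications. A
  finite-dimensional Poisson algebra is nilpotent if and only if all its multiplications are
  nilpotent (\<open>poisson_nilpotent_iff\<close>). It is supersolvable if and only if all its multiplications
  have their eigenvalues in \<open>F\<close> and some ideal \<open>K\<close> contains all brackets and acts nilpotently
  (\<open>poisson_supersolvable_iff\<close>). The first is an Engel theorem, the second a Lie-Kolchin theorem:
  multiplications commute on any section of the algebra that \<open>K\<close> annihilates. Both hold over
  every field, since no trace and no division by integers is involved.

  \<^item> Root vectors form a subalgebra. For an additively closed set \<open>L\<close> of scalars, let \<open>S\<close> be the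
  sum of the generalized eigenspaces of \<open>T\<close> with eigenvalue in \<open>L\<close>. It is a subalgebra of
  \<open>P\<close>: if \<open>T = [x,_]\<close>, because \<open>T\<close> is a derivation, and if \<open>T\<close> is the multiplication by \<open>x\<close>, because
  of the Leibniz rule.

  \<^item> Elements of the Frattini ideal are non-generators. The map \<open>T\<close> sends \<open>P\<close> into \<open>B\<close> after
  finitely many steps, because \<open>B\<close> is a subideal. If the hypothesis on \<open>B / C\<close> puts
  the spectrum of \<open>T\<close> on \<open>B / C\<close> into \<open>L\<close>, where \<open>0 \<in> L\<close>, then all of \<open>P\<close> consists of root vectors
  modulo \<open>C\<close>. A Fitting decomposition gives \<open>P = C + S\<close>. As \<open>C\<close> lies in the Frattini ideal, \<open>S = P\<close>,
  so the spectrum of \<open>T\<close> on \<open>P\<close>, and hence on \<open>B\<close>, lies in \<open>L\<close> (\<open>spectrum_in_frattini_lift\<close>).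

  \<^item> Two choices of \<open>L\<close> suffice. With \<open>L = {0}\<close> the spectra of \<open>B / C\<close> lift to those of a nilpotent
  \<open>B\<close>. In the supersolvable case one takes \<open>L = F\<close> for all \<open>x \<in> B\<close>, and \<open>L = {0}\<close> for the \<open>x\<close> in the
  preimage of the ideal \<open>K\<close> of \<open>B / C\<close>.

  The linear algebra is carried out with vectors modulo a subspace instead of quotient spaces, and
  with maximal or minimal subspaces instead of inductions on the dimension.\<close>

section \<open>Subspaces and dimension\<close>

context vectorspace
begin

lemma subspace_iff:
  "VectorSpace.subspace K W V \<longleftrightarrow>
     W \<subseteq> carrier V \<and> \<zero>\<^bsub>V\<^esub> \<in> W \<and> (\<forall>u\<in>W. \<forall>v\<in>W. u \<oplus>\<^bsub>V\<^esub> v \<in> W) \<and> (\<forall>a\<in>carrier K. \<forall>v\<in>W. a \<odot>\<^bsub>V\<^esub> v \<in> W)"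
proof
  assume "VectorSpace.subspace K W V"
  then have "submodule K W V" by simp
  then show "W \<subseteq> carrier V \<and> \<zero>\<^bsub>V\<^esub> \<in> W \<and> (\<forall>u\<in>W. \<forall>v\<in>W. u \<oplus>\<^bsub>V\<^esub> v \<in> W) \<and> (\<forall>a\<in>carrier K. \<forall>v\<in>W. a \<odot>\<^bsub>V\<^esub> v \<in> W)"
    unfolding submodule_def by blast
next
  assume "W \<subseteq> carrier V \<and> \<zero>\<^bsub>V\<^esub> \<in> W \<and> (\<forall>u\<in>W. \<forall>v\<in>W. u \<oplus>\<^bsub>V\<^esub> v \<in> W) \<and> (\<forall>a\<in>carrier K. \<forall>v\<in>W. a \<odot>\<^bsub>V\<^esub> v \<in> W)"
  then show "VectorSpace.subspace K W V"
    unfolding VectorSpace.subspace_def submodule_def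
    using vectorspace_axioms module_axioms by blast
qed

lemma subspaceI:
  assumes "W \<subseteq> carrier V" and "\<zero>\<^bsub>V\<^esub> \<in> W"
    and "\<And>u v. u \<in> W \<Longrightarrow> v \<in> W \<Longrightarrow> u \<oplus>\<^bsub>V\<^esub> v \<in> W"
    and "\<And>a v. a \<in> carrier K \<Longrightarrow> v \<in> W \<Longrightarrow> a \<odot>\<^bsub>V\<^esub> v \<in> W"
  shows "VectorSpace.subspace K W V"
  using assms by (auto simp: subspace_iff)

lemma subspaceD:
  assumes "VectorSpace.subspace K W V"
  shows "W \<subseteq> carrier V" and "\<zero>\<^bsub>V\<^esub> \<in> W"
    and "u \<in> W \<Longrightarrow> v \<in> W \<Longrightarrow> u \<oplus>\<^bsub>V\<^esub> v \<in> W"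
    and "a \<in> carrier K \<Longrightarrow> v \<in> W \<Longrightarrow> a \<odot>\<^bsub>V\<^esub> v \<in> W"
    and "v \<in> W \<Longrightarrow> v \<in> carrier V"
  using assms by (auto simp: subspace_iff)

lemma subspace_uminus:
  assumes "VectorSpace.subspace K W V" "v \<in> W"
  shows "\<ominus>\<^bsub>V\<^esub> v \<in> W"
proof -
  have "(\<ominus>\<^bsub>K\<^esub> \<one>\<^bsub>K\<^esub>) \<odot>\<^bsub>V\<^esub> v \<in> W"
    by (intro subspaceD(4)[OF assms(1)] assms(2) R.add.inv_closed R.one_closed)
  then show ?thesis
    using subspaceD(5)[OF assms] by (simp add: smult_l_minus)
qed

text \<open>Stands in for subtraction in most calculations below, which show that a sum and one of its
  summands lie in a subspace in order to conclude the same of the other summand.\<close>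

lemma subspace_cancel_left:
  assumes W: "VectorSpace.subspace K W V" and ab: "a \<oplus>\<^bsub>V\<^esub> b \<in> W" and a: "a \<in> W" and b: "b \<in> carrier V"
  shows "b \<in> W"
proof -
  have "\<ominus>\<^bsub>V\<^esub> a \<oplus>\<^bsub>V\<^esub> (a \<oplus>\<^bsub>V\<^esub> b) \<in> W"
    by (intro subspaceD(3)[OF W] subspace_uminus[OF W a] ab)
  then show ?thesis
    using subspaceD(5)[OF W a] b by (simp add: M.r_neg1)
qed

lemma subspace_cancel_right:
  assumes "VectorSpace.subspace K W V" and "a \<oplus>\<^bsub>V\<^esub> b \<in> W" and "b \<in> W" and "a \<in> carrier V"
  shows "a \<in> W"
  using subspace_cancel_left[OF assms(1) _ assms(3,4)] assms subspaceD(5)[OF assms(1,3)]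
  by (simp add: M.a_comm)

lemma subspace_zero: "VectorSpace.subspace K {\<zero>\<^bsub>V\<^esub>} V"
  by (rule subspaceI) auto

lemma subspace_carrier: "VectorSpace.subspace K (carrier V) V"
  by (rule subspaceI) auto

lemma subspace_Inter:
  assumes "\<And>W. W \<in> Ws \<Longrightarrow> VectorSpace.subspace K W V"
  shows "VectorSpace.subspace K (carrier V \<inter> \<Inter>Ws) V"
  using assms by (auto simp: subspace_iff)

definition adjoin :: "'c set \<Rightarrow> 'c \<Rightarrow> 'c set" where
  "adjoin U v = {u \<oplus>\<^bsub>V\<^esub> a \<odot>\<^bsub>V\<^esub> v | u a. u \<in> U \<and> a \<in> carrier K}"

lemma adjoin_subspace:
  assumes U: "VectorSpace.subspace K U V" and v: "v \<in> carrier V"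
  shows "VectorSpace.subspace K (adjoin U v) V"
proof (rule subspaceI)
  show "adjoin U v \<subseteq> carrier V"
    using subspaceD(1)[OF U] v by (auto simp: adjoin_def)
  have "\<zero>\<^bsub>V\<^esub> = \<zero>\<^bsub>V\<^esub> \<oplus>\<^bsub>V\<^esub> \<zero>\<^bsub>K\<^esub> \<odot>\<^bsub>V\<^esub> v" using v by simp
  then show "\<zero>\<^bsub>V\<^esub> \<in> adjoin U v"
    unfolding adjoin_def using subspaceD(2)[OF U] by blast
next
  fix x y assume "x \<in> adjoin U v" "y \<in> adjoin U v"
  then obtain u a u' b where *: "x = u \<oplus>\<^bsub>V\<^esub> a \<odot>\<^bsub>V\<^esub> v" "y = u' \<oplus>\<^bsub>V\<^esub> b \<odot>\<^bsub>V\<^esub> v"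
      "u \<in> U" "u' \<in> U" "a \<in> carrier K" "b \<in> carrier K"
    unfolding adjoin_def by blast
  then have "x \<oplus>\<^bsub>V\<^esub> y = (u \<oplus>\<^bsub>V\<^esub> u') \<oplus>\<^bsub>V\<^esub> (a \<oplus>\<^bsub>K\<^esub> b) \<odot>\<^bsub>V\<^esub> v"
    using subspaceD(5)[OF U] v by (simp add: smult_l_distr M.a_ac)
  then show "x \<oplus>\<^bsub>V\<^esub> y \<in> adjoin U v"
    unfolding adjoin_def using * subspaceD(3)[OF U] by blast
next
  fix c x assume c: "c \<in> carrier K" and "x \<in> adjoin U v"
  then obtain u a where *: "x = u \<oplus>\<^bsub>V\<^esub> a \<odot>\<^bsub>V\<^esub> v" "u \<in> U" "a \<in> carrier K"
    unfolding adjoin_def by blast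
  then have "c \<odot>\<^bsub>V\<^esub> x = c \<odot>\<^bsub>V\<^esub> u \<oplus>\<^bsub>V\<^esub> (c \<otimes>\<^bsub>K\<^esub> a) \<odot>\<^bsub>V\<^esub> v"
    using subspaceD(5)[OF U] v c by (simp add: smult_r_distr smult_assoc1)
  then show "c \<odot>\<^bsub>V\<^esub> x \<in> adjoin U v"
    unfolding adjoin_def using * c subspaceD(4)[OF U] by blast
qed

lemma adjoin_contains:
  assumes U: "VectorSpace.subspace K U V" and v: "v \<in> carrier V"
  shows "U \<subseteq> adjoin U v" and "v \<in> adjoin U v"
proof -
  show "U \<subseteq> adjoin U v"
  proof
    fix u assume u: "u \<in> U"
    then have "u = u \<oplus>\<^bsub>V\<^esub> \<zero>\<^bsub>K\<^esub> \<odot>\<^bsub>V\<^esub> v" using subspaceD(5)[OF U] v by simp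
    then show "u \<in> adjoin U v" unfolding adjoin_def using u by blast
  qed
  have "v = \<zero>\<^bsub>V\<^esub> \<oplus>\<^bsub>V\<^esub> \<one>\<^bsub>K\<^esub> \<odot>\<^bsub>V\<^esub> v" using v by simp
  then show "v \<in> adjoin U v" unfolding adjoin_def using subspaceD(2)[OF U] by blast
qed

lemma adjoin_least:
  assumes "VectorSpace.subspace K W V" "U \<subseteq> W" "v \<in> W"
  shows "adjoin U v \<subseteq> W"
  using assms subspaceD(3,4)[OF assms(1)] by (auto simp: adjoin_def)

text \<open>A maximal linearly independent subset of a subspace spans it, and a finite-dimensional
  space bounds the size of such subsets.\<close>

lemma subspace_has_basis:
  assumes fin: fin_dim and U: "VectorSpace.subspace K U V"
  shows "\<exists>A. finite A \<and> A \<subseteq> U \<and> lin_indpt A \<and> span A = U"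
proof -
  interpret U: vectorspace K "vs U" using subspace_is_vs[OF U] .
  have sm: "submodule K U V" using U by simp
  have "\<And>A. A \<subseteq> U \<and> lin_indpt A \<Longrightarrow> finite A \<and> card A \<le> dim"
    using li_le_dim[OF fin] subspaceD(1)[OF U] by blast
  moreover have "{} \<subseteq> U \<and> lin_indpt {}" by (simp add: lin_dep_def)
  ultimately obtain A where A: "finite A" "maximal A (\<lambda>S. S \<subseteq> U \<and> lin_indpt S)"
    using maximal_exists[of "\<lambda>S. S \<subseteq> U \<and> lin_indpt S" dim "{}"] by blast
  have "maximal A (\<lambda>S. S \<subseteq> carrier (vs U) \<and> U.lin_indpt S)"
    using A(2) span_li_not_depend(2)[OF _ sm] unfolding maximal_def by auto
  then have "U.span A = U" using U.max_li_is_gen by simp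
  moreover have "A \<subseteq> U" "lin_indpt A" using A(2) unfolding maximal_def by auto
  ultimately show ?thesis
    using A(1) span_li_not_depend(1)[OF _ sm] by metis
qed

lemma dim_subspace_eq_card:
  assumes U: "VectorSpace.subspace K U V"
    and A: "finite A" "A \<subseteq> U" "lin_indpt A" "span A = U"
  shows "vectorspace.fin_dim K (vs U)" and "vectorspace.dim K (vs U) = card A"
proof -
  interpret U: vectorspace K "vs U" using subspace_is_vs[OF U] .
  have sm: "submodule K U V" using U by simp
  have "U.span A = U" using span_li_not_depend(1)[OF A(2) sm] A(4) by simp
  moreover have "U.lin_indpt A" using span_li_not_depend(2)[OF A(2) sm] A(3) by simp
  ultimately have "U.basis A" using A(2) by (simp add: U.basis_def)
  then show "vectorspace.dim K (vs U) = card A" using U.dim_basis A(1) by blast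
  show "vectorspace.fin_dim K (vs U)"
    unfolding U.fin_dim_def using A(1,2) \<open>U.span A = U\<close> by auto
qed

lemma dim_zero_subspace:
  shows "vectorspace.fin_dim K (vs {\<zero>\<^bsub>V\<^esub>})" and "vectorspace.dim K (vs {\<zero>\<^bsub>V\<^esub>}) = 0"
proof -
  have li: "lin_indpt {}" by (simp add: lin_dep_def)
  show "vectorspace.fin_dim K (vs {\<zero>\<^bsub>V\<^esub>})"
    using dim_subspace_eq_card(1)[OF subspace_zero _ _ li] span_empty by simp
  show "vectorspace.dim K (vs {\<zero>\<^bsub>V\<^esub>}) = 0"
    using dim_subspace_eq_card(2)[OF subspace_zero _ _ li] span_empty by simp
qed

lemma dim_adjoin:
  assumes fin: fin_dim and U: "VectorSpace.subspace K U V" and v: "v \<in> carrier V" "v \<notin> U"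
  shows "vectorspace.fin_dim K (vs (adjoin U v))"
    and "vectorspace.dim K (vs (adjoin U v)) = Suc (vectorspace.dim K (vs U))"
proof -
  obtain A where A: "finite A" "A \<subseteq> U" "lin_indpt A" "span A = U"
    using subspace_has_basis[OF fin U] by blast
  have AV: "A \<subseteq> carrier V" using A(2) subspaceD(1)[OF U] by blast
  have vA: "v \<notin> A" using A(2) v(2) by blast
  have li: "lin_indpt (A \<union> {v})"
    using lin_dep_iff_in_span[OF AV A(3) v(1) vA] A(4) v(2) by blast
  have sub: "VectorSpace.subspace K (adjoin U v) V" using adjoin_subspace[OF U v(1)] .
  have Av: "A \<union> {v} \<subseteq> adjoin U v" using adjoin_contains[OF U v(1)] A(2) by blast
  have AvV: "A \<union> {v} \<subseteq> carrier V" using AV v(1) by simp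
  have "span (A \<union> {v}) \<subseteq> adjoin U v" using span_is_subset[OF Av] sub by simp
  moreover have "adjoin U v \<subseteq> span (A \<union> {v})"
    using adjoin_least[OF span_is_subspace[OF AvV]] span_is_monotone[of A "A \<union> {v}"]
      in_own_span[OF AvV] A(4) by blast
  ultimately have sp: "span (A \<union> {v}) = adjoin U v" by blast
  show "vectorspace.fin_dim K (vs (adjoin U v))"
    using dim_subspace_eq_card(1)[OF sub _ Av li sp] A(1) by simp
  show "vectorspace.dim K (vs (adjoin U v)) = Suc (vectorspace.dim K (vs U))"
    using dim_subspace_eq_card(2)[OF sub _ Av li sp] dim_subspace_eq_card(2)[OF U A] A(1) vA
    by simp
qed

lemma dim_subspace_mono:
  assumes fin: fin_dim and U: "VectorSpace.subspace K U V" and W: "VectorSpace.subspace K W V"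
    and UW: "U \<subseteq> W"
  shows "vectorspace.dim K (vs U) \<le> vectorspace.dim K (vs W)"
proof -
  interpret W: vectorspace K "vs W" using subspace_is_vs[OF W] .
  have sm: "submodule K W V" using W by simp
  obtain A where A: "finite A" "A \<subseteq> U" "lin_indpt A" "span A = U"
    using subspace_has_basis[OF fin U] by blast
  obtain A' where A': "finite A'" "A' \<subseteq> W" "lin_indpt A'" "span A' = W"
    using subspace_has_basis[OF fin W] by blast
  have AW: "A \<subseteq> W" using A(2) UW by blast
  have "W.lin_indpt A" using span_li_not_depend(2)[OF AW sm] A(3) by simp
  then have "card A \<le> W.dim"
    using W.li_le_dim(2)[OF dim_subspace_eq_card(1)[OF W A']] AW by simp
  then show ?thesis using dim_subspace_eq_card(2)[OF U A] by simp
qed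

lemma dim_subspace_strict_mono:
  assumes fin: fin_dim and U: "VectorSpace.subspace K U V" and W: "VectorSpace.subspace K W V"
    and UW: "U \<subset> W"
  shows "vectorspace.dim K (vs U) < vectorspace.dim K (vs W)"
proof -
  obtain v where v: "v \<in> W" "v \<notin> U" using UW by blast
  have vV: "v \<in> carrier V" using subspaceD(5)[OF W v(1)] .
  have "vectorspace.dim K (vs (adjoin U v)) \<le> vectorspace.dim K (vs W)"
    using dim_subspace_mono[OF fin adjoin_subspace[OF U vV] W] adjoin_least[OF W _ v(1)] UW
    by blast
  then show ?thesis using dim_adjoin(2)[OF fin U vV v(2)] by simp
qed

lemma codimension_one_eq_adjoin:
  assumes fin: fin_dim and U: "VectorSpace.subspace K U V" and W: "VectorSpace.subspace K W V"
    and UW: "U \<subset> W" and dim: "vectorspace.dim K (vs W) = Suc (vectorspace.dim K (vs U))"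
  shows "\<exists>v\<in>W. W = adjoin U v"
proof -
  obtain v where v: "v \<in> W" "v \<notin> U" using UW by blast
  have vV: "v \<in> carrier V" using subspaceD(5)[OF W v(1)] .
  have "adjoin U v \<subseteq> W" using adjoin_least[OF W _ v(1)] UW by blast
  moreover have "\<not> adjoin U v \<subset> W"
    using dim_subspace_strict_mono[OF fin adjoin_subspace[OF U vV] W]
      dim_adjoin(2)[OF fin U vV v(2)] dim by fastforce
  ultimately show ?thesis using v(1) by blast
qed

text \<open>The two chain conditions, in the form in which finite dimension is mostly used below: a
  subspace of largest or of smallest dimension with the property \<open>Q\<close> is maximal or minimal.\<close>

lemma exists_maximal_subspace:
  assumes fin: fin_dim and "Q U\<^sub>0" and sub: "\<And>U. Q U \<Longrightarrow> VectorSpace.subspace K U V"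
  shows "\<exists>U. Q U \<and> (\<forall>W. Q W \<longrightarrow> U \<subseteq> W \<longrightarrow> W = U)"
proof -
  have "\<forall>U. Q U \<longrightarrow> vectorspace.dim K (vs U) < Suc (vectorspace.dim K (vs (carrier V)))"
    using dim_subspace_mono[OF fin sub subspace_carrier] subspaceD(1)[OF sub] by (simp add: less_Suc_eq_le)
  then obtain U where "Q U" and U: "\<forall>W. Q W \<longrightarrow> vectorspace.dim K (vs W) \<le> vectorspace.dim K (vs U)"
    using ex_has_greatest_nat[of Q U\<^sub>0 "\<lambda>U. vectorspace.dim K (vs U)"
        "Suc (vectorspace.dim K (vs (carrier V)))"] \<open>Q U\<^sub>0\<close> by blast
  have "\<forall>W. Q W \<longrightarrow> U \<subseteq> W \<longrightarrow> W = U"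
  proof (intro allI impI)
    fix W assume "Q W" "U \<subseteq> W"
    then show "W = U"
      using dim_subspace_strict_mono[OF fin sub[OF \<open>Q U\<close>] sub[OF \<open>Q W\<close>]] U leD by blast
  qed
  then show ?thesis using \<open>Q U\<close> by blast
qed

lemma exists_minimal_subspace:
  assumes fin: fin_dim and "Q U\<^sub>0" and sub: "\<And>U. Q U \<Longrightarrow> VectorSpace.subspace K U V"
  shows "\<exists>U. Q U \<and> (\<forall>W. Q W \<longrightarrow> W \<subseteq> U \<longrightarrow> W = U)"
proof -
  obtain U where "Q U" and U: "\<forall>W. Q W \<longrightarrow> vectorspace.dim K (vs U) \<le> vectorspace.dim K (vs W)"
    using ex_has_least_nat[of Q U\<^sub>0 "\<lambda>U. vectorspace.dim K (vs U)"] \<open>Q U\<^sub>0\<close> by auto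
  have "\<forall>W. Q W \<longrightarrow> W \<subseteq> U \<longrightarrow> W = U"
  proof (intro allI impI)
    fix W assume "Q W" "W \<subseteq> U"
    then show "W = U"
      using dim_subspace_strict_mono[OF fin sub[OF \<open>Q W\<close>] sub[OF \<open>Q U\<close>]] U leD by blast
  qed
  then show ?thesis using \<open>Q U\<close> by blast
qed

end

section \<open>Root spaces of a linear map modulo a subspace\<close>

text \<open>If \<open>U\<close> is invariant under \<open>T\<close>, this is the preimage of the sum, over the scalars \<open>l \<in> L\<close>, of
  the generalized eigenspaces of the map that \<open>T\<close> induces modulo \<open>U\<close>. A vector belongs to it if some
  product of factors \<open>T - l\<close> sends it into \<open>U\<close>; in the inductive form this needs neither polynomials
  in \<open>T\<close> nor quotient spaces. The step is written \<open>T v = l v + w\<close> to keep subtraction out of the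
  calculations.\<close>

inductive_set root_space ::
    "('a, 'c, 'd) module_scheme \<Rightarrow> ('c \<Rightarrow> 'c) \<Rightarrow> 'a set \<Rightarrow> 'c set \<Rightarrow> 'c set"
  for V T L U where
  base: "v \<in> U \<Longrightarrow> v \<in> root_space V T L U"
| step: "v \<in> carrier V \<Longrightarrow> l \<in> L \<Longrightarrow> w \<in> root_space V T L U \<Longrightarrow> T v = l \<odot>\<^bsub>V\<^esub> v \<oplus>\<^bsub>V\<^esub> w
         \<Longrightarrow> v \<in> root_space V T L U"

lemma root_space_mono:
  assumes "v \<in> root_space V T L U" "L \<subseteq> L'" "U \<subseteq> U'"
  shows "v \<in> root_space V T L' U'"
  using assms(1)
proof induction
  case (base v)
  then show ?case using assms(3) by (blast intro: root_space.base)
next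
  case (step v l w)
  then show ?case using assms(2) by (blast intro: root_space.step)
qed

lemma root_space_trans:
  assumes "v \<in> root_space V T L U" "U \<subseteq> root_space V T L U'"
  shows "v \<in> root_space V T L U'"
  using assms(1)
proof induction
  case (base v)
  then show ?case using assms(2) by blast
next
  case (step v l w)
  then show ?case by (blast intro: root_space.step)
qed

context vectorspace
begin

lemma root_space_in_carrier:
  "v \<in> root_space V T L U \<Longrightarrow> U \<subseteq> carrier V \<Longrightarrow> v \<in> carrier V"
  by (induction rule: root_space.induct) auto

lemma smult_left_commute:
  assumes "a \<in> carrier K" "b \<in> carrier K" "v \<in> carrier V"
  shows "a \<odot>\<^bsub>V\<^esub> (b \<odot>\<^bsub>V\<^esub> v) = b \<odot>\<^bsub>V\<^esub> (a \<odot>\<^bsub>V\<^esub> v)"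
  using assms by (simp add: smult_assoc1[symmetric] R.m_comm)

lemma add_exchange:
  assumes "p \<in> carrier V" "q \<in> carrier V" "r \<in> carrier V" "s \<in> carrier V"
  shows "(p \<oplus>\<^bsub>V\<^esub> q) \<oplus>\<^bsub>V\<^esub> (r \<oplus>\<^bsub>V\<^esub> s) = (p \<oplus>\<^bsub>V\<^esub> r) \<oplus>\<^bsub>V\<^esub> (q \<oplus>\<^bsub>V\<^esub> s)"
  using assms by (simp add: M.a_ac)

lemma add_diff_cancel:
  assumes "v \<in> carrier V" "w \<in> carrier V"
  shows "w \<oplus>\<^bsub>V\<^esub> (v \<oplus>\<^bsub>V\<^esub> \<ominus>\<^bsub>V\<^esub> w) = v"
proof -
  have "w \<oplus>\<^bsub>V\<^esub> (v \<oplus>\<^bsub>V\<^esub> \<ominus>\<^bsub>V\<^esub> w) = v \<oplus>\<^bsub>V\<^esub> (w \<oplus>\<^bsub>V\<^esub> \<ominus>\<^bsub>V\<^esub> w)" using assms by (intro M.a_lcomm) auto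
  then show ?thesis using assms by (simp add: M.r_neg)
qed

lemma module_hom_zero:
  assumes "T \<in> module_hom K V V"
  shows "T \<zero>\<^bsub>V\<^esub> = \<zero>\<^bsub>V\<^esub>"
proof -
  interpret mod_hom K V V T using assms by unfold_locales
  show ?thesis by simp
qed

lemma root_space_smult:
  assumes T: "T \<in> module_hom K V V" and U: "VectorSpace.subspace K U V"
    and L: "L \<subseteq> carrier K" and a: "a \<in> carrier K" and v: "v \<in> root_space V T L U"
  shows "a \<odot>\<^bsub>V\<^esub> v \<in> root_space V T L U"
  using v
proof induction
  case (base v)
  then show ?case using subspaceD(4)[OF U a] by (blast intro: root_space.base)
next
  case (step v l w)
  have w: "w \<in> carrier V" using root_space_in_carrier[OF step(3)] subspaceD(1)[OF U] by blast
  have l: "l \<in> carrier K" using step L by blast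
  have "T (a \<odot>\<^bsub>V\<^esub> v) = a \<odot>\<^bsub>V\<^esub> (l \<odot>\<^bsub>V\<^esub> v \<oplus>\<^bsub>V\<^esub> w)"
    using step module_hom_smult[OF T a] by simp
  also have "\<dots> = a \<odot>\<^bsub>V\<^esub> (l \<odot>\<^bsub>V\<^esub> v) \<oplus>\<^bsub>V\<^esub> a \<odot>\<^bsub>V\<^esub> w" using a l step w by (simp add: smult_r_distr)
  also have "a \<odot>\<^bsub>V\<^esub> (l \<odot>\<^bsub>V\<^esub> v) = l \<odot>\<^bsub>V\<^esub> (a \<odot>\<^bsub>V\<^esub> v)"
    using a l step by (simp add: smult_left_commute[of a l])
  finally show ?case using step a by (blast intro: root_space.step)
qed

lemma root_space_shift:
  assumes T: "T \<in> module_hom K V V" and U: "VectorSpace.subspace K U V"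
    and inv: "\<And>u. u \<in> U \<Longrightarrow> T u \<in> U"
    and L: "L \<subseteq> carrier K" and a: "a \<in> carrier K" and v: "v \<in> root_space V T L U"
  shows "T v \<oplus>\<^bsub>V\<^esub> a \<odot>\<^bsub>V\<^esub> v \<in> root_space V T L U"
  using v
proof induction
  case (base v)
  then show ?case
    using subspaceD(3)[OF U inv[OF base]] subspaceD(4)[OF U a base] by (blast intro: root_space.base)
next
  case (step v l w)
  have w: "w \<in> carrier V" using root_space_in_carrier[OF step(3)] subspaceD(1)[OF U] by blast
  have l: "l \<in> carrier K" using step L by blast
  have TV: "T v \<in> carrier V" "T w \<in> carrier V" using module_hom_closed[OF T] step w by blast+
  have "T (T v \<oplus>\<^bsub>V\<^esub> a \<odot>\<^bsub>V\<^esub> v) = T (T v) \<oplus>\<^bsub>V\<^esub> a \<odot>\<^bsub>V\<^esub> T v"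
    using module_hom_add[OF T, of "T v" "a \<odot>\<^bsub>V\<^esub> v"] module_hom_smult[OF T a] step TV a by simp
  also have "T (T v) = l \<odot>\<^bsub>V\<^esub> T v \<oplus>\<^bsub>V\<^esub> T w"
    using module_hom_add[OF T, of "l \<odot>\<^bsub>V\<^esub> v" w] module_hom_smult[OF T l] step w l by simp
  also have "a \<odot>\<^bsub>V\<^esub> T v = l \<odot>\<^bsub>V\<^esub> (a \<odot>\<^bsub>V\<^esub> v) \<oplus>\<^bsub>V\<^esub> a \<odot>\<^bsub>V\<^esub> w"
  proof -
    have "a \<odot>\<^bsub>V\<^esub> T v = a \<odot>\<^bsub>V\<^esub> (l \<odot>\<^bsub>V\<^esub> v) \<oplus>\<^bsub>V\<^esub> a \<odot>\<^bsub>V\<^esub> w"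
      using step a l w by (simp add: smult_r_distr)
    also have "a \<odot>\<^bsub>V\<^esub> (l \<odot>\<^bsub>V\<^esub> v) = l \<odot>\<^bsub>V\<^esub> (a \<odot>\<^bsub>V\<^esub> v)"
      using a l step(1) by (simp add: smult_left_commute[of a l])
    finally show ?thesis .
  qed
  finally have "T (T v \<oplus>\<^bsub>V\<^esub> a \<odot>\<^bsub>V\<^esub> v) = l \<odot>\<^bsub>V\<^esub> (T v \<oplus>\<^bsub>V\<^esub> a \<odot>\<^bsub>V\<^esub> v) \<oplus>\<^bsub>V\<^esub> (T w \<oplus>\<^bsub>V\<^esub> a \<odot>\<^bsub>V\<^esub> w)"
    using TV a l step(1) w add_exchange[of "l \<odot>\<^bsub>V\<^esub> T v" "T w" "l \<odot>\<^bsub>V\<^esub> (a \<odot>\<^bsub>V\<^esub> v)" "a \<odot>\<^bsub>V\<^esub> w"]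
    by (simp add: smult_r_distr)
  then show ?case
    using root_space.step[of "T v \<oplus>\<^bsub>V\<^esub> a \<odot>\<^bsub>V\<^esub> v" V l L "T w \<oplus>\<^bsub>V\<^esub> a \<odot>\<^bsub>V\<^esub> w" T U] step.hyps(1,2) step.IH TV a
    by (metis M.add.m_closed smult_closed)
qed

text \<open>The difference between \<open>(T - l) (u + v)\<close> and \<open>(T - l) v\<close> is \<open>(T - l) u\<close>, again a root vector by
  the preceding lemma. Hence a chain for \<open>v\<close> is followed while the other summand changes.\<close>

lemma root_space_add:
  assumes T: "T \<in> module_hom K V V" and U: "VectorSpace.subspace K U V"
    and inv: "\<And>u. u \<in> U \<Longrightarrow> T u \<in> U"
    and L: "L \<subseteq> carrier K" and u: "u \<in> root_space V T L U" and v: "v \<in> root_space V T L U"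
  shows "u \<oplus>\<^bsub>V\<^esub> v \<in> root_space V T L U"
proof -
  note UV = subspaceD(1)[OF U]
  have eq: "T (u \<oplus>\<^bsub>V\<^esub> v) = l \<odot>\<^bsub>V\<^esub> (u \<oplus>\<^bsub>V\<^esub> v) \<oplus>\<^bsub>V\<^esub> ((T u \<oplus>\<^bsub>V\<^esub> (\<ominus>\<^bsub>K\<^esub> l) \<odot>\<^bsub>V\<^esub> u) \<oplus>\<^bsub>V\<^esub> w)"
    if *: "u \<in> carrier V" "v \<in> carrier V" "w \<in> carrier V" "l \<in> carrier K" "T v = l \<odot>\<^bsub>V\<^esub> v \<oplus>\<^bsub>V\<^esub> w"
    for u v w l
  proof -
    have Tu: "T u \<in> carrier V" using module_hom_closed[OF T] *(1) by blast
    have cancel: "p \<oplus>\<^bsub>V\<^esub> (\<ominus>\<^bsub>V\<^esub> p \<oplus>\<^bsub>V\<^esub> q) = q" if "p \<in> carrier V" "q \<in> carrier V" for p q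
      using that by (simp add: M.r_neg2)
    have "l \<odot>\<^bsub>V\<^esub> (u \<oplus>\<^bsub>V\<^esub> v) \<oplus>\<^bsub>V\<^esub> ((T u \<oplus>\<^bsub>V\<^esub> \<ominus>\<^bsub>V\<^esub> (l \<odot>\<^bsub>V\<^esub> u)) \<oplus>\<^bsub>V\<^esub> w)
        = l \<odot>\<^bsub>V\<^esub> u \<oplus>\<^bsub>V\<^esub> (\<ominus>\<^bsub>V\<^esub> (l \<odot>\<^bsub>V\<^esub> u) \<oplus>\<^bsub>V\<^esub> (T u \<oplus>\<^bsub>V\<^esub> (l \<odot>\<^bsub>V\<^esub> v \<oplus>\<^bsub>V\<^esub> w)))"
      using *(1-4) Tu by (simp add: smult_r_distr M.a_ac)
    also have "\<dots> = T u \<oplus>\<^bsub>V\<^esub> (l \<odot>\<^bsub>V\<^esub> v \<oplus>\<^bsub>V\<^esub> w)" using * Tu by (intro cancel) auto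
    finally have "l \<odot>\<^bsub>V\<^esub> (u \<oplus>\<^bsub>V\<^esub> v) \<oplus>\<^bsub>V\<^esub> ((T u \<oplus>\<^bsub>V\<^esub> \<ominus>\<^bsub>V\<^esub> (l \<odot>\<^bsub>V\<^esub> u)) \<oplus>\<^bsub>V\<^esub> w) = T u \<oplus>\<^bsub>V\<^esub> (l \<odot>\<^bsub>V\<^esub> v \<oplus>\<^bsub>V\<^esub> w)" .
    with * show ?thesis
      using module_hom_add[OF T *(1,2)] by (simp add: smult_l_minus)
  qed
  have base_add: "\<forall>u\<in>U. u \<oplus>\<^bsub>V\<^esub> v \<in> root_space V T L U" if "v \<in> root_space V T L U" for v
    using that
  proof induction
    case (base v)
    then show ?case using subspaceD(3)[OF U] by (blast intro: root_space.base)
  next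
    case (step v l w)
    show ?case
    proof
      fix u assume u: "u \<in> U"
      have l: "l \<in> carrier K" using step L by blast
      have w: "w \<in> carrier V" using root_space_in_carrier[OF step(3) UV] .
      have "T u \<oplus>\<^bsub>V\<^esub> (\<ominus>\<^bsub>K\<^esub> l) \<odot>\<^bsub>V\<^esub> u \<in> U"
        by (intro subspaceD(3,4)[OF U] inv u R.add.inv_closed l)
      then have "(T u \<oplus>\<^bsub>V\<^esub> (\<ominus>\<^bsub>K\<^esub> l) \<odot>\<^bsub>V\<^esub> u) \<oplus>\<^bsub>V\<^esub> w \<in> root_space V T L U"
        using step by blast
      then show "u \<oplus>\<^bsub>V\<^esub> v \<in> root_space V T L U"
        using eq[OF _ step(1) w l step(4)] u UV step(1,2) by (blast intro: root_space.step)
    qed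
  qed
  from v show ?thesis
    using u
  proof (induction arbitrary: u)
    case (base v)
    then have "v \<oplus>\<^bsub>V\<^esub> u \<in> root_space V T L U" using base_add by blast
    then show ?case
      using base UV root_space_in_carrier[OF base(2) UV] M.a_comm[of u v] by auto
  next
    case (step v l w)
    have l: "l \<in> carrier K" using step L by blast
    have w: "w \<in> carrier V" using root_space_in_carrier[OF step(3) UV] .
    have u: "u \<in> carrier V" using root_space_in_carrier[OF step.prems UV] .
    have "T u \<oplus>\<^bsub>V\<^esub> (\<ominus>\<^bsub>K\<^esub> l) \<odot>\<^bsub>V\<^esub> u \<in> root_space V T L U"
      using root_space_shift[OF T U inv L _ step.prems] l by simp
    then have "(T u \<oplus>\<^bsub>V\<^esub> (\<ominus>\<^bsub>K\<^esub> l) \<odot>\<^bsub>V\<^esub> u) \<oplus>\<^bsub>V\<^esub> w \<in> root_space V T L U"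
      using step.IH by blast
    then show ?case
      using eq[OF u step(1) w l step(4)] u step(1,2) by (blast intro: root_space.step)
  qed
qed

lemma root_space_subspace:
  assumes T: "T \<in> module_hom K V V" and U: "VectorSpace.subspace K U V"
    and inv: "\<And>u. u \<in> U \<Longrightarrow> T u \<in> U" and L: "L \<subseteq> carrier K"
  shows "VectorSpace.subspace K (root_space V T L U) V"
proof (rule subspaceI)
  show "root_space V T L U \<subseteq> carrier V"
    using root_space_in_carrier subspaceD(1)[OF U] by blast
  show "\<zero>\<^bsub>V\<^esub> \<in> root_space V T L U"
    using subspaceD(2)[OF U] by (rule root_space.base)
qed (use root_space_add[OF T U inv L] root_space_smult[OF T U L] in blast)+

text \<open>The last vector outside \<open>U\<close> that is met on the way from \<open>v\<close> into \<open>U\<close> is an eigenvector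
  modulo \<open>U\<close>; it lies in every invariant subspace that contains \<open>v\<close>.\<close>

lemma root_space_eigenvector:
  assumes v: "v \<in> root_space V T L U" "v \<notin> U" "v \<in> W"
    and L: "L \<subseteq> carrier K" and U: "VectorSpace.subspace K U V"
    and W: "VectorSpace.subspace K W V" and inv: "\<And>w. w \<in> W \<Longrightarrow> T w \<in> W"
  shows "\<exists>w\<in>W - U. \<exists>l\<in>L. \<exists>u\<in>U. T w = l \<odot>\<^bsub>V\<^esub> w \<oplus>\<^bsub>V\<^esub> u"
  using v
proof induction
  case (base v)
  then show ?case by blast
next
  case (step v l w)
  have "w \<in> carrier V" using root_space_in_carrier[OF step(3)] subspaceD(1)[OF U] by blast
  moreover have "l \<odot>\<^bsub>V\<^esub> v \<in> W" using subspaceD(4)[OF W] step L by blast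
  ultimately have "w \<in> W"
    using subspace_cancel_left[OF W, of "l \<odot>\<^bsub>V\<^esub> v" w] inv[OF \<open>v \<in> W\<close>] step(4) by simp
  then show ?case using step by blast
qed

text \<open>A form of Fitting's decomposition. Among the invariant subspaces \<open>D\<close> of \<open>C\<close> modulo which the
  root vectors modulo \<open>C\<close> are still root vectors, take a minimal one. For \<open>l \<in> L\<close> the subspace
  \<open>(T - l) D\<close> has the same properties, so \<open>(T - l) D = D\<close>. When a chain of factors \<open>T - l\<close> leads a
  vector into \<open>D\<close>, one can therefore subtract an element of \<open>D\<close> at each stage, so that the
  chain ends in zero.\<close>

lemma root_space_decompose:
  assumes fin: fin_dim and T: "T \<in> module_hom K V V" and L: "L \<subseteq> carrier K"
    and C: "VectorSpace.subspace K C V" and inv: "\<And>c. c \<in> C \<Longrightarrow> T c \<in> C"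
    and v: "v \<in> root_space V T L C"
  shows "\<exists>c\<in>C. \<exists>s\<in>root_space V T L {\<zero>\<^bsub>V\<^esub>}. v = c \<oplus>\<^bsub>V\<^esub> s"
proof -
  define Q where "Q D \<longleftrightarrow> VectorSpace.subspace K D V \<and> (\<forall>d\<in>D. T d \<in> D) \<and> D \<subseteq> C \<and>
    root_space V T L C \<subseteq> root_space V T L D" for D
  have "Q C" using C inv by (auto simp: Q_def)
  then obtain D where "Q D" and D_min: "\<forall>W. Q W \<longrightarrow> W \<subseteq> D \<longrightarrow> W = D"
    using exists_minimal_subspace[OF fin, of Q C] Q_def by blast
  then have D: "VectorSpace.subspace K D V" and D_inv: "\<And>d. d \<in> D \<Longrightarrow> T d \<in> D" and "D \<subseteq> C"
    and D_roots: "root_space V T L C \<subseteq> root_space V T L D"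
    by (auto simp: Q_def)
  note DV = subspaceD(5)[OF D]
  have surj: "\<exists>d'\<in>D. T d' = l \<odot>\<^bsub>V\<^esub> d' \<oplus>\<^bsub>V\<^esub> d" if "l \<in> L" "d \<in> D" for l d
  proof -
    have l: "l \<in> carrier K" using that L by blast
    define E where "E = {e \<in> carrier V. \<exists>d\<in>D. T d = l \<odot>\<^bsub>V\<^esub> d \<oplus>\<^bsub>V\<^esub> e}"
    have ED: "E \<subseteq> D"
    proof
      fix e assume "e \<in> E"
      then obtain d where "d \<in> D" "T d = l \<odot>\<^bsub>V\<^esub> d \<oplus>\<^bsub>V\<^esub> e" "e \<in> carrier V" unfolding E_def by blast
      then show "e \<in> D"
        using subspace_cancel_left[OF D, of "l \<odot>\<^bsub>V\<^esub> d" e] D_inv[of d] subspaceD(4)[OF D l] by simp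
    qed
    have "VectorSpace.subspace K E V"
    proof (rule subspaceI)
      show "E \<subseteq> carrier V" by (auto simp: E_def)
      show "\<zero>\<^bsub>V\<^esub> \<in> E"
        unfolding E_def using subspaceD(2)[OF D] module_hom_zero[OF T] l by (auto intro!: bexI[of _ "\<zero>\<^bsub>V\<^esub>"])
    next
      fix e e' assume e: "e \<in> E" "e' \<in> E"
      then obtain d d' where d: "d \<in> D" "T d = l \<odot>\<^bsub>V\<^esub> d \<oplus>\<^bsub>V\<^esub> e" "d' \<in> D" "T d' = l \<odot>\<^bsub>V\<^esub> d' \<oplus>\<^bsub>V\<^esub> e'"
        unfolding E_def by blast
      have "T (d \<oplus>\<^bsub>V\<^esub> d') = l \<odot>\<^bsub>V\<^esub> (d \<oplus>\<^bsub>V\<^esub> d') \<oplus>\<^bsub>V\<^esub> (e \<oplus>\<^bsub>V\<^esub> e')"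
        using d e DV[of d] DV[of d'] l module_hom_add[OF T, of d d']
        by (simp add: E_def smult_r_distr M.a_ac)
      then show "e \<oplus>\<^bsub>V\<^esub> e' \<in> E" unfolding E_def using e d subspaceD(3)[OF D] by (auto simp: E_def)
    next
      fix a e assume a: "a \<in> carrier K" and e: "e \<in> E"
      then obtain d where d: "d \<in> D" "T d = l \<odot>\<^bsub>V\<^esub> d \<oplus>\<^bsub>V\<^esub> e" unfolding E_def by blast
      have "a \<odot>\<^bsub>V\<^esub> (l \<odot>\<^bsub>V\<^esub> d) = l \<odot>\<^bsub>V\<^esub> (a \<odot>\<^bsub>V\<^esub> d)"
        using a l DV[OF d(1)] by (simp add: smult_left_commute[of a l])
      then have "T (a \<odot>\<^bsub>V\<^esub> d) = l \<odot>\<^bsub>V\<^esub> (a \<odot>\<^bsub>V\<^esub> d) \<oplus>\<^bsub>V\<^esub> a \<odot>\<^bsub>V\<^esub> e"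
        using d e DV[of d] l a module_hom_smult[OF T a, of d]
        by (simp add: E_def smult_r_distr)
      then show "a \<odot>\<^bsub>V\<^esub> e \<in> E" unfolding E_def using e d a subspaceD(4)[OF D] by (auto simp: E_def)
    qed
    moreover have "T e \<in> E" if eE: "e \<in> E" for e
    proof -
      obtain d where d: "d \<in> D" "T d = l \<odot>\<^bsub>V\<^esub> d \<oplus>\<^bsub>V\<^esub> e" and e: "e \<in> carrier V"
        using eE unfolding E_def by blast
      have "T (T d) = l \<odot>\<^bsub>V\<^esub> T d \<oplus>\<^bsub>V\<^esub> T e"
        using d e l DV[OF d(1)] module_hom_add[OF T, of "l \<odot>\<^bsub>V\<^esub> d" e] module_hom_smult[OF T l, of d]
        by simp
      then show ?thesis
        unfolding E_def using D_inv[OF d(1)] e module_hom_closed[OF T] by blast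
    qed
    moreover have "D \<subseteq> root_space V T L E"
    proof
      fix d assume d: "d \<in> D"
      let ?e = "T d \<oplus>\<^bsub>V\<^esub> \<ominus>\<^bsub>V\<^esub> (l \<odot>\<^bsub>V\<^esub> d)"
      have "T d = l \<odot>\<^bsub>V\<^esub> d \<oplus>\<^bsub>V\<^esub> ?e"
        using DV[OF d] DV[OF D_inv[OF d]] l by (simp add: add_diff_cancel)
      moreover have "?e \<in> E"
        unfolding E_def using calculation d DV[OF d] DV[OF D_inv[OF d]] l by blast
      ultimately show "d \<in> root_space V T L E"
        using \<open>l \<in> L\<close> DV[OF d] by (blast intro: root_space.intros)
    qed
    then have "root_space V T L C \<subseteq> root_space V T L E"
      using root_space_trans[OF subsetD[OF D_roots]] by (intro subsetI)
    ultimately have "Q E" using ED \<open>D \<subseteq> C\<close> by (auto simp: Q_def)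
    then have "E = D" using D_min ED by blast
    then show ?thesis using that(2) by (auto simp: E_def)
  qed
  have "v \<in> root_space V T L D" using v D_roots by blast
  then have "\<exists>c\<in>D. \<exists>s\<in>root_space V T L {\<zero>\<^bsub>V\<^esub>}. v = c \<oplus>\<^bsub>V\<^esub> s"
  proof induction
    case (base v)
    then have "v = v \<oplus>\<^bsub>V\<^esub> \<zero>\<^bsub>V\<^esub>" using DV by simp
    then show ?case using base by (blast intro: root_space.base)
  next
    case (step v l w)
    have l: "l \<in> carrier K" using step L by blast
    obtain d s where ds: "d \<in> D" "s \<in> root_space V T L {\<zero>\<^bsub>V\<^esub>}" "w = d \<oplus>\<^bsub>V\<^esub> s" using step by blast
    obtain d' where d': "d' \<in> D" "T d' = l \<odot>\<^bsub>V\<^esub> d' \<oplus>\<^bsub>V\<^esub> d" using surj step(2) ds(1) by blast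
    have sV: "s \<in> carrier V" using root_space_in_carrier[OF ds(2)] by simp
    define s' where "s' = v \<oplus>\<^bsub>V\<^esub> \<ominus>\<^bsub>V\<^esub> d'"
    have s'V: "s' \<in> carrier V" using step(1) DV[OF d'(1)] by (simp add: s'_def)
    have v_eq: "v = d' \<oplus>\<^bsub>V\<^esub> s'"
      using step(1) DV[OF d'(1)] by (simp add: s'_def add_diff_cancel)
    have "T d' \<oplus>\<^bsub>V\<^esub> T s' = T v"
      using v_eq module_hom_add[OF T DV[OF d'(1)] s'V] by simp
    also have "\<dots> = l \<odot>\<^bsub>V\<^esub> (d' \<oplus>\<^bsub>V\<^esub> s') \<oplus>\<^bsub>V\<^esub> (d \<oplus>\<^bsub>V\<^esub> s)" using step(4) v_eq ds(3) by simp
    also have "\<dots> = T d' \<oplus>\<^bsub>V\<^esub> (l \<odot>\<^bsub>V\<^esub> s' \<oplus>\<^bsub>V\<^esub> s)"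
      using DV[OF d'(1)] DV[OF ds(1)] s'V sV l d'(2) add_exchange[of "l \<odot>\<^bsub>V\<^esub> d'" "l \<odot>\<^bsub>V\<^esub> s'" d s]
      by (simp add: smult_r_distr)
    finally have "T s' = l \<odot>\<^bsub>V\<^esub> s' \<oplus>\<^bsub>V\<^esub> s"
      using DV[OF D_inv[OF d'(1)]] funcset_mem[OF module_hom_closed[OF T] s'V] s'V sV l by simp
    then have "s' \<in> root_space V T L {\<zero>\<^bsub>V\<^esub>}" using s'V step(2) ds(2) by (blast intro: root_space.step)
    then show ?case using v_eq d'(1) by blast
  qed
  then show ?thesis using \<open>D \<subseteq> C\<close> by blast
qed

text \<open>If \<open>T a = l a\<close> and \<open>T b = m b\<close>, then \<open>T (f a b) = (l + m) (f a b)\<close>; the induction extends this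
  from eigenvectors to root vectors.\<close>

lemma root_space_closed_under_derivation:
  assumes T: "T \<in> module_hom K V V" and L: "L \<subseteq> carrier K"
    and L_add: "\<And>l m. l \<in> L \<Longrightarrow> m \<in> L \<Longrightarrow> l \<oplus>\<^bsub>K\<^esub> m \<in> L"
    and f_left: "\<And>b. b \<in> carrier V \<Longrightarrow> (\<lambda>a. f a b) \<in> module_hom K V V"
    and f_right: "\<And>a. a \<in> carrier V \<Longrightarrow> f a \<in> module_hom K V V"
    and deriv: "\<And>a b. a \<in> carrier V \<Longrightarrow> b \<in> carrier V \<Longrightarrow> T (f a b) = f (T a) b \<oplus>\<^bsub>V\<^esub> f a (T b)"
    and a: "a \<in> root_space V T L {\<zero>\<^bsub>V\<^esub>}" and b: "b \<in> root_space V T L {\<zero>\<^bsub>V\<^esub>}"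
  shows "f a b \<in> root_space V T L {\<zero>\<^bsub>V\<^esub>}"
proof -
  have zV: "{\<zero>\<^bsub>V\<^esub>} \<subseteq> carrier V" by simp
  have R: "VectorSpace.subspace K (root_space V T L {\<zero>\<^bsub>V\<^esub>}) V"
    using root_space_subspace[OF T subspace_zero _ L] module_hom_zero[OF T] by simp
  from a show ?thesis using b
  proof (induction arbitrary: b)
    case (base a)
    then have "f a b = \<zero>\<^bsub>V\<^esub>"
      using module_hom_zero[OF f_left[OF root_space_in_carrier[OF base(2) zV]]] by simp
    then show ?case by (simp add: root_space.base)
  next
    case (step a l a')
    note IH_a = step.IH
    note a = step.hyps
    have l: "l \<in> carrier K" using a L by blast
    have a'V: "a' \<in> carrier V" using root_space_in_carrier[OF a(3) zV] .
    show ?case using step.prems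
    proof induction
      case (base b)
      then have "f a b = \<zero>\<^bsub>V\<^esub>" using module_hom_zero[OF f_right[OF a(1)]] by simp
      then show ?case by (simp add: root_space.base)
    next
      case (step b m b')
      have m: "m \<in> carrier K" using step L by blast
      have b'V: "b' \<in> carrier V" using root_space_in_carrier[OF step(3) zV] .
      have fV: "f x y \<in> carrier V" if "x \<in> carrier V" "y \<in> carrier V" for x y
        using module_hom_closed[OF f_right[OF that(1)]] that(2) by blast
      have "T (f a b) = f (l \<odot>\<^bsub>V\<^esub> a \<oplus>\<^bsub>V\<^esub> a') b \<oplus>\<^bsub>V\<^esub> f a (m \<odot>\<^bsub>V\<^esub> b \<oplus>\<^bsub>V\<^esub> b')"
        using deriv[OF a(1) step(1)] a(4) step(4) by simp
      also have "f (l \<odot>\<^bsub>V\<^esub> a \<oplus>\<^bsub>V\<^esub> a') b = l \<odot>\<^bsub>V\<^esub> f a b \<oplus>\<^bsub>V\<^esub> f a' b"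
        using module_hom_add[OF f_left[OF step(1)], of "l \<odot>\<^bsub>V\<^esub> a" a']
          module_hom_smult[OF f_left[OF step(1)] l a(1)] a(1) l a'V by simp
      also have "f a (m \<odot>\<^bsub>V\<^esub> b \<oplus>\<^bsub>V\<^esub> b') = m \<odot>\<^bsub>V\<^esub> f a b \<oplus>\<^bsub>V\<^esub> f a b'"
        using module_hom_add[OF f_right[OF a(1)], of "m \<odot>\<^bsub>V\<^esub> b" b']
          module_hom_smult[OF f_right[OF a(1)] m step(1)] step(1) m b'V by simp
      finally have eq: "T (f a b) = (l \<oplus>\<^bsub>K\<^esub> m) \<odot>\<^bsub>V\<^esub> f a b \<oplus>\<^bsub>V\<^esub> (f a' b \<oplus>\<^bsub>V\<^esub> f a b')"
        using fV[OF a(1) step(1)] fV[OF a'V step(1)] fV[OF a(1) b'V] l m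
        by (simp add: smult_l_distr M.a_ac)
      have "b \<in> root_space V T L {\<zero>\<^bsub>V\<^esub>}" using step(1-4) by (rule root_space.step)
      then have "f a' b \<oplus>\<^bsub>V\<^esub> f a b' \<in> root_space V T L {\<zero>\<^bsub>V\<^esub>}"
        using IH_a step.IH subspaceD(3)[OF R] by blast
      then show ?case
        using eq L_add[OF a(2) step(2)] fV[OF a(1) step(1)] by (blast intro: root_space.step)
    qed
  qed
qed

lemma funpow_into_root_space:
  assumes T: "T \<in> module_hom K V V" and L: "\<zero>\<^bsub>K\<^esub> \<in> L"
    and v: "v \<in> carrier V" "(T ^^ k) v \<in> U"
  shows "v \<in> root_space V T L U"
  using v
proof (induction k arbitrary: v)
  case 0
  then show ?case by (simp add: root_space.base)
next
  case (Suc k)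
  have Tv: "T v \<in> carrier V" using module_hom_closed[OF T] Suc.prems(1) by blast
  have "T v \<in> root_space V T L U"
    using Suc.IH[OF Tv] Suc.prems(2) by (simp add: funpow_swap1)
  then show ?case
    using root_space.step[OF Suc.prems(1) L] Suc.prems(1) Tv by simp
qed

end

section \<open>Products of subsets of a Poisson algebra\<close>

context poisson_algebra
begin

abbreviation sub :: "'p set \<Rightarrow> bool" where
  "sub W \<equiv> VectorSpace.subspace F W P"

abbreviation roots :: "('p \<Rightarrow> 'p) \<Rightarrow> 'f set \<Rightarrow> 'p set \<Rightarrow> 'p set" where
  "roots \<equiv> root_space P"

lemma bracket_right_hom:
  assumes "x \<in> carrier P"
  shows "(\<lambda>v. \<lbrakk>x,v\<rbrakk>\<^bsub>P\<^esub>) \<in> module_hom F P P"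
  using assms bracket_closed bracket_add_right bracket_smult_right
  by (auto simp: module_hom_def)

lemma bracket_left_hom:
  assumes "x \<in> carrier P"
  shows "(\<lambda>v. \<lbrakk>v,x\<rbrakk>\<^bsub>P\<^esub>) \<in> module_hom F P P"
  using assms bracket_closed bracket_add_left bracket_smult_left
  by (auto simp: module_hom_def)

lemma mult_left_hom:
  assumes "x \<in> carrier P"
  shows "(\<lambda>v. v \<otimes>\<^bsub>P\<^esub> x) \<in> module_hom F P P"
  using assms mult_closed mult_add_left mult_smult_left
  by (auto simp: module_hom_def)

lemma mult_right_hom:
  assumes "x \<in> carrier P"
  shows "(\<lambda>v. x \<otimes>\<^bsub>P\<^esub> v) \<in> module_hom F P P"
proof -
  have "x \<otimes>\<^bsub>P\<^esub> v = v \<otimes>\<^bsub>P\<^esub> x" if "v \<in> carrier P" for v using mult_comm[OF assms that] .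
  then show ?thesis
    using mult_left_hom[OF assms] by (auto simp: module_hom_def)
qed

lemma bracket_swap:
  assumes x: "x \<in> carrier P" and y: "y \<in> carrier P"
  shows "\<lbrakk>x,y\<rbrakk>\<^bsub>P\<^esub> = \<ominus>\<^bsub>P\<^esub> \<lbrakk>y,x\<rbrakk>\<^bsub>P\<^esub>"
proof -
  have "\<lbrakk>x \<oplus>\<^bsub>P\<^esub> y, x \<oplus>\<^bsub>P\<^esub> y\<rbrakk>\<^bsub>P\<^esub> = (\<lbrakk>x,x\<rbrakk>\<^bsub>P\<^esub> \<oplus>\<^bsub>P\<^esub> \<lbrakk>y,x\<rbrakk>\<^bsub>P\<^esub>) \<oplus>\<^bsub>P\<^esub> (\<lbrakk>x,y\<rbrakk>\<^bsub>P\<^esub> \<oplus>\<^bsub>P\<^esub> \<lbrakk>y,y\<rbrakk>\<^bsub>P\<^esub>)"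
    using x y by (simp add: bracket_add_left bracket_add_right)
  then have "\<lbrakk>x,y\<rbrakk>\<^bsub>P\<^esub> \<oplus>\<^bsub>P\<^esub> \<lbrakk>y,x\<rbrakk>\<^bsub>P\<^esub> = \<lbrakk>x \<oplus>\<^bsub>P\<^esub> y, x \<oplus>\<^bsub>P\<^esub> y\<rbrakk>\<^bsub>P\<^esub>"
    using bracket_closed[OF x y] bracket_closed[OF y x] x y by (simp add: bracket_alternating[of x] bracket_alternating[of y] M.a_comm)
  also have "\<dots> = \<zero>\<^bsub>P\<^esub>" using x y by (simp add: bracket_alternating)
  finally show ?thesis
    using x y bracket_closed by (simp add: M.minus_equality)
qed

lemma bracket_swap_in:
  assumes "sub W" "x \<in> carrier P" "y \<in> carrier P" "\<lbrakk>x,y\<rbrakk>\<^bsub>P\<^esub> \<in> W"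
  shows "\<lbrakk>y,x\<rbrakk>\<^bsub>P\<^esub> \<in> W"
  using bracket_swap[OF assms(3,2)] subspace_uminus[OF assms(1,4)] by simp

lemma bracket_mult_deriv:
  assumes x: "x \<in> carrier P" and y: "y \<in> carrier P" and z: "z \<in> carrier P"
  shows "\<lbrakk>x, y \<otimes>\<^bsub>P\<^esub> z\<rbrakk>\<^bsub>P\<^esub> = \<lbrakk>x,y\<rbrakk>\<^bsub>P\<^esub> \<otimes>\<^bsub>P\<^esub> z \<oplus>\<^bsub>P\<^esub> y \<otimes>\<^bsub>P\<^esub> \<lbrakk>x,z\<rbrakk>\<^bsub>P\<^esub>"
proof -
  have *: "\<ominus>\<^bsub>P\<^esub> (u \<otimes>\<^bsub>P\<^esub> v) = (\<ominus>\<^bsub>P\<^esub> u) \<otimes>\<^bsub>P\<^esub> v" "\<ominus>\<^bsub>P\<^esub> (u \<otimes>\<^bsub>P\<^esub> v) = u \<otimes>\<^bsub>P\<^esub> (\<ominus>\<^bsub>P\<^esub> v)"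
    if "u \<in> carrier P" "v \<in> carrier P" for u v
  proof -
    interpret l: mod_hom F P P "\<lambda>u. u \<otimes>\<^bsub>P\<^esub> v"
      using mult_left_hom[OF that(2)] by unfold_locales
    interpret r: mod_hom F P P "\<lambda>v. u \<otimes>\<^bsub>P\<^esub> v"
      using mult_right_hom[OF that(1)] by unfold_locales
    show "\<ominus>\<^bsub>P\<^esub> (u \<otimes>\<^bsub>P\<^esub> v) = (\<ominus>\<^bsub>P\<^esub> u) \<otimes>\<^bsub>P\<^esub> v" "\<ominus>\<^bsub>P\<^esub> (u \<otimes>\<^bsub>P\<^esub> v) = u \<otimes>\<^bsub>P\<^esub> (\<ominus>\<^bsub>P\<^esub> v)"
      using l.f_neg[OF that(1)] r.f_neg[OF that(2)] by simp_all
  qed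
  have "\<lbrakk>x, y \<otimes>\<^bsub>P\<^esub> z\<rbrakk>\<^bsub>P\<^esub> = \<ominus>\<^bsub>P\<^esub> (\<lbrakk>y,x\<rbrakk>\<^bsub>P\<^esub> \<otimes>\<^bsub>P\<^esub> z \<oplus>\<^bsub>P\<^esub> y \<otimes>\<^bsub>P\<^esub> \<lbrakk>z,x\<rbrakk>\<^bsub>P\<^esub>)"
    using bracket_swap[OF x mult_closed[OF y z]] leibniz[OF y z x] by simp
  also have "\<dots> = (\<ominus>\<^bsub>P\<^esub> \<lbrakk>y,x\<rbrakk>\<^bsub>P\<^esub>) \<otimes>\<^bsub>P\<^esub> z \<oplus>\<^bsub>P\<^esub> y \<otimes>\<^bsub>P\<^esub> (\<ominus>\<^bsub>P\<^esub> \<lbrakk>z,x\<rbrakk>\<^bsub>P\<^esub>)"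
    using *(1)[of "\<lbrakk>y,x\<rbrakk>\<^bsub>P\<^esub>" z] *(2)[of y "\<lbrakk>z,x\<rbrakk>\<^bsub>P\<^esub>"] x y z bracket_closed mult_closed
    by (simp add: M.minus_add)
  finally show ?thesis using bracket_swap[OF x y] bracket_swap[OF x z] by simp
qed

lemma bracket_bracket_deriv:
  assumes x: "x \<in> carrier P" and y: "y \<in> carrier P" and z: "z \<in> carrier P"
  shows "\<lbrakk>x, \<lbrakk>y,z\<rbrakk>\<^bsub>P\<^esub>\<rbrakk>\<^bsub>P\<^esub> = \<lbrakk>\<lbrakk>x,y\<rbrakk>\<^bsub>P\<^esub>, z\<rbrakk>\<^bsub>P\<^esub> \<oplus>\<^bsub>P\<^esub> \<lbrakk>y, \<lbrakk>x,z\<rbrakk>\<^bsub>P\<^esub>\<rbrakk>\<^bsub>P\<^esub>"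
proof -
  note [simp] = bracket_closed x y z
  interpret r: mod_hom F P P "\<lambda>v. \<lbrakk>y,v\<rbrakk>\<^bsub>P\<^esub>"
    using bracket_right_hom[OF y] by unfold_locales
  have "\<lbrakk>x, \<lbrakk>y,z\<rbrakk>\<^bsub>P\<^esub>\<rbrakk>\<^bsub>P\<^esub> \<oplus>\<^bsub>P\<^esub> (\<lbrakk>y, \<lbrakk>z,x\<rbrakk>\<^bsub>P\<^esub>\<rbrakk>\<^bsub>P\<^esub> \<oplus>\<^bsub>P\<^esub> \<lbrakk>z, \<lbrakk>x,y\<rbrakk>\<^bsub>P\<^esub>\<rbrakk>\<^bsub>P\<^esub>) = \<zero>\<^bsub>P\<^esub>"
    using jacobi[OF x y z] by (simp add: M.a_assoc)
  then have "\<lbrakk>x, \<lbrakk>y,z\<rbrakk>\<^bsub>P\<^esub>\<rbrakk>\<^bsub>P\<^esub> = \<ominus>\<^bsub>P\<^esub> (\<lbrakk>y, \<lbrakk>z,x\<rbrakk>\<^bsub>P\<^esub>\<rbrakk>\<^bsub>P\<^esub> \<oplus>\<^bsub>P\<^esub> \<lbrakk>z, \<lbrakk>x,y\<rbrakk>\<^bsub>P\<^esub>\<rbrakk>\<^bsub>P\<^esub>)"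
    by (simp add: M.minus_equality)
  also have "\<dots> = \<ominus>\<^bsub>P\<^esub> \<lbrakk>z, \<lbrakk>x,y\<rbrakk>\<^bsub>P\<^esub>\<rbrakk>\<^bsub>P\<^esub> \<oplus>\<^bsub>P\<^esub> \<ominus>\<^bsub>P\<^esub> \<lbrakk>y, \<lbrakk>z,x\<rbrakk>\<^bsub>P\<^esub>\<rbrakk>\<^bsub>P\<^esub>"
    by (simp add: M.minus_add M.a_comm)
  also have "\<ominus>\<^bsub>P\<^esub> \<lbrakk>z, \<lbrakk>x,y\<rbrakk>\<^bsub>P\<^esub>\<rbrakk>\<^bsub>P\<^esub> = \<lbrakk>\<lbrakk>x,y\<rbrakk>\<^bsub>P\<^esub>, z\<rbrakk>\<^bsub>P\<^esub>"
    using bracket_swap[of "\<lbrakk>x,y\<rbrakk>\<^bsub>P\<^esub>" z] by simp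
  also have "\<ominus>\<^bsub>P\<^esub> \<lbrakk>y, \<lbrakk>z,x\<rbrakk>\<^bsub>P\<^esub>\<rbrakk>\<^bsub>P\<^esub> = \<lbrakk>y, \<lbrakk>x,z\<rbrakk>\<^bsub>P\<^esub>\<rbrakk>\<^bsub>P\<^esub>"
    using bracket_swap[of x z] r.f_neg[of "\<lbrakk>z,x\<rbrakk>\<^bsub>P\<^esub>"] by simp
  finally show ?thesis .
qed

text \<open>Subalgebras, ideals, normalizers and annihilators of sections are all expressed by
  this one condition.\<close>

definition prods_in :: "'p set \<Rightarrow> 'p set \<Rightarrow> 'p set \<Rightarrow> bool" where
  "prods_in X Y W \<longleftrightarrow> (\<forall>x\<in>X. \<forall>y\<in>Y. x \<otimes>\<^bsub>P\<^esub> y \<in> W \<and> \<lbrakk>x,y\<rbrakk>\<^bsub>P\<^esub> \<in> W)"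

lemma prods_inD:
  assumes "prods_in X Y W" "x \<in> X" "y \<in> Y"
  shows "x \<otimes>\<^bsub>P\<^esub> y \<in> W" and "\<lbrakk>x,y\<rbrakk>\<^bsub>P\<^esub> \<in> W"
  using assms by (auto simp: prods_in_def)

lemma prods_in_mono:
  "prods_in X Y W \<Longrightarrow> X' \<subseteq> X \<Longrightarrow> Y' \<subseteq> Y \<Longrightarrow> W \<subseteq> W' \<Longrightarrow> prods_in X' Y' W'"
  unfolding prods_in_def by blast

lemma prods_in_swap:
  assumes W: "sub W" and X: "X \<subseteq> carrier P" and Y: "Y \<subseteq> carrier P" and "prods_in X Y W"
  shows "prods_in Y X W"
  unfolding prods_in_def
proof (intro ballI)
  fix y x assume yx: "y \<in> Y" "x \<in> X"
  then have c: "x \<in> carrier P" "y \<in> carrier P" using X Y by auto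
  show "y \<otimes>\<^bsub>P\<^esub> x \<in> W \<and> \<lbrakk>y,x\<rbrakk>\<^bsub>P\<^esub> \<in> W"
    using prods_inD[OF assms(4) yx(2,1)] mult_comm[OF c] bracket_swap_in[OF W c] by simp
qed

lemma subspace_vimage:
  assumes T: "T \<in> module_hom F P P" and W: "sub W" and Y: "sub Y"
  shows "sub {v \<in> Y. T v \<in> W}"
proof (rule subspaceI)
  show "{v \<in> Y. T v \<in> W} \<subseteq> carrier P" using subspaceD(1)[OF Y] by blast
  show "\<zero>\<^bsub>P\<^esub> \<in> {v \<in> Y. T v \<in> W}"
    using subspaceD(2)[OF Y] subspaceD(2)[OF W] module_hom_zero[OF T] by simp
next
  fix u v assume "u \<in> {v \<in> Y. T v \<in> W}" "v \<in> {v \<in> Y. T v \<in> W}"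
  then show "u \<oplus>\<^bsub>P\<^esub> v \<in> {v \<in> Y. T v \<in> W}"
    using subspaceD(3,5)[OF Y] subspaceD(3)[OF W] module_hom_add[OF T] by auto
next
  fix a v assume "a \<in> carrier F" "v \<in> {v \<in> Y. T v \<in> W}"
  then show "a \<odot>\<^bsub>P\<^esub> v \<in> {v \<in> Y. T v \<in> W}"
    using subspaceD(4,5)[OF Y] subspaceD(4)[OF W] module_hom_smult[OF T] by auto
qed

lemma subspace_transporter:
  assumes X: "X \<subseteq> carrier P" and W: "sub W" and Y: "sub Y"
  shows "sub {v \<in> Y. prods_in X {v} W}"
proof -
  let ?Z = "\<lambda>x. {v \<in> {v \<in> Y. x \<otimes>\<^bsub>P\<^esub> v \<in> W}. \<lbrakk>x,v\<rbrakk>\<^bsub>P\<^esub> \<in> W}"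
  have "sub (?Z x)" if "x \<in> X" for x
    using that X by (blast intro: subspace_vimage mult_right_hom bracket_right_hom W Y)
  then have "sub (carrier P \<inter> \<Inter>(insert Y (?Z ` X)))"
    by (intro subspace_Inter) (use Y in auto)
  moreover have "carrier P \<inter> \<Inter>(insert Y (?Z ` X)) = {v \<in> Y. prods_in X {v} W}"
    using subspaceD(1)[OF Y] by (auto simp: prods_in_def)
  ultimately show ?thesis by simp
qed

lemma prods_in_adjoin:
  assumes X: "X \<subseteq> carrier P" and W: "sub W" and U: "U \<subseteq> carrier P" and v: "v \<in> carrier P"
    and XU: "prods_in X U W" and Xv: "prods_in X {v} W"
  shows "prods_in X (adjoin U v) W"
proof -
  have "adjoin U v \<subseteq> {v \<in> carrier P. prods_in X {v} W}"
    using U v XU Xv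
    by (intro adjoin_least subspace_transporter X W subspace_carrier) (auto simp: prods_in_def)
  then show ?thesis by (auto simp: prods_in_def)
qed

lemma prods_in_span:
  assumes X: "X \<subseteq> carrier P" and W: "sub W" and S: "S \<subseteq> carrier P" and XS: "prods_in X S W"
  shows "prods_in X (span S) W"
proof -
  have "S \<subseteq> {v \<in> carrier P. prods_in X {v} W}"
    using S XS by (auto simp: prods_in_def)
  then have "span S \<subseteq> {v \<in> carrier P. prods_in X {v} W}"
    using span_is_subset is_module[OF subspace_transporter[OF X W subspace_carrier]] by blast
  then show ?thesis by (auto simp: prods_in_def)
qed

lemma subalgebra_iff: "poisson_subalgebra F P S \<longleftrightarrow> sub S \<and> prods_in S S S"
  by (auto simp: poisson_subalgebra_def prods_in_def)

lemma ideal_iff: "poisson_ideal F P I \<longleftrightarrow> sub I \<and> prods_in (carrier P) I I"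
proof -
  have "poisson_ideal F P I \<longleftrightarrow> sub I \<and> prods_in I (carrier P) I"
    by (auto simp: poisson_ideal_def prods_in_def)
  also have "\<dots> \<longleftrightarrow> sub I \<and> prods_in (carrier P) I I"
    using prods_in_swap[of I] subspaceD(1)[of I] by blast
  finally show ?thesis .
qed

lemma ideal_zero: "poisson_ideal F P {\<zero>\<^bsub>P\<^esub>}"
  using subspace_zero module_hom_zero[OF mult_right_hom] module_hom_zero[OF bracket_right_hom]
  by (auto simp: ideal_iff prods_in_def)

lemma subalgebra_zero: "poisson_subalgebra F P {\<zero>\<^bsub>P\<^esub>}"
  using ideal_zero by (auto simp: subalgebra_iff ideal_iff intro: prods_in_mono)

section \<open>Spectra and the Frattini ideal\<close>

text \<open>Both multiplications by \<open>x\<close> have all their eigenvalues modulo \<open>U\<close> in \<open>L\<close>. The cases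
  of interest are \<open>L = {0}\<close> (both are nilpotent) and \<open>L = F\<close> (both are
  triangularizable over the base field).\<close>

definition spectrum_in :: "'f set \<Rightarrow> 'p \<Rightarrow> 'p set \<Rightarrow> bool" where
  "spectrum_in L x U \<longleftrightarrow>
     carrier P \<subseteq> roots (\<lambda>v. x \<otimes>\<^bsub>P\<^esub> v) L U \<and> carrier P \<subseteq> roots (\<lambda>v. \<lbrakk>x,v\<rbrakk>\<^bsub>P\<^esub>) L U"

text \<open>Since \<open>[x,_]\<close> is a derivation of both products, its root vectors form a
  subalgebra.\<close>

lemma bracket_roots_subalgebra:
  assumes x: "x \<in> carrier P" and L: "L \<subseteq> carrier F"
    and L_add: "\<And>l m. l \<in> L \<Longrightarrow> m \<in> L \<Longrightarrow> l \<oplus>\<^bsub>F\<^esub> m \<in> L"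
  shows "poisson_subalgebra F P (roots (\<lambda>v. \<lbrakk>x,v\<rbrakk>\<^bsub>P\<^esub>) L {\<zero>\<^bsub>P\<^esub>})"
  unfolding subalgebra_iff
proof
  show "sub (roots (\<lambda>v. \<lbrakk>x,v\<rbrakk>\<^bsub>P\<^esub>) L {\<zero>\<^bsub>P\<^esub>})"
    using root_space_subspace[OF bracket_right_hom[OF x] subspace_zero _ L]
      module_hom_zero[OF bracket_right_hom[OF x]] by simp
  show "prods_in (roots (\<lambda>v. \<lbrakk>x,v\<rbrakk>\<^bsub>P\<^esub>) L {\<zero>\<^bsub>P\<^esub>}) (roots (\<lambda>v. \<lbrakk>x,v\<rbrakk>\<^bsub>P\<^esub>) L {\<zero>\<^bsub>P\<^esub>}) (roots (\<lambda>v. \<lbrakk>x,v\<rbrakk>\<^bsub>P\<^esub>) L {\<zero>\<^bsub>P\<^esub>})"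
    unfolding prods_in_def
  proof (intro ballI conjI)
    fix a b assume ab: "a \<in> roots (\<lambda>v. \<lbrakk>x,v\<rbrakk>\<^bsub>P\<^esub>) L {\<zero>\<^bsub>P\<^esub>}" "b \<in> roots (\<lambda>v. \<lbrakk>x,v\<rbrakk>\<^bsub>P\<^esub>) L {\<zero>\<^bsub>P\<^esub>}"
    show "a \<otimes>\<^bsub>P\<^esub> b \<in> roots (\<lambda>v. \<lbrakk>x,v\<rbrakk>\<^bsub>P\<^esub>) L {\<zero>\<^bsub>P\<^esub>}"
      using root_space_closed_under_derivation[OF bracket_right_hom[OF x] L L_add
          mult_left_hom mult_right_hom bracket_mult_deriv[OF x] ab] .
    show "\<lbrakk>a,b\<rbrakk>\<^bsub>P\<^esub> \<in> roots (\<lambda>v. \<lbrakk>x,v\<rbrakk>\<^bsub>P\<^esub>) L {\<zero>\<^bsub>P\<^esub>}"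
      using root_space_closed_under_derivation[OF bracket_right_hom[OF x] L L_add
          bracket_left_hom bracket_right_hom bracket_bracket_deriv[OF x] ab] .
  qed
qed

text \<open>Multiplication by \<open>x\<close> is not a derivation, but it commutes with all multiplications,
  and \<open>(x - l) [a,y] = [(x - l) a, y] - a [x,y]\<close>, so its root vectors even form an ideal.\<close>

lemma mult_roots_subalgebra:
  assumes x: "x \<in> carrier P" and L: "L \<subseteq> carrier F"
  shows "poisson_subalgebra F P (roots (\<lambda>v. x \<otimes>\<^bsub>P\<^esub> v) L {\<zero>\<^bsub>P\<^esub>})"
proof -
  let ?R = "roots (\<lambda>v. x \<otimes>\<^bsub>P\<^esub> v) L {\<zero>\<^bsub>P\<^esub>}"
  have R: "sub ?R"
    using root_space_subspace[OF mult_right_hom[OF x] subspace_zero _ L]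
      module_hom_zero[OF mult_right_hom[OF x]] by simp
  have mult: "a \<otimes>\<^bsub>P\<^esub> y \<in> ?R" if "a \<in> ?R" "y \<in> carrier P" for a y
    using that(1)
  proof induction
    case (base a)
    then show ?case
      using module_hom_zero[OF mult_left_hom[OF that(2)]] by (simp add: root_space.base)
  next
    case (step a l b)
    have l: "l \<in> carrier F" using step L by blast
    have b: "b \<in> carrier P" using subspaceD(5)[OF R step(3)] .
    have "x \<otimes>\<^bsub>P\<^esub> (a \<otimes>\<^bsub>P\<^esub> y) = (l \<odot>\<^bsub>P\<^esub> a \<oplus>\<^bsub>P\<^esub> b) \<otimes>\<^bsub>P\<^esub> y"
      using mult_assoc[OF x step(1) that(2)] step(4) by simp
    also have "\<dots> = l \<odot>\<^bsub>P\<^esub> (a \<otimes>\<^bsub>P\<^esub> y) \<oplus>\<^bsub>P\<^esub> b \<otimes>\<^bsub>P\<^esub> y"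
      using step(1) l b that(2) by (simp add: mult_add_left mult_smult_left)
    finally show ?case
      using step mult_closed[OF step(1) that(2)] by (blast intro: root_space.step)
  qed
  have bracket: "\<lbrakk>a,y\<rbrakk>\<^bsub>P\<^esub> \<in> ?R" if "a \<in> ?R" and y: "y \<in> carrier P" for a y
    using that(1)
  proof induction
    case (base a)
    then show ?case
      using module_hom_zero[OF bracket_left_hom[OF y]] by (simp add: root_space.base)
  next
    case (step a l b)
    note a = step(1)
    have l: "l \<in> carrier F" using step L by blast
    have b: "b \<in> carrier P" using subspaceD(5)[OF R step(3)] .
    have aR: "a \<in> ?R" using step(1-4) by (rule root_space.step)
    let ?c = "\<ominus>\<^bsub>P\<^esub> (\<lbrakk>x,y\<rbrakk>\<^bsub>P\<^esub> \<otimes>\<^bsub>P\<^esub> a)"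
    have cl: "\<lbrakk>x,y\<rbrakk>\<^bsub>P\<^esub> \<otimes>\<^bsub>P\<^esub> a \<in> carrier P" "x \<otimes>\<^bsub>P\<^esub> \<lbrakk>a,y\<rbrakk>\<^bsub>P\<^esub> \<in> carrier P" "\<lbrakk>a,y\<rbrakk>\<^bsub>P\<^esub> \<in> carrier P" "\<lbrakk>b,y\<rbrakk>\<^bsub>P\<^esub> \<in> carrier P"
      using a b x y by (auto intro: mult_closed bracket_closed)
    have "\<lbrakk>x \<otimes>\<^bsub>P\<^esub> a, y\<rbrakk>\<^bsub>P\<^esub> = \<lbrakk>x,y\<rbrakk>\<^bsub>P\<^esub> \<otimes>\<^bsub>P\<^esub> a \<oplus>\<^bsub>P\<^esub> x \<otimes>\<^bsub>P\<^esub> \<lbrakk>a,y\<rbrakk>\<^bsub>P\<^esub>" by (rule leibniz[OF x a y])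
    also have "\<lbrakk>x \<otimes>\<^bsub>P\<^esub> a, y\<rbrakk>\<^bsub>P\<^esub> = l \<odot>\<^bsub>P\<^esub> \<lbrakk>a,y\<rbrakk>\<^bsub>P\<^esub> \<oplus>\<^bsub>P\<^esub> \<lbrakk>b,y\<rbrakk>\<^bsub>P\<^esub>"
      using a l b y step(4) by (simp add: bracket_add_left bracket_smult_left)
    finally have eq: "l \<odot>\<^bsub>P\<^esub> \<lbrakk>a,y\<rbrakk>\<^bsub>P\<^esub> \<oplus>\<^bsub>P\<^esub> \<lbrakk>b,y\<rbrakk>\<^bsub>P\<^esub> = \<lbrakk>x,y\<rbrakk>\<^bsub>P\<^esub> \<otimes>\<^bsub>P\<^esub> a \<oplus>\<^bsub>P\<^esub> x \<otimes>\<^bsub>P\<^esub> \<lbrakk>a,y\<rbrakk>\<^bsub>P\<^esub>" .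
    have "x \<otimes>\<^bsub>P\<^esub> \<lbrakk>a,y\<rbrakk>\<^bsub>P\<^esub> = ?c \<oplus>\<^bsub>P\<^esub> (\<lbrakk>x,y\<rbrakk>\<^bsub>P\<^esub> \<otimes>\<^bsub>P\<^esub> a \<oplus>\<^bsub>P\<^esub> x \<otimes>\<^bsub>P\<^esub> \<lbrakk>a,y\<rbrakk>\<^bsub>P\<^esub>)"
      using cl by (simp add: M.r_neg1)
    also have "\<dots> = l \<odot>\<^bsub>P\<^esub> \<lbrakk>a,y\<rbrakk>\<^bsub>P\<^esub> \<oplus>\<^bsub>P\<^esub> (?c \<oplus>\<^bsub>P\<^esub> \<lbrakk>b,y\<rbrakk>\<^bsub>P\<^esub>)"
      unfolding eq[symmetric] using cl l by (simp add: M.a_ac)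
    finally have "x \<otimes>\<^bsub>P\<^esub> \<lbrakk>a,y\<rbrakk>\<^bsub>P\<^esub> = l \<odot>\<^bsub>P\<^esub> \<lbrakk>a,y\<rbrakk>\<^bsub>P\<^esub> \<oplus>\<^bsub>P\<^esub> (?c \<oplus>\<^bsub>P\<^esub> \<lbrakk>b,y\<rbrakk>\<^bsub>P\<^esub>)" .
    moreover have "?c \<in> ?R"
      using subspace_uminus[OF R mult[OF aR bracket_closed[OF x y]]]
        mult_comm[OF a bracket_closed[OF x y]] by simp
    then have "?c \<oplus>\<^bsub>P\<^esub> \<lbrakk>b,y\<rbrakk>\<^bsub>P\<^esub> \<in> ?R" using step.IH subspaceD(3)[OF R] by blast
    ultimately show ?case using step(2) cl(3) by (blast intro: root_space.step)
  qed
  show ?thesis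
    unfolding subalgebra_iff prods_in_def using R mult bracket subspaceD(5)[OF R] by blast
qed

lemma frattini_ideal_subset:
  "frattini_ideal F P \<subseteq> frattini_subalgebra F P"
proof -
  let ?S = "frattini_subalgebra F P"
  define Q where "Q I \<longleftrightarrow> poisson_ideal F P I \<and> I \<subseteq> ?S" for I
  define U where "U = \<Union>{I. Q I}"
  have S: "sub ?S"
    unfolding frattini_subalgebra_def
    by (rule subspace_Inter) (auto simp: maximal_subalgebra_def poisson_subalgebra_def)
  have US: "U \<subseteq> ?S" by (auto simp: U_def Q_def)
  have UP: "U \<subseteq> carrier P" using US subspaceD(1)[OF S] by blast
  have spU: "sub (span U)" using span_is_subspace[OF UP] .
  have "prods_in (carrier P) U (span U)"
    unfolding prods_in_def
  proof (intro ballI)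
    fix x y assume x: "x \<in> carrier P" and "y \<in> U"
    then obtain I where I: "Q I" "y \<in> I" unfolding U_def by blast
    then have "x \<otimes>\<^bsub>P\<^esub> y \<in> I \<and> \<lbrakk>x,y\<rbrakk>\<^bsub>P\<^esub> \<in> I"
      using x by (auto simp: Q_def ideal_iff prods_in_def)
    then show "x \<otimes>\<^bsub>P\<^esub> y \<in> span U \<and> \<lbrakk>x,y\<rbrakk>\<^bsub>P\<^esub> \<in> span U"
      using I in_own_span[OF UP] unfolding U_def by blast
  qed
  then have "poisson_ideal F P (span U)"
    unfolding ideal_iff using spU prods_in_span[OF _ spU UP] by blast
  moreover have "span U \<subseteq> ?S" using span_is_subset[OF US] S by simp
  ultimately have "Q (span U)" by (simp add: Q_def)
  moreover have "I \<subseteq> span U" if "Q I" for I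
    using that in_own_span[OF UP] unfolding U_def by blast
  ultimately have "frattini_ideal F P = span U"
    unfolding frattini_ideal_def Q_def[symmetric] by (intro Greatest_equality) auto
  then show ?thesis using \<open>span U \<subseteq> ?S\<close> by simp
qed

text \<open>The elements of the Frattini ideal are non-generators: a proper subalgebra lies in a maximal
  one, which contains the Frattini ideal as well.\<close>

lemma frattini_supplement:
  assumes fin: fin_dim and S: "poisson_subalgebra F P S" and C: "C \<subseteq> frattini_ideal F P"
    and sum: "\<And>v. v \<in> carrier P \<Longrightarrow> \<exists>c\<in>C. \<exists>s\<in>S. v = c \<oplus>\<^bsub>P\<^esub> s"
  shows "S = carrier P"
proof (rule ccontr)
  assume "S \<noteq> carrier P"
  define Q where "Q M \<longleftrightarrow> poisson_subalgebra F P M \<and> S \<subseteq> M \<and> M \<noteq> carrier P" for M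
  have "Q S" using S \<open>S \<noteq> carrier P\<close> by (simp add: Q_def)
  then obtain M where "Q M" and M: "\<forall>W. Q W \<longrightarrow> M \<subseteq> W \<longrightarrow> W = M"
    using exists_maximal_subspace[OF fin, of Q S] by (auto simp: Q_def subalgebra_iff)
  then have "maximal_subalgebra F P M"
    by (auto simp: maximal_subalgebra_def Q_def)
  then have "C \<subseteq> M"
    using C frattini_ideal_subset by (auto simp: frattini_subalgebra_def)
  moreover have "S \<subseteq> M" "sub M" using \<open>Q M\<close> by (auto simp: Q_def subalgebra_iff)
  ultimately have "carrier P \<subseteq> M" using sum subspaceD(3)[OF \<open>sub M\<close>] by blast
  then show False using \<open>Q M\<close> subspaceD(1)[OF \<open>sub M\<close>] by (auto simp: Q_def)
qed

text \<open>Multiplying by \<open>x \<in> B\<close> moves each member of the chain from \<open>P\<close> down to \<open>B\<close> into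
  the next one.\<close>

lemma subideal_spectrum:
  assumes B: "poisson_subideal F P B" and x: "x \<in> B" and L: "\<zero>\<^bsub>F\<^esub> \<in> L"
  shows "spectrum_in L x B"
proof -
  obtain r and Bs :: "nat \<Rightarrow> 'p set" where Bs: "Bs 0 = B" "Bs r = carrier P"
    "\<And>i. i \<le> r \<Longrightarrow> poisson_subalgebra F P (Bs i)"
    "\<And>i. i < r \<Longrightarrow> Bs i \<subseteq> Bs (Suc i)"
    "\<And>i. i < r \<Longrightarrow> poisson_ideal F (P\<lparr>carrier := Bs (Suc i)\<rparr>) (Bs i)"
    using B unfolding poisson_subideal_def by blast
  have BsP: "Bs i \<subseteq> carrier P" if "i \<le> r" for i
    using Bs(3)[OF that] subspaceD(1) by (auto simp: subalgebra_iff)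
  have xBs: "x \<in> Bs i" if "i \<le> r" for i
    using that
  proof (induction i)
    case 0
    then show ?case using x Bs(1) by simp
  next
    case (Suc i)
    then show ?case using Bs(4)[of i] by auto
  qed
  have xP: "x \<in> carrier P" using xBs[of r] Bs(2) by simp
  have step: "x \<otimes>\<^bsub>P\<^esub> v \<in> Bs i \<and> \<lbrakk>x,v\<rbrakk>\<^bsub>P\<^esub> \<in> Bs i" if "i < r" "v \<in> Bs (Suc i)" for i v
    using Bs(5)[OF that(1)] xBs[of i] that by (auto simp: poisson_ideal_def)
  have down: "v \<in> roots T L B"
    if T: "T \<in> module_hom F P P" and "\<And>i v. i < r \<Longrightarrow> v \<in> Bs (Suc i) \<Longrightarrow> T v \<in> Bs i"
      and "i \<le> r" "v \<in> Bs i" for T i v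
    using that(3,4)
  proof (induction i arbitrary: v)
    case 0
    then show ?case using Bs(1) by (blast intro: root_space.base)
  next
    case (Suc i)
    have v: "v \<in> carrier P" using Suc.prems BsP by blast
    have Tv: "T v \<in> carrier P" using module_hom_closed[OF T] v by blast
    have "T v \<in> roots T L B" using Suc that(2) by simp
    then show ?case using root_space.step[OF v L, of "T v" T B] v Tv by simp
  qed
  show ?thesis
    unfolding spectrum_in_def Bs(2)[symmetric]
    using down[OF mult_right_hom[OF xP] _ order_refl] down[OF bracket_right_hom[OF xP] _ order_refl] step
    by blast
qed

text \<open>The crux. If \<open>P = C + S\<close> with \<open>C\<close> in the Frattini ideal and \<open>S\<close> a subalgebra, then \<open>S = P\<close>;
  here \<open>S\<close> is the set of root vectors of a multiplication by \<open>x\<close>, and \<open>C + S = P\<close> because all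
  vectors of \<open>P\<close> are root vectors modulo \<open>C\<close>.\<close>

lemma spectrum_in_frattini_lift:
  assumes fin: fin_dim and B: "poisson_subideal F P B"
    and C: "sub C" "prods_in B C C" "C \<subseteq> frattini_ideal F P"
    and x: "x \<in> B" "x \<in> carrier P"
    and L: "L \<subseteq> carrier F" "\<zero>\<^bsub>F\<^esub> \<in> L" "\<And>l m. l \<in> L \<Longrightarrow> m \<in> L \<Longrightarrow> l \<oplus>\<^bsub>F\<^esub> m \<in> L"
    and mult: "B \<subseteq> roots (\<lambda>v. x \<otimes>\<^bsub>P\<^esub> v) L C" and bracket: "B \<subseteq> roots (\<lambda>v. \<lbrakk>x,v\<rbrakk>\<^bsub>P\<^esub>) L C"
  shows "spectrum_in L x {\<zero>\<^bsub>P\<^esub>}"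
proof -
  have P_B: "carrier P \<subseteq> roots (\<lambda>v. x \<otimes>\<^bsub>P\<^esub> v) L B" "carrier P \<subseteq> roots (\<lambda>v. \<lbrakk>x,v\<rbrakk>\<^bsub>P\<^esub>) L B"
    using subideal_spectrum[OF B x(1) L(2)] by (auto simp: spectrum_in_def)
  have "roots T L {\<zero>\<^bsub>P\<^esub>} = carrier P"
    if T: "T \<in> module_hom F P P" and TC: "\<And>c. c \<in> C \<Longrightarrow> T c \<in> C"
      and P: "carrier P \<subseteq> roots T L B" "B \<subseteq> roots T L C"
      and S: "poisson_subalgebra F P (roots T L {\<zero>\<^bsub>P\<^esub>})" for T
  proof (rule frattini_supplement[OF fin S C(3)])
    fix v assume "v \<in> carrier P"
    then have "v \<in> roots T L C" using root_space_trans[OF subsetD[OF P(1)] P(2)] by blast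
    then show "\<exists>c\<in>C. \<exists>s\<in>roots T L {\<zero>\<^bsub>P\<^esub>}. v = c \<oplus>\<^bsub>P\<^esub> s"
      using root_space_decompose[OF fin T L(1) C(1) TC] by blast
  qed
  from this[OF mult_right_hom[OF x(2)] _ P_B(1) mult mult_roots_subalgebra[OF x(2) L(1)]]
    this[OF bracket_right_hom[OF x(2)] _ P_B(2) bracket bracket_roots_subalgebra[OF x(2) L(1,3)]]
  show ?thesis
    using prods_inD[OF C(2) x(1)] by (auto simp: spectrum_in_def)
qed

section \<open>Engel's theorem for Poisson algebras\<close>

text \<open>The existence of eigenvectors modulo \<open>U\<close>, when the only possible eigenvalue is \<open>0\<close>.\<close>

lemma nil_root_kernel:
  assumes v: "v \<in> roots T {\<zero>\<^bsub>F\<^esub>} {\<zero>\<^bsub>P\<^esub>}" "v \<notin> U" "v \<in> W"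
    and U: "sub U" and W: "sub W" and inv: "\<And>w. w \<in> W \<Longrightarrow> T w \<in> W"
  shows "\<exists>w\<in>W - U. T w \<in> U"
proof -
  have "v \<in> roots T {\<zero>\<^bsub>F\<^esub>} U"
    using root_space_mono[OF v(1) order_refl] subspaceD(2)[OF U] by blast
  then obtain w u where w: "w \<in> W - U" "u \<in> U" "T w = \<zero>\<^bsub>F\<^esub> \<odot>\<^bsub>P\<^esub> w \<oplus>\<^bsub>P\<^esub> u"
    using root_space_eigenvector[of v T "{\<zero>\<^bsub>F\<^esub>}" U W] v(2,3) U W inv by auto
  then have "T w = u" using subspaceD(5)[OF W] subspaceD(5)[OF U] by simp
  then show ?thesis using w by blast
qed

text \<open>The conclusion of Engel's theorem for all nonzero sections \<open>W / U\<close> of \<open>P\<close> on which \<open>N\<close> acts. This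
  generality is what the induction needs: it uses the property of a subalgebra \<open>M\<close> of \<open>N\<close> for the
  section \<open>N / M\<close>, to find an element that normalizes \<open>M\<close>, and for the given section \<open>W / U\<close>.\<close>

definition engel :: "'p set \<Rightarrow> bool" where
  "engel N \<longleftrightarrow> (\<forall>U W. sub U \<longrightarrow> sub W \<longrightarrow> U \<subset> W \<longrightarrow> prods_in N U U \<longrightarrow> prods_in N W W
     \<longrightarrow> (\<exists>v\<in>W - U. prods_in N {v} U))"

text \<open>By the identities of a Poisson algebra, a product of \<open>m \<in> M\<close> with \<open>w v\<close> or \<open>[w,v]\<close> expands into
  terms that contain a product of \<open>m\<close> with \<open>v\<close>, which lies in \<open>U\<close>, or a product of \<open>m\<close> with \<open>w\<close>, which
  lies in \<open>M\<close> and so sends \<open>v\<close> into \<open>U\<close>.\<close>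

lemma annihilated_section_invariant:
  assumes M: "M \<subseteq> carrier P" and w: "w \<in> carrier P" and U: "sub U" and W: "sub W"
    and Mw: "prods_in M {w} M" and wU: "prods_in {w} U U" and wW: "prods_in {w} W W"
  shows "prods_in {w} {v \<in> W. prods_in M {v} U} {v \<in> W. prods_in M {v} U}"
proof -
  have "w \<otimes>\<^bsub>P\<^esub> v \<in> {v \<in> W. prods_in M {v} U} \<and> \<lbrakk>w,v\<rbrakk>\<^bsub>P\<^esub> \<in> {v \<in> W. prods_in M {v} U}"
    if v: "v \<in> W" "prods_in M {v} U" for v
  proof -
    have vP: "v \<in> carrier P" using subspaceD(5)[OF W v(1)] .
    have MvU: "m \<otimes>\<^bsub>P\<^esub> v \<in> U" "\<lbrakk>m,v\<rbrakk>\<^bsub>P\<^esub> \<in> U" if "m \<in> M" for m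
      using v(2) that by (auto simp: prods_in_def)
    have MwM: "m \<otimes>\<^bsub>P\<^esub> w \<in> M" "\<lbrakk>m,w\<rbrakk>\<^bsub>P\<^esub> \<in> M" if "m \<in> M" for m
      using Mw that by (auto simp: prods_in_def)
    have wUU: "w \<otimes>\<^bsub>P\<^esub> u \<in> U" "\<lbrakk>w,u\<rbrakk>\<^bsub>P\<^esub> \<in> U" if "u \<in> U" for u
      using wU that by (auto simp: prods_in_def)
    have "m \<otimes>\<^bsub>P\<^esub> (w \<otimes>\<^bsub>P\<^esub> v) \<in> U \<and> \<lbrakk>m, w \<otimes>\<^bsub>P\<^esub> v\<rbrakk>\<^bsub>P\<^esub> \<in> U \<and> m \<otimes>\<^bsub>P\<^esub> \<lbrakk>w,v\<rbrakk>\<^bsub>P\<^esub> \<in> U \<and> \<lbrakk>m, \<lbrakk>w,v\<rbrakk>\<^bsub>P\<^esub>\<rbrakk>\<^bsub>P\<^esub> \<in> U"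
      if m: "m \<in> M" for m
    proof (intro conjI)
      have mP: "m \<in> carrier P" using m M by blast
      note cl = mP w vP mult_closed bracket_closed
      show "m \<otimes>\<^bsub>P\<^esub> (w \<otimes>\<^bsub>P\<^esub> v) \<in> U"
        using mult_assoc[OF mP w vP] MvU(1)[OF MwM(1)[OF m]] by simp
      show "\<lbrakk>m, w \<otimes>\<^bsub>P\<^esub> v\<rbrakk>\<^bsub>P\<^esub> \<in> U"
        unfolding bracket_mult_deriv[OF mP w vP]
        by (intro subspaceD(3)[OF U] MvU wUU MwM m)
      have "\<lbrakk>m,w\<rbrakk>\<^bsub>P\<^esub> \<otimes>\<^bsub>P\<^esub> v \<oplus>\<^bsub>P\<^esub> w \<otimes>\<^bsub>P\<^esub> \<lbrakk>m,v\<rbrakk>\<^bsub>P\<^esub> \<in> U"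
        by (intro subspaceD(3)[OF U] MvU wUU MwM m)
      have "\<lbrakk>w, m \<otimes>\<^bsub>P\<^esub> v\<rbrakk>\<^bsub>P\<^esub> \<in> U" by (intro wUU MvU m)
      then have "\<lbrakk>w,m\<rbrakk>\<^bsub>P\<^esub> \<otimes>\<^bsub>P\<^esub> v \<oplus>\<^bsub>P\<^esub> m \<otimes>\<^bsub>P\<^esub> \<lbrakk>w,v\<rbrakk>\<^bsub>P\<^esub> \<in> U"
        unfolding bracket_mult_deriv[OF w mP vP] .
      moreover have "\<lbrakk>w,m\<rbrakk>\<^bsub>P\<^esub> \<otimes>\<^bsub>P\<^esub> v \<in> U"
      proof -
        interpret l: mod_hom F P P "\<lambda>u. u \<otimes>\<^bsub>P\<^esub> v" using mult_left_hom[OF vP] by unfold_locales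
        have "\<lbrakk>w,m\<rbrakk>\<^bsub>P\<^esub> \<otimes>\<^bsub>P\<^esub> v = \<ominus>\<^bsub>P\<^esub> (\<lbrakk>m,w\<rbrakk>\<^bsub>P\<^esub> \<otimes>\<^bsub>P\<^esub> v)"
          using bracket_swap[OF w mP] l.f_neg[of "\<lbrakk>m,w\<rbrakk>\<^bsub>P\<^esub>"] cl by simp
        then show ?thesis using subspace_uminus[OF U MvU(1)[OF MwM(2)[OF m]]] by simp
      qed
      ultimately show "m \<otimes>\<^bsub>P\<^esub> \<lbrakk>w,v\<rbrakk>\<^bsub>P\<^esub> \<in> U"
        using subspace_cancel_left[OF U] cl by blast
      show "\<lbrakk>m, \<lbrakk>w,v\<rbrakk>\<^bsub>P\<^esub>\<rbrakk>\<^bsub>P\<^esub> \<in> U"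
        unfolding bracket_bracket_deriv[OF mP w vP]
        by (intro subspaceD(3)[OF U] MvU wUU MwM m)
    qed
    then show ?thesis
      using wW v(1) by (auto simp: prods_in_def)
  qed
  then show ?thesis by (auto simp: prods_in_def)
qed

lemma prods_in_swap_singleton:
  assumes "sub W" "X \<subseteq> carrier P" "v \<in> carrier P" "prods_in X {v} W"
  shows "prods_in {v} X W"
  using prods_in_swap[OF assms(1,2) _ assms(4)] assms(3) by simp

text \<open>The Engel property passes from \<open>M\<close> to \<open>M + F w\<close> if \<open>w\<close> normalizes \<open>M\<close>: the vectors of
  \<open>W / U\<close> that \<open>M\<close> annihilates form a section invariant under \<open>w\<close>, in which the commuting nilpotent
  maps given by \<open>w\<close> have a common kernel.\<close>

lemma engel_adjoin:
  assumes M: "sub M" "engel M" and w: "w \<in> carrier P" "prods_in M {w} M"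
    and nil: "spectrum_in {\<zero>\<^bsub>F\<^esub>} w {\<zero>\<^bsub>P\<^esub>}"
  shows "engel (adjoin M w)"
  unfolding engel_def
proof (intro allI impI)
  fix U W
  assume U: "sub U" and W: "sub W" and UW: "U \<subset> W"
    and invU: "prods_in (adjoin M w) U U" and invW: "prods_in (adjoin M w) W W"
  note MP = subspaceD(1)[OF M(1)]
  have MM': "M \<subseteq> adjoin M w" "{w} \<subseteq> adjoin M w" using adjoin_contains[OF M(1) w(1)] by auto
  obtain v\<^sub>0 where v\<^sub>0: "v\<^sub>0 \<in> W - U" "prods_in M {v\<^sub>0} U"
    using M(2) U W UW invU invW MM'(1) prods_in_mono unfolding engel_def by (metis order_refl)
  define W\<^sub>0 where "W\<^sub>0 = {v \<in> W. prods_in M {v} U}"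
  have W\<^sub>0: "sub W\<^sub>0" unfolding W\<^sub>0_def by (rule subspace_transporter[OF MP U W])
  have W\<^sub>0_inv: "prods_in {w} W\<^sub>0 W\<^sub>0"
    unfolding W\<^sub>0_def
    using annihilated_section_invariant[OF MP w(1) U W w(2)] invU invW MM'(2) prods_in_mono
    by (metis order_refl)
  have wU: "prods_in {w} U U" using prods_in_mono[OF invU MM'(2)] by blast
  have "\<exists>v\<in>W\<^sub>0 - U. w \<otimes>\<^bsub>P\<^esub> v \<in> U"
  proof (rule nil_root_kernel[OF _ _ _ U W\<^sub>0])
    show "v\<^sub>0 \<in> roots (\<lambda>v. w \<otimes>\<^bsub>P\<^esub> v) {\<zero>\<^bsub>F\<^esub>} {\<zero>\<^bsub>P\<^esub>}"
      using nil v\<^sub>0(1) subspaceD(5)[OF W] by (auto simp: spectrum_in_def)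
    show "v\<^sub>0 \<notin> U" "v\<^sub>0 \<in> W\<^sub>0" using v\<^sub>0 by (auto simp: W\<^sub>0_def)
    show "w \<otimes>\<^bsub>P\<^esub> v \<in> W\<^sub>0" if "v \<in> W\<^sub>0" for v using prods_inD(1)[OF W\<^sub>0_inv _ that] by simp
  qed
  then obtain v\<^sub>1 where v\<^sub>1: "v\<^sub>1 \<in> W\<^sub>0 - U" "w \<otimes>\<^bsub>P\<^esub> v\<^sub>1 \<in> U" by blast
  define W\<^sub>1 where "W\<^sub>1 = {v \<in> W\<^sub>0. w \<otimes>\<^bsub>P\<^esub> v \<in> U}"
  have W\<^sub>1: "sub W\<^sub>1" unfolding W\<^sub>1_def by (rule subspace_vimage[OF mult_right_hom[OF w(1)] U W\<^sub>0])
  have W\<^sub>1_inv: "\<lbrakk>w,v\<rbrakk>\<^bsub>P\<^esub> \<in> W\<^sub>1" if v: "v \<in> W\<^sub>1" for v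
  proof -
    have vP: "v \<in> carrier P" using subspaceD(5)[OF W\<^sub>1 v] .
    have "\<lbrakk>w, w \<otimes>\<^bsub>P\<^esub> v\<rbrakk>\<^bsub>P\<^esub> \<in> U" using prods_inD(2)[OF wU] v by (simp add: W\<^sub>1_def)
    moreover have "\<lbrakk>w, w \<otimes>\<^bsub>P\<^esub> v\<rbrakk>\<^bsub>P\<^esub> = w \<otimes>\<^bsub>P\<^esub> \<lbrakk>w,v\<rbrakk>\<^bsub>P\<^esub>"
      using bracket_mult_deriv[OF w(1) w(1) vP] bracket_alternating[OF w(1)]
        module_hom_zero[OF mult_left_hom[OF vP]] mult_closed bracket_closed w(1) vP by simp
    ultimately show ?thesis
      using prods_inD(2)[OF W\<^sub>0_inv] v by (simp add: W\<^sub>1_def)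
  qed
  have "\<exists>v\<in>W\<^sub>1 - U. \<lbrakk>w,v\<rbrakk>\<^bsub>P\<^esub> \<in> U"
  proof (rule nil_root_kernel[OF _ _ _ U W\<^sub>1 W\<^sub>1_inv])
    show "v\<^sub>1 \<in> roots (\<lambda>v. \<lbrakk>w,v\<rbrakk>\<^bsub>P\<^esub>) {\<zero>\<^bsub>F\<^esub>} {\<zero>\<^bsub>P\<^esub>}"
      using nil v\<^sub>1(1) subspaceD(5)[OF W\<^sub>0] by (auto simp: spectrum_in_def)
    show "v\<^sub>1 \<notin> U" "v\<^sub>1 \<in> W\<^sub>1" using v\<^sub>1 by (auto simp: W\<^sub>1_def)
  qed
  then obtain v\<^sub>2 where v\<^sub>2: "v\<^sub>2 \<in> W\<^sub>1 - U" "\<lbrakk>w,v\<^sub>2\<rbrakk>\<^bsub>P\<^esub> \<in> U" by blast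
  have v\<^sub>2P: "v\<^sub>2 \<in> carrier P" using v\<^sub>2(1) subspaceD(5)[OF W\<^sub>1] by blast
  have "prods_in {v\<^sub>2} M U"
    using v\<^sub>2(1) prods_in_swap_singleton[OF U MP v\<^sub>2P] by (simp add: W\<^sub>1_def W\<^sub>0_def)
  moreover have "prods_in {v\<^sub>2} {w} U"
  proof (rule prods_in_swap_singleton[OF U _ v\<^sub>2P])
    show "prods_in {w} {v\<^sub>2} U" using v\<^sub>2 by (simp add: W\<^sub>1_def prods_in_def)
  qed (use w in auto)
  ultimately have "prods_in {v\<^sub>2} (adjoin M w) U"
    using prods_in_adjoin[OF _ U MP w(1)] v\<^sub>2P by simp
  then have "prods_in (adjoin M w) {v\<^sub>2} U"
    using prods_in_swap[OF U _ subspaceD(1)[OF adjoin_subspace[OF M(1) w(1)]]] v\<^sub>2P by simp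
  then show "\<exists>v\<in>W - U. prods_in (adjoin M w) {v} U"
    using v\<^sub>2(1) by (auto simp: W\<^sub>1_def W\<^sub>0_def)
qed

lemma adjoin_subalgebra:
  assumes M: "sub M" "prods_in M M M" and w: "w \<in> carrier P" "prods_in M {w} M" "w \<otimes>\<^bsub>P\<^esub> w \<in> M"
  shows "prods_in (adjoin M w) (adjoin M w) (adjoin M w)"
proof -
  let ?M = "adjoin M w"
  note MP = subspaceD(1)[OF M(1)]
  have M': "sub ?M" by (rule adjoin_subspace[OF M(1) w(1)])
  note M'P = subspaceD(1)[OF M']
  have MM': "M \<subseteq> ?M" by (rule adjoin_contains[OF M(1) w(1)])
  have "prods_in M ?M ?M"
    using prods_in_mono[OF prods_in_adjoin[OF MP M(1) MP w(1) M(2) w(2)] order_refl order_refl MM'] .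
  then have "prods_in ?M M ?M" by (rule prods_in_swap[OF M' MP M'P])
  moreover have "prods_in ?M {w} ?M"
  proof (rule prods_in_swap[OF M' _ M'P])
    have "prods_in {w} M M" by (rule prods_in_swap_singleton[OF M(1) MP w(1,2)])
    moreover have "prods_in {w} {w} M"
      using w(3) bracket_alternating[OF w(1)] subspaceD(2)[OF M(1)] by (simp add: prods_in_def)
    ultimately have "prods_in {w} ?M M" using prods_in_adjoin[OF _ M(1) MP w(1)] w(1) by simp
    then show "prods_in {w} ?M ?M" using prods_in_mono[OF _ _ _ MM'] by blast
  qed (use w(1) in simp)
  ultimately show ?thesis using prods_in_adjoin[OF M'P M' MP w(1)] by blast
qed

text \<open>Engel's theorem, in the form of Jacobson's theorem on weakly closed sets of nilpotent maps.
  Let \<open>M\<close> be a maximal subalgebra of \<open>N\<close> among those with the Engel property. If \<open>M \<noteq> N\<close>, then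
  the property, applied to the section \<open>N / M\<close>, gives \<open>v \<notin> M\<close> that normalizes \<open>M\<close>, and some
  power \<open>w\<close> of \<open>v\<close> lies outside \<open>M\<close> while \<open>w w\<close> lies in \<open>M\<close>. Then \<open>M + F w\<close> is a larger
  subalgebra with the Engel property.\<close>

theorem engel_theorem:
  assumes fin: fin_dim and N: "poisson_subalgebra F P N"
    and nil: "\<And>x. x \<in> N \<Longrightarrow> spectrum_in {\<zero>\<^bsub>F\<^esub>} x {\<zero>\<^bsub>P\<^esub>}"
  shows "engel N"
proof -
  define Q where "Q M \<longleftrightarrow> poisson_subalgebra F P M \<and> M \<subseteq> N \<and> engel M" for M
  have N': "sub N" "prods_in N N N" using N by (auto simp: subalgebra_iff)
  have "prods_in {\<zero>\<^bsub>P\<^esub>} {v} U" if "v \<in> carrier P" "sub U" for v U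
    using that subspaceD(2) module_hom_zero[OF mult_left_hom] module_hom_zero[OF bracket_left_hom]
    by (simp add: prods_in_def)
  then have "engel {\<zero>\<^bsub>P\<^esub>}"
    unfolding engel_def using subspaceD(5) by (metis DiffI psubsetE subsetI)
  then have "Q {\<zero>\<^bsub>P\<^esub>}"
    using subalgebra_zero subspaceD(2)[OF N'(1)] by (simp add: Q_def)
  then obtain M where "Q M" and M_max: "\<forall>W. Q W \<longrightarrow> M \<subseteq> W \<longrightarrow> W = M"
    using exists_maximal_subspace[OF fin, of Q "{\<zero>\<^bsub>P\<^esub>}"] by (auto simp: Q_def subalgebra_iff)
  then have M: "sub M" "prods_in M M M" "M \<subseteq> N" "engel M" by (auto simp: Q_def subalgebra_iff)
  note MP = subspaceD(1)[OF M(1)] and NP = subspaceD(1)[OF N'(1)]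
  have "M = N"
  proof (rule ccontr)
    assume "M \<noteq> N"
    then have "M \<subset> N" using M(3) by blast
    moreover have "prods_in M N N" using prods_in_mono[OF N'(2) M(3)] by blast
    ultimately obtain v where v: "v \<in> N - M" "prods_in M {v} M"
      using M(4) M(1,2) N'(1) unfolding engel_def by blast
    have vP: "v \<in> carrier P" using v(1) NP by blast
    \<comment> \<open>Every element \<open>z\<close> of \<open>Z\<close> normalizes \<open>M\<close>, and \<open>v z \<in> M\<close> implies
      \<open>z z \<in> M\<close>: the latter because \<open>z y \<in> M\<close> whenever \<open>v y \<in> M\<close>, a property that all
      powers of \<open>v\<close> have.\<close>
    define Y where "Y = {y \<in> carrier P. v \<otimes>\<^bsub>P\<^esub> y \<in> M}"
    define Z where "Z = {z \<in> N. prods_in M {z} M} \<inter> {z \<in> carrier P. \<forall>y\<in>Y. y \<otimes>\<^bsub>P\<^esub> z \<in> M}"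
    have Z: "sub Z"
    proof -
      have A: "sub {z \<in> N. prods_in M {z} M}" by (rule subspace_transporter[OF MP M(1) N'(1)])
      have B: "sub {z \<in> {z \<in> N. prods_in M {z} M}. y \<otimes>\<^bsub>P\<^esub> z \<in> M}" if "y \<in> Y" for y
        using subspace_vimage[OF mult_right_hom M(1) A] that by (simp add: Y_def)
      have "sub (carrier P \<inter> \<Inter>(insert {z \<in> N. prods_in M {z} M}
          ((\<lambda>y. {z \<in> {z \<in> N. prods_in M {z} M}. y \<otimes>\<^bsub>P\<^esub> z \<in> M}) ` Y)))"
        using A B by (intro subspace_Inter) auto
      moreover have "carrier P \<inter> \<Inter>(insert {z \<in> N. prods_in M {z} M}
          ((\<lambda>y. {z \<in> {z \<in> N. prods_in M {z} M}. y \<otimes>\<^bsub>P\<^esub> z \<in> M}) ` Y)) = Z"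
        using NP by (auto simp: Z_def)
      ultimately show ?thesis by simp
    qed
    have vZ: "v \<in> Z"
      using v vP mult_comm[OF vP] by (auto simp: Z_def Y_def)
    have Z_inv: "v \<otimes>\<^bsub>P\<^esub> z \<in> Z" if z: "z \<in> Z" for z
    proof -
      have zN: "z \<in> N" and Mz: "prods_in M {z} M" and Yz: "\<And>y. y \<in> Y \<Longrightarrow> y \<otimes>\<^bsub>P\<^esub> z \<in> M"
        using z by (auto simp: Z_def)
      have zP: "z \<in> carrier P" using zN NP by blast
      have vzN: "v \<otimes>\<^bsub>P\<^esub> z \<in> N" using prods_inD(1)[OF N'(2)] v(1) zN by blast
      have vM: "v \<otimes>\<^bsub>P\<^esub> m \<in> M" if "m \<in> M" for m
        using prods_inD(1)[OF v(2) that] mult_comm[OF vP] that MP by auto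
      have Mvz: "prods_in M {v \<otimes>\<^bsub>P\<^esub> z} M"
        unfolding prods_in_def
      proof (intro ballI)
        fix m x assume m: "m \<in> M" and "x \<in> {v \<otimes>\<^bsub>P\<^esub> z}"
        then have x: "x = v \<otimes>\<^bsub>P\<^esub> z" by simp
        have mP: "m \<in> carrier P" using m MP by blast
        have "m \<otimes>\<^bsub>P\<^esub> (v \<otimes>\<^bsub>P\<^esub> z) \<in> M"
          using mult_assoc[OF mP vP zP] prods_inD(1)[OF Mz prods_inD(1)[OF v(2) m]] by simp
        moreover have "\<lbrakk>m, v \<otimes>\<^bsub>P\<^esub> z\<rbrakk>\<^bsub>P\<^esub> \<in> M"
          unfolding bracket_mult_deriv[OF mP vP zP]
          by (intro subspaceD(3)[OF M(1)] prods_inD(1)[OF Mz] vM prods_inD(2)[OF v(2) m]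
              prods_inD(2)[OF Mz m]) auto
        ultimately show "m \<otimes>\<^bsub>P\<^esub> x \<in> M \<and> \<lbrakk>m,x\<rbrakk>\<^bsub>P\<^esub> \<in> M" using x by simp
      qed
      have "y \<otimes>\<^bsub>P\<^esub> (v \<otimes>\<^bsub>P\<^esub> z) \<in> M" if y: "y \<in> Y" for y
      proof -
        have yP: "y \<in> carrier P" using y by (simp add: Y_def)
        have "y \<otimes>\<^bsub>P\<^esub> (v \<otimes>\<^bsub>P\<^esub> z) = v \<otimes>\<^bsub>P\<^esub> (y \<otimes>\<^bsub>P\<^esub> z)"
          using mult_assoc[OF yP vP zP] mult_assoc[OF vP yP zP] mult_comm[OF yP vP] by simp
        then show ?thesis using vM[OF Yz[OF y]] by simp
      qed
      then show ?thesis using vzN Mvz NP by (auto simp: Z_def)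
    qed
    have "\<exists>w\<in>Z - M. v \<otimes>\<^bsub>P\<^esub> w \<in> M"
    proof (rule nil_root_kernel[OF _ _ vZ M(1) Z Z_inv])
      show "v \<in> roots (\<lambda>y. v \<otimes>\<^bsub>P\<^esub> y) {\<zero>\<^bsub>F\<^esub>} {\<zero>\<^bsub>P\<^esub>}"
        using nil[of v] v(1) vP by (auto simp: spectrum_in_def)
    qed (use v(1) in blast)+
    then obtain w where w: "w \<in> Z" "w \<notin> M" "v \<otimes>\<^bsub>P\<^esub> w \<in> M" by blast
    have wP: "w \<in> carrier P" and wN: "w \<in> N" and Mw: "prods_in M {w} M" and ww: "w \<otimes>\<^bsub>P\<^esub> w \<in> M"
      using w by (auto simp: Z_def Y_def)
    have "Q (adjoin M w)"
      unfolding Q_def subalgebra_iff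
      using adjoin_subspace[OF M(1) wP] adjoin_subalgebra[OF M(1,2) wP Mw ww]
        adjoin_least[OF N'(1) M(3) wN] engel_adjoin[OF M(1,4) wP Mw nil[OF wN]] by blast
    then show False
      using M_max adjoin_contains[OF M(1) wP] w(2) by blast
  qed
  then show ?thesis using M(4) by simp
qed

section \<open>Nilpotent Poisson algebras\<close>

fun lower_central :: "nat \<Rightarrow> 'p set" where
  "lower_central 0 = carrier P"
| "lower_central (Suc k) =
     span (\<Union>x\<in>carrier P. \<Union>v\<in>lower_central k. {x \<otimes>\<^bsub>P\<^esub> v, \<lbrakk>x,v\<rbrakk>\<^bsub>P\<^esub>})"

lemma lower_central_carrier: "lower_central k \<subseteq> carrier P"
proof (induction k)
  case (Suc k)
  then show ?case
    unfolding lower_central.simps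
    by (intro span_is_subset2) (auto intro: mult_closed bracket_closed)
qed simp

lemma lower_central_generators_carrier:
  "(\<Union>x\<in>carrier P. \<Union>v\<in>lower_central k. {x \<otimes>\<^bsub>P\<^esub> v, \<lbrakk>x,v\<rbrakk>\<^bsub>P\<^esub>}) \<subseteq> carrier P"
  using lower_central_carrier[of k] by (auto intro: mult_closed bracket_closed)

lemma lower_central_subspace: "sub (lower_central k)"
proof (cases k)
  case (Suc k')
  then show ?thesis
    using span_is_subspace[OF lower_central_generators_carrier] by simp
qed (simp add: subspace_carrier)

lemma lower_central_prods: "prods_in (carrier P) (lower_central k) (lower_central (Suc k))"
  using in_own_span[OF lower_central_generators_carrier[of k]] by (auto simp: prods_in_def)

text \<open>The left-normed powers are multiplicative, as in a Lie algebra: move the factors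
  of the second argument to the left one at a time by the Leibniz and Jacobi identities.\<close>

lemma lower_central_mult:
  "prods_in (lower_central i) (lower_central j) (lower_central (Suc (i + j)))"
proof (induction j arbitrary: i)
  case 0
  show ?case
    using prods_in_swap[OF lower_central_subspace order_refl lower_central_carrier
        lower_central_prods[of i]] by simp
next
  case (Suc j)
  let ?W = "lower_central (Suc (i + Suc j))"
  note W = lower_central_subspace[of "Suc (i + Suc j)"]
  show ?case
    unfolding lower_central.simps(2)[of j]
  proof (rule prods_in_span[OF lower_central_carrier W lower_central_generators_carrier])
    show "prods_in (lower_central i) (\<Union>x\<in>carrier P. \<Union>v\<in>lower_central j. {x \<otimes>\<^bsub>P\<^esub> v, \<lbrakk>x,v\<rbrakk>\<^bsub>P\<^esub>}) ?W"
      unfolding prods_in_def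
    proof (intro ballI)
      fix u g assume u: "u \<in> lower_central i"
        and "g \<in> (\<Union>x\<in>carrier P. \<Union>v\<in>lower_central j. {x \<otimes>\<^bsub>P\<^esub> v, \<lbrakk>x,v\<rbrakk>\<^bsub>P\<^esub>})"
      then obtain x v where x: "x \<in> carrier P" and v: "v \<in> lower_central j"
        and g: "g = x \<otimes>\<^bsub>P\<^esub> v \<or> g = \<lbrakk>x,v\<rbrakk>\<^bsub>P\<^esub>" by blast
      have uP: "u \<in> carrier P" and vP: "v \<in> carrier P" using u v lower_central_carrier by auto
      have uv: "u \<otimes>\<^bsub>P\<^esub> v \<in> lower_central (Suc (i + j))" "\<lbrakk>u,v\<rbrakk>\<^bsub>P\<^esub> \<in> lower_central (Suc (i + j))"
        using prods_inD[OF Suc.IH u v] by auto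
      have up: "x \<otimes>\<^bsub>P\<^esub> a \<in> ?W" "\<lbrakk>x,a\<rbrakk>\<^bsub>P\<^esub> \<in> ?W" if "a \<in> lower_central (Suc (i + j))" for a
        using prods_inD[OF lower_central_prods x that] by simp_all
      have xu: "\<lbrakk>x,u\<rbrakk>\<^bsub>P\<^esub> \<in> lower_central (Suc i)" using prods_inD(2)[OF lower_central_prods x u] .
      then have ux: "\<lbrakk>u,x\<rbrakk>\<^bsub>P\<^esub> \<in> lower_central (Suc i)"
        using bracket_swap_in[OF lower_central_subspace x uP] by blast
      have IH': "a \<otimes>\<^bsub>P\<^esub> v \<in> ?W" "\<lbrakk>a,v\<rbrakk>\<^bsub>P\<^esub> \<in> ?W" if "a \<in> lower_central (Suc i)" for a
        using prods_inD[OF Suc.IH that v] by simp_all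
      have "u \<otimes>\<^bsub>P\<^esub> (x \<otimes>\<^bsub>P\<^esub> v) \<in> ?W"
      proof -
        have "u \<otimes>\<^bsub>P\<^esub> (x \<otimes>\<^bsub>P\<^esub> v) = x \<otimes>\<^bsub>P\<^esub> (u \<otimes>\<^bsub>P\<^esub> v)"
          using mult_assoc[OF uP x vP] mult_assoc[OF x uP vP] mult_comm[OF uP x] by simp
        then show ?thesis using up(1)[OF uv(1)] by simp
      qed
      moreover have "\<lbrakk>u, x \<otimes>\<^bsub>P\<^esub> v\<rbrakk>\<^bsub>P\<^esub> \<in> ?W"
        unfolding bracket_mult_deriv[OF uP x vP]
        by (rule subspaceD(3)[OF W IH'(1)[OF ux] up(1)[OF uv(2)]])
      moreover have "u \<otimes>\<^bsub>P\<^esub> \<lbrakk>x,v\<rbrakk>\<^bsub>P\<^esub> \<in> ?W"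
      proof (rule subspace_cancel_left[OF W])
        show "\<lbrakk>x,u\<rbrakk>\<^bsub>P\<^esub> \<otimes>\<^bsub>P\<^esub> v \<oplus>\<^bsub>P\<^esub> u \<otimes>\<^bsub>P\<^esub> \<lbrakk>x,v\<rbrakk>\<^bsub>P\<^esub> \<in> ?W"
          using up(2)[OF uv(1)] unfolding bracket_mult_deriv[OF x uP vP] .
        show "\<lbrakk>x,u\<rbrakk>\<^bsub>P\<^esub> \<otimes>\<^bsub>P\<^esub> v \<in> ?W" using IH'(1)[OF xu] .
      qed (use uP x vP in \<open>auto intro: mult_closed bracket_closed\<close>)
      moreover have "\<lbrakk>u, \<lbrakk>x,v\<rbrakk>\<^bsub>P\<^esub>\<rbrakk>\<^bsub>P\<^esub> \<in> ?W"
        unfolding bracket_bracket_deriv[OF uP x vP]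
        by (rule subspaceD(3)[OF W IH'(2)[OF ux] up(2)[OF uv(2)]])
      ultimately show "u \<otimes>\<^bsub>P\<^esub> g \<in> ?W \<and> \<lbrakk>u,g\<rbrakk>\<^bsub>P\<^esub> \<in> ?W" using g by blast
    qed
  qed
qed

lemma poisson_power_Suc_Suc:
  "poisson_power F P (Suc (Suc n)) = span (\<Union>i\<in>{1..Suc n}.
     mult_span F P (poisson_power F P i) (poisson_power F P (Suc (Suc n) - i)) \<union>
     bracket_span F P (poisson_power F P i) (poisson_power F P (Suc (Suc n) - i)))"
  by simp

lemma prods_in_mult_span_bracket_span:
  assumes "prods_in X Y W" "sub W"
  shows "mult_span F P X Y \<union> bracket_span F P X Y \<subseteq> W"
  unfolding mult_span_def bracket_span_def
proof (intro Un_least span_is_subset is_module assms(2))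
  show "{x \<otimes>\<^bsub>P\<^esub> y | x y. x \<in> X \<and> y \<in> Y} \<subseteq> W" "{\<lbrakk>x,y\<rbrakk>\<^bsub>P\<^esub> | x y. x \<in> X \<and> y \<in> Y} \<subseteq> W"
    using assms(1) by (auto simp: prods_in_def)
qed

text \<open>All bracketings of \<open>k + 1\<close> factors reduce to left-normed ones.\<close>

lemma poisson_power_subset_lower_central: "poisson_power F P (Suc k) \<subseteq> lower_central k"
proof (induction k rule: less_induct)
  case (less k)
  show ?case
  proof (cases k)
    case (Suc n)
    have "mult_span F P (poisson_power F P i) (poisson_power F P (Suc (Suc n) - i)) \<union>
        bracket_span F P (poisson_power F P i) (poisson_power F P (Suc (Suc n) - i))
        \<subseteq> lower_central k" if i: "i \<in> {1..Suc n}" for i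
    proof -
      obtain a where a: "i = Suc a" "a \<le> n" using i by (cases i) auto
      have "Suc (Suc n) - i = Suc (n - a)" using a by simp
      moreover have "Suc (a + (n - a)) = k" using a Suc by simp
      ultimately have "prods_in (poisson_power F P i) (poisson_power F P (Suc (Suc n) - i))
          (lower_central k)"
        using prods_in_mono[OF lower_central_mult[of a "n - a"]] less[of a] less[of "n - a"] a Suc
        by simp
      then show ?thesis by (rule prods_in_mult_span_bracket_span[OF _ lower_central_subspace])
    qed
    then show ?thesis
      unfolding Suc poisson_power_Suc_Suc
      by (intro span_is_subset is_module lower_central_subspace UN_least)
  next
    case 0
    show ?thesis unfolding 0 by simp
  qed
qed

lemma poisson_power_carrier: "poisson_power F P k \<subseteq> carrier P"
  using poisson_power_subset_lower_central lower_central_carrier by (cases k) fastforce+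

lemma poisson_power_prods:
  "prods_in (carrier P) (poisson_power F P (Suc k)) (poisson_power F P (Suc (Suc k)))"
proof -
  let ?X = "poisson_power F P (Suc k)"
  let ?G = "\<Union>i\<in>{1..Suc k}.
     mult_span F P (poisson_power F P i) (poisson_power F P (Suc (Suc k) - i)) \<union>
     bracket_span F P (poisson_power F P i) (poisson_power F P (Suc (Suc k) - i))"
  have prods: "{x \<otimes>\<^bsub>P\<^esub> y | x y. x \<in> X \<and> y \<in> Y} \<subseteq> carrier P" "{\<lbrakk>x,y\<rbrakk>\<^bsub>P\<^esub> | x y. x \<in> X \<and> y \<in> Y} \<subseteq> carrier P"
    if "X \<subseteq> carrier P" "Y \<subseteq> carrier P" for X Y
    using that by (auto intro: mult_closed bracket_closed)
  have G: "?G \<subseteq> carrier P"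
    unfolding mult_span_def bracket_span_def
    by (intro UN_least Un_least span_is_subset2 prods poisson_power_carrier)
  have "mult_span F P (carrier P) ?X \<union> bracket_span F P (carrier P) ?X \<subseteq> ?G"
    by (rule subset_trans[OF _ UN_upper[of 1]]) auto
  moreover have "prods_in (carrier P) ?X (mult_span F P (carrier P) ?X \<union> bracket_span F P (carrier P) ?X)"
    unfolding mult_span_def bracket_span_def prods_in_def
    using in_own_span[OF prods(1)[OF order_refl poisson_power_carrier[of "Suc k"]]]
      in_own_span[OF prods(2)[OF order_refl poisson_power_carrier[of "Suc k"]]] by blast
  ultimately show ?thesis
    unfolding poisson_power_Suc_Suc
    using in_own_span[OF G] by (meson prods_in_mono order_refl subset_trans)
qed

text \<open>An ascending central series of length \<open>k\<close> that ends in \<open>U\<close>. Engel's theorem builds it from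
  below; it bounds the length of the descending series.\<close>

inductive central_chain :: "nat \<Rightarrow> 'p set \<Rightarrow> bool" where
  zero: "central_chain 0 {\<zero>\<^bsub>P\<^esub>}"
| step: "central_chain k U \<Longrightarrow> sub W \<Longrightarrow> U \<subseteq> W \<Longrightarrow> prods_in (carrier P) W U
         \<Longrightarrow> central_chain (Suc k) W"

lemma central_chain_subspace: "central_chain k U \<Longrightarrow> sub U"
  by (induction rule: central_chain.induct) (auto simp: subspace_zero)

lemma central_chain_prods: "central_chain k U \<Longrightarrow> prods_in (carrier P) U U"
proof (induction rule: central_chain.induct)
  case zero
  then show ?case using ideal_zero by (simp add: ideal_iff)
next
  case (step k U W)
  then show ?case by (auto simp: prods_in_def)
qed

lemma central_chain_lower_central:
  assumes "central_chain k U" "lower_central j \<subseteq> U"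
  shows "lower_central (j + k) \<subseteq> {\<zero>\<^bsub>P\<^esub>}"
  using assms
proof (induction arbitrary: j)
  case zero
  then show ?case by simp
next
  case (step k U W)
  have "lower_central (Suc j) \<subseteq> U"
    unfolding lower_central.simps
    using step by (intro span_is_subset is_module central_chain_subspace) (auto simp: prods_in_def)
  then show ?case using step.IH by fastforce
qed

text \<open>If a power vanishes, then iterated multiplications by one element vanish. Conversely, a
  maximal term of a central series is the whole algebra, because Engel's theorem would otherwise
  provide a larger one.\<close>

theorem poisson_nilpotent_iff:
  assumes fin: fin_dim
  shows "poisson_nilpotent F P \<longleftrightarrow> (\<forall>x\<in>carrier P. spectrum_in {\<zero>\<^bsub>F\<^esub>} x {\<zero>\<^bsub>P\<^esub>})"
proof
  assume "poisson_nilpotent F P"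
  then obtain m where m: "poisson_power F P (Suc m) = {\<zero>\<^bsub>P\<^esub>}"
    unfolding poisson_nilpotent_def by (metis Suc_le_D One_nat_def)
  show "\<forall>x\<in>carrier P. spectrum_in {\<zero>\<^bsub>F\<^esub>} x {\<zero>\<^bsub>P\<^esub>}"
  proof
    fix x assume x: "x \<in> carrier P"
    have "v \<in> roots T {\<zero>\<^bsub>F\<^esub>} {\<zero>\<^bsub>P\<^esub>}"
      if T: "T \<in> module_hom F P P" and v: "v \<in> carrier P"
        and step: "\<And>k v. v \<in> poisson_power F P (Suc k) \<Longrightarrow> T v \<in> poisson_power F P (Suc (Suc k))"
      for T v
    proof (rule funpow_into_root_space[OF T _ v])
      have "(T ^^ k) v \<in> poisson_power F P (Suc k)" for k
        by (induction k) (use v step in auto)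
      then show "(T ^^ m) v \<in> {\<zero>\<^bsub>P\<^esub>}" using m by blast
    qed simp
    from this[OF mult_right_hom[OF x]] this[OF bracket_right_hom[OF x]]
    show "spectrum_in {\<zero>\<^bsub>F\<^esub>} x {\<zero>\<^bsub>P\<^esub>}"
      unfolding spectrum_in_def using prods_inD[OF poisson_power_prods x] by blast
  qed
next
  assume nil: "\<forall>x\<in>carrier P. spectrum_in {\<zero>\<^bsub>F\<^esub>} x {\<zero>\<^bsub>P\<^esub>}"
  have "poisson_subalgebra F P (carrier P)"
    using subspace_carrier by (auto simp: subalgebra_iff prods_in_def mult_closed bracket_closed)
  then have engel: "engel (carrier P)" using engel_theorem[OF fin] nil by blast
  have "\<exists>U. (\<exists>k. central_chain k U) \<and> (\<forall>W. (\<exists>k. central_chain k W) \<longrightarrow> U \<subseteq> W \<longrightarrow> W = U)"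
    by (rule exists_maximal_subspace[OF fin]) (use central_chain.zero central_chain_subspace in blast)+
  then obtain U k where U: "central_chain k U"
    and max: "\<And>W k. central_chain k W \<Longrightarrow> U \<subseteq> W \<Longrightarrow> W = U" by blast
  note subU = central_chain_subspace[OF U] and UU = central_chain_prods[OF U]
  have "U = carrier P"
  proof (rule ccontr)
    assume "U \<noteq> carrier P"
    then have "U \<subset> carrier P" using subspaceD(1)[OF subU] by blast
    moreover have "prods_in (carrier P) (carrier P) (carrier P)"
      by (simp add: prods_in_def mult_closed bracket_closed)
    ultimately obtain v where v: "v \<in> carrier P - U" "prods_in (carrier P) {v} U"
      using engel subU UU subspace_carrier unfolding engel_def by blast
    have vP: "v \<in> carrier P" using v by blast
    have "prods_in (carrier P) (adjoin U v) U"
      using prods_in_adjoin[OF _ subU subspaceD(1)[OF subU] vP UU v(2)] by blast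
    then have "central_chain (Suc k) (adjoin U v)"
      using central_chain.step[OF U adjoin_subspace[OF subU vP] adjoin_contains(1)[OF subU vP]] by blast
    then show False using max adjoin_contains[OF subU vP] v(1) by blast
  qed
  then have "lower_central (0 + k) \<subseteq> {\<zero>\<^bsub>P\<^esub>}"
    using central_chain_lower_central[OF U, of 0] by simp
  moreover have "\<zero>\<^bsub>P\<^esub> \<in> poisson_power F P (Suc k)"
    by (cases k) (simp_all add: span_zero)
  ultimately have "poisson_power F P (Suc k) = {\<zero>\<^bsub>P\<^esub>}"
    using poisson_power_subset_lower_central[of k] by auto
  then show "poisson_nilpotent F P"
    unfolding poisson_nilpotent_def by (intro exI[of _ "Suc k"]) simp
qed

end


section \<open>Supersolvable Poisson algebras\<close>

context vectorspace
begin

text \<open>The scalar is the coefficient of \<open>w\<close> in \<open>T w\<close>.\<close>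

lemma adjoin_scalar_action:
  assumes T: "T \<in> module_hom K V V" and U: "VectorSpace.subspace K U V" and w: "w \<in> carrier V"
    and TU: "\<And>u. u \<in> U \<Longrightarrow> T u \<in> U" and Tw: "T w \<in> adjoin U w"
  shows "\<exists>l\<in>carrier K. \<forall>v\<in>adjoin U w. \<exists>u\<in>U. T v = l \<odot>\<^bsub>V\<^esub> v \<oplus>\<^bsub>V\<^esub> u"
proof -
  obtain u\<^sub>0 l where l: "u\<^sub>0 \<in> U" "l \<in> carrier K" "T w = u\<^sub>0 \<oplus>\<^bsub>V\<^esub> l \<odot>\<^bsub>V\<^esub> w"
    using Tw by (auto simp: adjoin_def)
  have "\<exists>u\<in>U. T v = l \<odot>\<^bsub>V\<^esub> v \<oplus>\<^bsub>V\<^esub> u" if "v \<in> adjoin U w" for v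
  proof -
    obtain u b where v: "u \<in> U" "b \<in> carrier K" "v = u \<oplus>\<^bsub>V\<^esub> b \<odot>\<^bsub>V\<^esub> w"
      using \<open>v \<in> adjoin U w\<close> by (auto simp: adjoin_def)
    let ?u = "(T u \<oplus>\<^bsub>V\<^esub> b \<odot>\<^bsub>V\<^esub> u\<^sub>0) \<oplus>\<^bsub>V\<^esub> \<ominus>\<^bsub>V\<^esub> (l \<odot>\<^bsub>V\<^esub> u)"
    have c: "u \<in> carrier V" "u\<^sub>0 \<in> carrier V" "T u \<in> carrier V"
      using subspaceD(5)[OF U] v(1) l(1) TU by auto
    have "T v = T u \<oplus>\<^bsub>V\<^esub> b \<odot>\<^bsub>V\<^esub> T w"
      using module_hom_add[OF T, of u "b \<odot>\<^bsub>V\<^esub> w"] module_hom_smult[OF T v(2) w] v c w by simp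
    also have "\<dots> = T u \<oplus>\<^bsub>V\<^esub> (b \<odot>\<^bsub>V\<^esub> u\<^sub>0 \<oplus>\<^bsub>V\<^esub> l \<odot>\<^bsub>V\<^esub> (b \<odot>\<^bsub>V\<^esub> w))"
      using l v c w smult_left_commute[of b l w] by (simp add: smult_r_distr)
    also have "\<dots> = l \<odot>\<^bsub>V\<^esub> (b \<odot>\<^bsub>V\<^esub> w) \<oplus>\<^bsub>V\<^esub> (T u \<oplus>\<^bsub>V\<^esub> b \<odot>\<^bsub>V\<^esub> u\<^sub>0)"
      using c l v w by (simp add: M.a_ac)
    also have "T u \<oplus>\<^bsub>V\<^esub> b \<odot>\<^bsub>V\<^esub> u\<^sub>0 = l \<odot>\<^bsub>V\<^esub> u \<oplus>\<^bsub>V\<^esub> ?u"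
      using add_diff_cancel[of "T u \<oplus>\<^bsub>V\<^esub> b \<odot>\<^bsub>V\<^esub> u\<^sub>0" "l \<odot>\<^bsub>V\<^esub> u"] c l v by simp
    also have "l \<odot>\<^bsub>V\<^esub> (b \<odot>\<^bsub>V\<^esub> w) \<oplus>\<^bsub>V\<^esub> (l \<odot>\<^bsub>V\<^esub> u \<oplus>\<^bsub>V\<^esub> ?u) = (l \<odot>\<^bsub>V\<^esub> u \<oplus>\<^bsub>V\<^esub> l \<odot>\<^bsub>V\<^esub> (b \<odot>\<^bsub>V\<^esub> w)) \<oplus>\<^bsub>V\<^esub> ?u"
      using M.a_assoc[of "l \<odot>\<^bsub>V\<^esub> (b \<odot>\<^bsub>V\<^esub> w)" "l \<odot>\<^bsub>V\<^esub> u" ?u] M.a_comm[of "l \<odot>\<^bsub>V\<^esub> (b \<odot>\<^bsub>V\<^esub> w)" "l \<odot>\<^bsub>V\<^esub> u"] c l v w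
      by simp
    also have "l \<odot>\<^bsub>V\<^esub> u \<oplus>\<^bsub>V\<^esub> l \<odot>\<^bsub>V\<^esub> (b \<odot>\<^bsub>V\<^esub> w) = l \<odot>\<^bsub>V\<^esub> v"
      using c l v w by (simp add: smult_r_distr)
    finally have "T v = l \<odot>\<^bsub>V\<^esub> v \<oplus>\<^bsub>V\<^esub> ?u" .
    moreover have "?u \<in> U"
      by (intro subspaceD(3,4)[OF U] subspace_uminus[OF U] TU v l)
    ultimately show ?thesis by blast
  qed
  then show ?thesis using l(2) by blast
qed

text \<open>Scalars commute: modulo \<open>U\<close>, both \<open>S (T v)\<close> and \<open>T (S v)\<close> are equal to \<open>a b v\<close>.\<close>

lemma scalar_actions_commute:
  assumes S: "S \<in> module_hom K V V" and T: "T \<in> module_hom K V V"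
    and U: "VectorSpace.subspace K U V"
    and SU: "\<And>u. u \<in> U \<Longrightarrow> S u \<in> U" and TU: "\<And>u. u \<in> U \<Longrightarrow> T u \<in> U"
    and v: "v \<in> carrier V" and ab: "a \<in> carrier K" "b \<in> carrier K" "s \<in> U" "t \<in> U"
    and Sv: "S v = a \<odot>\<^bsub>V\<^esub> v \<oplus>\<^bsub>V\<^esub> s" and Tv: "T v = b \<odot>\<^bsub>V\<^esub> v \<oplus>\<^bsub>V\<^esub> t"
    and w: "w \<in> carrier V" "S (T v) = w \<oplus>\<^bsub>V\<^esub> T (S v)"
  shows "w \<in> U"
proof -
  let ?p = "a \<odot>\<^bsub>V\<^esub> (b \<odot>\<^bsub>V\<^esub> v)" and ?q = "a \<odot>\<^bsub>V\<^esub> t \<oplus>\<^bsub>V\<^esub> T s" and ?r = "b \<odot>\<^bsub>V\<^esub> s \<oplus>\<^bsub>V\<^esub> S t"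
  have c: "s \<in> carrier V" "t \<in> carrier V" "S t \<in> carrier V" "T s \<in> carrier V"
    using subspaceD(5)[OF U] SU TU ab(3,4) by auto
  have "S (T v) = b \<odot>\<^bsub>V\<^esub> S v \<oplus>\<^bsub>V\<^esub> S t"
    using Tv module_hom_add[OF S, of "b \<odot>\<^bsub>V\<^esub> v" t] module_hom_smult[OF S ab(2) v] c v ab by simp
  also have "\<dots> = ?p \<oplus>\<^bsub>V\<^esub> ?r"
    using Sv c v ab smult_left_commute[of b a v] by (simp add: smult_r_distr M.a_assoc)
  finally have 1: "S (T v) = ?p \<oplus>\<^bsub>V\<^esub> ?r" .
  have "T (S v) = a \<odot>\<^bsub>V\<^esub> T v \<oplus>\<^bsub>V\<^esub> T s"
    using Sv module_hom_add[OF T, of "a \<odot>\<^bsub>V\<^esub> v" s] module_hom_smult[OF T ab(1) v] c v ab by simp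
  also have "\<dots> = ?p \<oplus>\<^bsub>V\<^esub> ?q"
    using Tv c v ab by (simp add: smult_r_distr M.a_assoc)
  finally have "w \<oplus>\<^bsub>V\<^esub> (?p \<oplus>\<^bsub>V\<^esub> ?q) = ?p \<oplus>\<^bsub>V\<^esub> ?r" using 1 w(2) by simp
  moreover have "w \<oplus>\<^bsub>V\<^esub> (?p \<oplus>\<^bsub>V\<^esub> ?q) = ?p \<oplus>\<^bsub>V\<^esub> (w \<oplus>\<^bsub>V\<^esub> ?q)"
    by (rule M.a_lcomm) (use c v ab w in auto)
  ultimately have "?p \<oplus>\<^bsub>V\<^esub> (w \<oplus>\<^bsub>V\<^esub> ?q) = ?p \<oplus>\<^bsub>V\<^esub> ?r" by simp
  then have "w \<oplus>\<^bsub>V\<^esub> ?q = ?r" using c v ab w(1) by simp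
  moreover have "?q \<in> U" "?r \<in> U"
    by (intro subspaceD(3,4)[OF U] SU TU ab)+
  ultimately show ?thesis using subspace_cancel_right[OF U _ _ w(1)] by metis
qed

lemma eigenspace_subspace:
  assumes T: "T \<in> module_hom K V V" and U: "VectorSpace.subspace K U V"
    and W: "VectorSpace.subspace K W V" and l: "l \<in> carrier K"
  shows "VectorSpace.subspace K {v \<in> W. \<exists>u\<in>U. T v = l \<odot>\<^bsub>V\<^esub> v \<oplus>\<^bsub>V\<^esub> u} V"
proof (rule subspaceI)
  show "{v \<in> W. \<exists>u\<in>U. T v = l \<odot>\<^bsub>V\<^esub> v \<oplus>\<^bsub>V\<^esub> u} \<subseteq> carrier V" using subspaceD(1)[OF W] by blast
  show "\<zero>\<^bsub>V\<^esub> \<in> {v \<in> W. \<exists>u\<in>U. T v = l \<odot>\<^bsub>V\<^esub> v \<oplus>\<^bsub>V\<^esub> u}"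
    using module_hom_zero[OF T] subspaceD(2)[OF U] subspaceD(2)[OF W] l
    by (auto intro!: bexI[of _ "\<zero>\<^bsub>V\<^esub>"])
next
  fix x y assume "x \<in> {v \<in> W. \<exists>u\<in>U. T v = l \<odot>\<^bsub>V\<^esub> v \<oplus>\<^bsub>V\<^esub> u}" "y \<in> {v \<in> W. \<exists>u\<in>U. T v = l \<odot>\<^bsub>V\<^esub> v \<oplus>\<^bsub>V\<^esub> u}"
  then obtain u u' where *: "x \<in> W" "y \<in> W" "u \<in> U" "u' \<in> U" "T x = l \<odot>\<^bsub>V\<^esub> x \<oplus>\<^bsub>V\<^esub> u" "T y = l \<odot>\<^bsub>V\<^esub> y \<oplus>\<^bsub>V\<^esub> u'"
    by blast
  have c: "x \<in> carrier V" "y \<in> carrier V" "u \<in> carrier V" "u' \<in> carrier V"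
    using * subspaceD(5)[OF U] subspaceD(5)[OF W] by auto
  have "T (x \<oplus>\<^bsub>V\<^esub> y) = l \<odot>\<^bsub>V\<^esub> (x \<oplus>\<^bsub>V\<^esub> y) \<oplus>\<^bsub>V\<^esub> (u \<oplus>\<^bsub>V\<^esub> u')"
    using c * module_hom_add[OF T c(1,2)] add_exchange[of "l \<odot>\<^bsub>V\<^esub> x" u "l \<odot>\<^bsub>V\<^esub> y" u'] l
    by (simp add: smult_r_distr)
  then show "x \<oplus>\<^bsub>V\<^esub> y \<in> {v \<in> W. \<exists>u\<in>U. T v = l \<odot>\<^bsub>V\<^esub> v \<oplus>\<^bsub>V\<^esub> u}"
    using * subspaceD(3)[OF U] subspaceD(3)[OF W] by blast
next
  fix a x assume a: "a \<in> carrier K" and "x \<in> {v \<in> W. \<exists>u\<in>U. T v = l \<odot>\<^bsub>V\<^esub> v \<oplus>\<^bsub>V\<^esub> u}"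
  then obtain u where *: "x \<in> W" "u \<in> U" "T x = l \<odot>\<^bsub>V\<^esub> x \<oplus>\<^bsub>V\<^esub> u" by blast
  have c: "x \<in> carrier V" "u \<in> carrier V"
    using * subspaceD(5)[OF U] subspaceD(5)[OF W] by auto
  have "T (a \<odot>\<^bsub>V\<^esub> x) = l \<odot>\<^bsub>V\<^esub> (a \<odot>\<^bsub>V\<^esub> x) \<oplus>\<^bsub>V\<^esub> a \<odot>\<^bsub>V\<^esub> u"
    using module_hom_smult[OF T a c(1)] * c a l smult_left_commute[of a l x]
    by (simp add: smult_r_distr)
  then show "a \<odot>\<^bsub>V\<^esub> x \<in> {v \<in> W. \<exists>u\<in>U. T v = l \<odot>\<^bsub>V\<^esub> v \<oplus>\<^bsub>V\<^esub> u}"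
    using * a subspaceD(4)[OF U] subspaceD(4)[OF W] by blast
qed

end

context poisson_algebra
begin

text \<open>Both kinds of multiplication operators together, because most arguments below treat them
  alike.\<close>

definition multiplications :: "('p \<Rightarrow> 'p) set" where
  "multiplications = (\<lambda>x v. x \<otimes>\<^bsub>P\<^esub> v) ` carrier P \<union> (\<lambda>x v. \<lbrakk>x,v\<rbrakk>\<^bsub>P\<^esub>) ` carrier P"

lemma multiplications_hom: "T \<in> multiplications \<Longrightarrow> T \<in> module_hom F P P"
  unfolding multiplications_def using mult_right_hom bracket_right_hom by blast

lemma multiplicationsE:
  assumes "T \<in> multiplications"
  obtains (mult) x where "x \<in> carrier P" "T = (\<lambda>v. x \<otimes>\<^bsub>P\<^esub> v)"
    | (bracket) x where "x \<in> carrier P" "T = (\<lambda>v. \<lbrakk>x,v\<rbrakk>\<^bsub>P\<^esub>)"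
  using assms by (auto simp: multiplications_def)

lemma prods_in_carrier_iff:
  "prods_in (carrier P) X W \<longleftrightarrow> (\<forall>T\<in>multiplications. \<forall>v\<in>X. T v \<in> W)"
  by (auto simp: prods_in_def multiplications_def)

lemma spectrum_in_multiplications:
  "(\<forall>x\<in>carrier P. spectrum_in L x U) \<longleftrightarrow> (\<forall>T\<in>multiplications. carrier P \<subseteq> roots T L U)"
  by (auto simp: spectrum_in_def multiplications_def)

text \<open>For Lie algebras the derived algebra plays this part. Here only the
  brackets, and not all products, can be required to lie in a nilpotently acting ideal: the algebra
  \<open>F\<close>, with its own multiplication and zero bracket, is supersolvable and consists of products.\<close>

definition supersolvability_ideal :: "'p set \<Rightarrow> bool" where
  "supersolvability_ideal K \<longleftrightarrow> poisson_ideal F P K \<and> (\<forall>x\<in>carrier P. \<forall>y\<in>carrier P. \<lbrakk>x,y\<rbrakk>\<^bsub>P\<^esub> \<in> K) \<and>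
     (\<forall>x\<in>K. spectrum_in {\<zero>\<^bsub>F\<^esub>} x {\<zero>\<^bsub>P\<^esub>})"

text \<open>The commutator of two multiplications is again a multiplication, by a bracket, or zero.
  It vanishes modulo \<open>U\<close> on every vector that the ideal \<open>K\<close> maps into \<open>U\<close>.\<close>

lemma multiplications_commute:
  assumes K: "\<And>x y. x \<in> carrier P \<Longrightarrow> y \<in> carrier P \<Longrightarrow> \<lbrakk>x,y\<rbrakk>\<^bsub>P\<^esub> \<in> K"
    and U: "sub U" and v: "v \<in> carrier P" "prods_in K {v} U"
    and S: "S \<in> multiplications" and T: "T \<in> multiplications"
  shows "\<exists>u\<in>U. T (S v) = S (T v) \<oplus>\<^bsub>P\<^esub> u"
proof -
  note cl = mult_closed bracket_closed
  have Kv: "\<lbrakk>x,y\<rbrakk>\<^bsub>P\<^esub> \<otimes>\<^bsub>P\<^esub> v \<in> U" "\<lbrakk>\<lbrakk>x,y\<rbrakk>\<^bsub>P\<^esub>, v\<rbrakk>\<^bsub>P\<^esub> \<in> U" if "x \<in> carrier P" "y \<in> carrier P" for x y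
    using prods_inD[OF v(2) K[OF that]] by auto
  consider (mm) x y where "x \<in> carrier P" "y \<in> carrier P" "T = (\<lambda>v. x \<otimes>\<^bsub>P\<^esub> v)" "S = (\<lambda>v. y \<otimes>\<^bsub>P\<^esub> v)"
    | (mb) x y where "x \<in> carrier P" "y \<in> carrier P" "T = (\<lambda>v. x \<otimes>\<^bsub>P\<^esub> v)" "S = (\<lambda>v. \<lbrakk>y,v\<rbrakk>\<^bsub>P\<^esub>)"
    | (bm) x y where "x \<in> carrier P" "y \<in> carrier P" "T = (\<lambda>v. \<lbrakk>x,v\<rbrakk>\<^bsub>P\<^esub>)" "S = (\<lambda>v. y \<otimes>\<^bsub>P\<^esub> v)"
    | (bb) x y where "x \<in> carrier P" "y \<in> carrier P" "T = (\<lambda>v. \<lbrakk>x,v\<rbrakk>\<^bsub>P\<^esub>)" "S = (\<lambda>v. \<lbrakk>y,v\<rbrakk>\<^bsub>P\<^esub>)"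
    by (rule multiplicationsE[OF S]; rule multiplicationsE[OF T])
  then show ?thesis
  proof cases
    case mm
    have "x \<otimes>\<^bsub>P\<^esub> (y \<otimes>\<^bsub>P\<^esub> v) = y \<otimes>\<^bsub>P\<^esub> (x \<otimes>\<^bsub>P\<^esub> v)"
      using mult_assoc[OF mm(1,2) v(1)] mult_assoc[OF mm(2,1) v(1)] mult_comm[OF mm(1,2)] by simp
    then have "T (S v) = S (T v) \<oplus>\<^bsub>P\<^esub> \<zero>\<^bsub>P\<^esub>" using mm v cl by simp
    then show ?thesis using subspaceD(2)[OF U] by blast
  next
    case mb
    have c: "\<lbrakk>y,x\<rbrakk>\<^bsub>P\<^esub> \<otimes>\<^bsub>P\<^esub> v \<in> carrier P" "x \<otimes>\<^bsub>P\<^esub> \<lbrakk>y,v\<rbrakk>\<^bsub>P\<^esub> \<in> carrier P" using mb v cl by auto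
    have "\<lbrakk>y, x \<otimes>\<^bsub>P\<^esub> v\<rbrakk>\<^bsub>P\<^esub> = \<lbrakk>y,x\<rbrakk>\<^bsub>P\<^esub> \<otimes>\<^bsub>P\<^esub> v \<oplus>\<^bsub>P\<^esub> x \<otimes>\<^bsub>P\<^esub> \<lbrakk>y,v\<rbrakk>\<^bsub>P\<^esub>" by (rule bracket_mult_deriv[OF mb(2,1) v(1)])
    then have "T (S v) = S (T v) \<oplus>\<^bsub>P\<^esub> \<ominus>\<^bsub>P\<^esub> (\<lbrakk>y,x\<rbrakk>\<^bsub>P\<^esub> \<otimes>\<^bsub>P\<^esub> v)"
      using mb(3,4) c by (simp add: M.a_assoc add_diff_cancel)
    then show ?thesis using subspace_uminus[OF U Kv(1)[OF mb(2,1)]] by blast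
  next
    case bm
    have "\<lbrakk>x, y \<otimes>\<^bsub>P\<^esub> v\<rbrakk>\<^bsub>P\<^esub> = y \<otimes>\<^bsub>P\<^esub> \<lbrakk>x,v\<rbrakk>\<^bsub>P\<^esub> \<oplus>\<^bsub>P\<^esub> \<lbrakk>x,y\<rbrakk>\<^bsub>P\<^esub> \<otimes>\<^bsub>P\<^esub> v"
      using bracket_mult_deriv[OF bm(1,2) v(1)] bm v cl by (simp add: M.a_comm)
    then show ?thesis using bm(3,4) Kv(1)[OF bm(1,2)] by blast
  next
    case bb
    have "\<lbrakk>x, \<lbrakk>y,v\<rbrakk>\<^bsub>P\<^esub>\<rbrakk>\<^bsub>P\<^esub> = \<lbrakk>y, \<lbrakk>x,v\<rbrakk>\<^bsub>P\<^esub>\<rbrakk>\<^bsub>P\<^esub> \<oplus>\<^bsub>P\<^esub> \<lbrakk>\<lbrakk>x,y\<rbrakk>\<^bsub>P\<^esub>,v\<rbrakk>\<^bsub>P\<^esub>"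
      using bracket_bracket_deriv[OF bb(1,2) v(1)] bb v cl by (simp add: M.a_comm)
    then show ?thesis using bb(3,4) Kv(2)[OF bb(1,2)] by blast
  qed
qed

text \<open>A Lie-Kolchin argument. By Engel's theorem the ideal \<open>K\<close> annihilates a nonzero section
  \<open>W / U\<close>; take such a section, invariant under \<open>P\<close>, with \<open>W\<close> minimal. The multiplications
  commute on \<open>W / U\<close> and have eigenvectors there, so by minimality each is a scalar on it.\<close>

lemma common_eigenvector:
  assumes fin: fin_dim and K: "supersolvability_ideal K"
    and spec: "\<And>x. x \<in> carrier P \<Longrightarrow> spectrum_in (carrier F) x {\<zero>\<^bsub>P\<^esub>}"
    and U: "poisson_ideal F P U" "U \<noteq> carrier P"
  shows "\<exists>v\<in>carrier P - U. prods_in (carrier P) {v} (adjoin U v)"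
proof -
  have subU: "sub U" and UU: "prods_in (carrier P) U U" using U(1) by (auto simp: ideal_iff)
  have subK: "sub K" and KK: "prods_in (carrier P) K K"
    and brK: "\<And>x y. x \<in> carrier P \<Longrightarrow> y \<in> carrier P \<Longrightarrow> \<lbrakk>x,y\<rbrakk>\<^bsub>P\<^esub> \<in> K"
    using K by (auto simp: supersolvability_ideal_def ideal_iff)
  note KP = subspaceD(1)[OF subK] and UP = subspaceD(1)[OF subU]
  have PP: "prods_in (carrier P) (carrier P) (carrier P)"
    by (simp add: prods_in_def mult_closed bracket_closed)
  have "poisson_subalgebra F P K"
    using subK prods_in_mono[OF KK KP] by (auto simp: subalgebra_iff)
  then have "engel K"
    using engel_theorem[OF fin] K by (auto simp: supersolvability_ideal_def)
  moreover have "prods_in K U U" "prods_in K (carrier P) (carrier P)"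
    using prods_in_mono[OF UU KP] prods_in_mono[OF PP KP] by auto
  ultimately obtain v\<^sub>0 where v\<^sub>0: "v\<^sub>0 \<in> carrier P - U" "prods_in K {v\<^sub>0} U"
    using subU subspace_carrier UP U(2) unfolding engel_def by (metis psubsetI)
  define W\<^sub>0 where "W\<^sub>0 = {v \<in> carrier P. prods_in K {v} U}"
  have W\<^sub>0: "sub W\<^sub>0" unfolding W\<^sub>0_def by (rule subspace_transporter[OF KP subU subspace_carrier])
  have "prods_in {x} W\<^sub>0 W\<^sub>0" if x: "x \<in> carrier P" for x
    unfolding W\<^sub>0_def
  proof (rule annihilated_section_invariant[OF KP x subU subspace_carrier])
    show "prods_in K {x} K"
      using prods_in_mono[OF prods_in_swap[OF subK order_refl KP KK]] x by blast
  qed (use x UU PP in \<open>auto simp: prods_in_def\<close>)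
  then have W\<^sub>0_inv: "prods_in (carrier P) W\<^sub>0 W\<^sub>0" by (auto simp: prods_in_def)
  define Q where "Q W \<longleftrightarrow> sub W \<and> U \<subset> W \<and> W \<subseteq> W\<^sub>0 \<and> prods_in (carrier P) W W" for W
  have "U \<subseteq> W\<^sub>0" using prods_in_mono[OF UU KP] UP by (auto simp: W\<^sub>0_def prods_in_def)
  moreover have "v\<^sub>0 \<in> W\<^sub>0" "v\<^sub>0 \<notin> U" using v\<^sub>0 by (auto simp: W\<^sub>0_def)
  ultimately have "Q W\<^sub>0" using W\<^sub>0 W\<^sub>0_inv by (auto simp: Q_def)
  then obtain W where "Q W" and W_min: "\<forall>W'. Q W' \<longrightarrow> W' \<subseteq> W \<longrightarrow> W' = W"
    using exists_minimal_subspace[OF fin, of Q W\<^sub>0] by (auto simp: Q_def)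
  then have W: "sub W" "U \<subset> W" "W \<subseteq> W\<^sub>0" and WW: "prods_in (carrier P) W W"
    by (auto simp: Q_def)
  obtain v where v: "v \<in> W" "v \<notin> U" using W(2) by blast
  have vP: "v \<in> carrier P" using subspaceD(5)[OF W(1) v(1)] .
  have scalar: "\<exists>l\<in>carrier F. \<forall>v\<in>W. \<exists>u\<in>U. T v = l \<odot>\<^bsub>P\<^esub> v \<oplus>\<^bsub>P\<^esub> u" if T: "T \<in> multiplications" for T
  proof -
    note Th = multiplications_hom[OF T]
    have "v \<in> roots T (carrier F) {\<zero>\<^bsub>P\<^esub>}"
      using spec T vP spectrum_in_multiplications by blast
    then have "v \<in> roots T (carrier F) U"
      using root_space_mono subspaceD(2)[OF subU] by (metis empty_subsetI insert_subset order_refl)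
    then obtain w l where w: "w \<in> W - U" "l \<in> carrier F" "\<exists>u\<in>U. T w = l \<odot>\<^bsub>P\<^esub> w \<oplus>\<^bsub>P\<^esub> u"
      using root_space_eigenvector[of v T "carrier F" U W] v subU W(1) WW T
      by (auto simp: prods_in_carrier_iff)
    define E where "E = {v \<in> W. \<exists>u\<in>U. T v = l \<odot>\<^bsub>P\<^esub> v \<oplus>\<^bsub>P\<^esub> u}"
    have E: "sub E" unfolding E_def by (rule eigenspace_subspace[OF Th subU W(1) w(2)])
    have "U \<subseteq> E"
    proof
      fix u assume u: "u \<in> U"
      have uP: "u \<in> carrier P" using u UP by blast
      have TuU: "T u \<in> U" using UU T u by (auto simp: prods_in_carrier_iff)
      have "T u = l \<odot>\<^bsub>P\<^esub> u \<oplus>\<^bsub>P\<^esub> (T u \<oplus>\<^bsub>P\<^esub> \<ominus>\<^bsub>P\<^esub> (l \<odot>\<^bsub>P\<^esub> u))"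
        using add_diff_cancel[of "T u" "l \<odot>\<^bsub>P\<^esub> u"] uP TuU UP w(2) by auto
      moreover have "T u \<oplus>\<^bsub>P\<^esub> \<ominus>\<^bsub>P\<^esub> (l \<odot>\<^bsub>P\<^esub> u) \<in> U"
        by (intro subspaceD(3,4)[OF subU] subspace_uminus[OF subU] TuU u w)
      ultimately show "u \<in> E" using u W(2) by (auto simp: E_def)
    qed
    moreover have "w \<in> E" using w by (auto simp: E_def)
    moreover have "S x \<in> E" if S: "S \<in> multiplications" and x: "x \<in> E" for S x
    proof -
      note Sh = multiplications_hom[OF S]
      obtain u where xW: "x \<in> W" and u: "u \<in> U" "T x = l \<odot>\<^bsub>P\<^esub> x \<oplus>\<^bsub>P\<^esub> u" using x by (auto simp: E_def)
      have xP: "x \<in> carrier P" and uP: "u \<in> carrier P" using subspaceD(5)[OF W(1) xW] u UP by auto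
      have Sx: "S x \<in> W" using WW S xW by (auto simp: prods_in_carrier_iff)
      have SuU: "S u \<in> U" using UU S u by (auto simp: prods_in_carrier_iff)
      have "prods_in K {x} U" using xW W(3) by (auto simp: W\<^sub>0_def)
      then obtain u' where u': "u' \<in> U" "T (S x) = S (T x) \<oplus>\<^bsub>P\<^esub> u'"
        using multiplications_commute[OF brK subU xP _ S T] by blast
      have "S (T x) = l \<odot>\<^bsub>P\<^esub> S x \<oplus>\<^bsub>P\<^esub> S u"
        using u module_hom_add[OF Sh, of "l \<odot>\<^bsub>P\<^esub> x" u] module_hom_smult[OF Sh w(2) xP] xP uP w(2) by simp
      moreover have "S x \<in> carrier P" "S u \<in> carrier P" "u' \<in> carrier P"
        using subspaceD(5)[OF W(1) Sx] SuU u'(1) UP by auto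
      ultimately have "T (S x) = l \<odot>\<^bsub>P\<^esub> S x \<oplus>\<^bsub>P\<^esub> (S u \<oplus>\<^bsub>P\<^esub> u')"
        using u'(2) w(2) by (simp add: M.a_assoc)
      then show ?thesis using Sx subspaceD(3)[OF subU SuU u'(1)] by (auto simp: E_def)
    qed
    ultimately have "Q E"
      using E W(3) w(1) by (auto simp: Q_def prods_in_carrier_iff E_def)
    then have "E = W" using W_min by (auto simp: E_def)
    then show ?thesis using w(2) by (auto simp: E_def)
  qed
  have "prods_in (carrier P) {v} (adjoin U v)"
    unfolding prods_in_carrier_iff
  proof (intro ballI)
    fix T x assume T: "T \<in> multiplications" and "x \<in> {v}"
    obtain l u where "l \<in> carrier F" "u \<in> U" "T v = l \<odot>\<^bsub>P\<^esub> v \<oplus>\<^bsub>P\<^esub> u" using scalar[OF T] v(1) by blast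
    then show "T x \<in> adjoin U v"
      using \<open>x \<in> {v}\<close> vP UP M.a_comm[of "l \<odot>\<^bsub>P\<^esub> v" u] by (auto simp: adjoin_def)
  qed
  then show ?thesis using v(2) vP by blast
qed

text \<open>Initial parts of a flag: \<open>As n\<close> may be a proper ideal, so that a flag can be built one step at a
  time.\<close>

definition ideal_flag :: "nat \<Rightarrow> (nat \<Rightarrow> 'p set) \<Rightarrow> bool" where
  "ideal_flag n As \<longleftrightarrow> As 0 = {\<zero>\<^bsub>P\<^esub>} \<and> (\<forall>i<n. As i \<subset> As (Suc i)) \<and>
     (\<forall>i\<le>n. poisson_ideal F P (As i) \<and> vectorspace.fin_dim F (P\<lparr>carrier := As i\<rparr>) \<and>
        vectorspace.dim F (P\<lparr>carrier := As i\<rparr>) = i)"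

lemma poisson_supersolvable_flag:
  "poisson_supersolvable F P \<longleftrightarrow> (\<exists>n As. ideal_flag n As \<and> As n = carrier P)"
proof -
  have all_le: "(\<forall>i\<le>n. R i) \<longleftrightarrow> R 0 \<and> (\<forall>i\<in>{1..n}. R i)" for R :: "nat \<Rightarrow> bool" and n
  proof (intro iffI allI impI)
    fix i assume "R 0 \<and> (\<forall>i\<in>{1..n}. R i)" "i \<le> n"
    then show "R i" by (cases "i = 0") auto
  qed auto
  show ?thesis
    unfolding poisson_supersolvable_def ideal_flag_def all_le
    by (intro ex_cong1) (auto simp: ideal_zero dim_zero_subspace)
qed

text \<open>A supersolvable algebra acts on each factor of its flag by scalars. As scalars commute, all
  brackets act as zero, and the elements whose multiplications act as zero form the ideal
  that is sought. Conversely, a maximal ideal with a flag is the whole algebra, because it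
  could otherwise be enlarged by a common eigenvector.\<close>

theorem poisson_supersolvable_iff:
  assumes fin: fin_dim
  shows "poisson_supersolvable F P \<longleftrightarrow>
    (\<exists>K. supersolvability_ideal K) \<and> (\<forall>x\<in>carrier P. spectrum_in (carrier F) x {\<zero>\<^bsub>P\<^esub>})"
proof
  assume "poisson_supersolvable F P"
  then obtain n As where As: "ideal_flag n As" and An: "As n = carrier P"
    by (auto simp: poisson_supersolvable_flag)
  have A0: "As 0 = {\<zero>\<^bsub>P\<^esub>}" and A_less: "\<And>i. i < n \<Longrightarrow> As i \<subset> As (Suc i)"
    and A_sub: "\<And>i. i \<le> n \<Longrightarrow> sub (As i)" and A_inv: "\<And>i. i \<le> n \<Longrightarrow> prods_in (carrier P) (As i) (As i)"
    and A_dim: "\<And>i. i \<le> n \<Longrightarrow> vectorspace.dim F (P\<lparr>carrier := As i\<rparr>) = i"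
    using As by (auto simp: ideal_flag_def ideal_iff)
  have AP: "As i \<subseteq> carrier P" if "i \<le> n" for i using subspaceD(1)[OF A_sub[OF that]] .
  have scalar: "\<exists>l\<in>carrier F. \<forall>v\<in>As (Suc i). \<exists>u\<in>As i. T v = l \<odot>\<^bsub>P\<^esub> v \<oplus>\<^bsub>P\<^esub> u"
    if i: "i < n" and T: "T \<in> multiplications" for i T
  proof -
    have "Suc i \<le> n" "i \<le> n" using i by auto
    then obtain w where w: "w \<in> As (Suc i)" "As (Suc i) = adjoin (As i) w"
      using codimension_one_eq_adjoin[OF fin A_sub A_sub A_less[OF i]] A_dim by metis
    have "\<exists>l\<in>carrier F. \<forall>v\<in>adjoin (As i) w. \<exists>u\<in>As i. T v = l \<odot>\<^bsub>P\<^esub> v \<oplus>\<^bsub>P\<^esub> u"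
    proof (rule adjoin_scalar_action[OF multiplications_hom[OF T] A_sub[OF \<open>i \<le> n\<close>]])
      show "w \<in> carrier P" using w(1) AP[OF \<open>Suc i \<le> n\<close>] by blast
      show "T u \<in> As i" if "u \<in> As i" for u
        using A_inv[OF \<open>i \<le> n\<close>] T that by (auto simp: prods_in_carrier_iff)
      show "T w \<in> adjoin (As i) w"
        using A_inv[OF \<open>Suc i \<le> n\<close>] T w by (auto simp: prods_in_carrier_iff)
    qed
    then show ?thesis using w(2) by simp
  qed
  define K where "K = carrier P \<inter> (\<Inter>i\<in>{..<n}. {x \<in> carrier P. prods_in (As (Suc i)) {x} (As i)})"
  have subK: "sub K"
    unfolding K_def
  proof (rule subspace_Inter)
    fix W assume "W \<in> (\<lambda>i. {x \<in> carrier P. prods_in (As (Suc i)) {x} (As i)}) ` {..<n}"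
    then obtain i where "i < n" "W = {x \<in> carrier P. prods_in (As (Suc i)) {x} (As i)}" by auto
    then show "sub W" using subspace_transporter[OF AP A_sub subspace_carrier, of "Suc i" i] by simp
  qed
  have in_K: "x \<in> K \<longleftrightarrow> x \<in> carrier P \<and> (\<forall>i<n. \<forall>v\<in>As (Suc i). v \<otimes>\<^bsub>P\<^esub> x \<in> As i \<and> \<lbrakk>v,x\<rbrakk>\<^bsub>P\<^esub> \<in> As i)" for x
    by (auto simp: K_def prods_in_def)
  have "prods_in (carrier P) K K"
    unfolding prods_in_def
  proof (intro ballI)
    fix b x assume b: "b \<in> carrier P" and x: "x \<in> K"
    have xP: "x \<in> carrier P" using x by (simp add: in_K)
    have "v \<otimes>\<^bsub>P\<^esub> (b \<otimes>\<^bsub>P\<^esub> x) \<in> As i \<and> \<lbrakk>v, b \<otimes>\<^bsub>P\<^esub> x\<rbrakk>\<^bsub>P\<^esub> \<in> As i \<and> v \<otimes>\<^bsub>P\<^esub> \<lbrakk>b,x\<rbrakk>\<^bsub>P\<^esub> \<in> As i \<and> \<lbrakk>v, \<lbrakk>b,x\<rbrakk>\<^bsub>P\<^esub>\<rbrakk>\<^bsub>P\<^esub> \<in> As i"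
      if i: "i < n" and v: "v \<in> As (Suc i)" for i v
    proof (intro conjI)
      have le: "Suc i \<le> n" "i \<le> n" using i by auto
      note A = A_sub[OF le(2)]
      have vP: "v \<in> carrier P" using v AP[OF le(1)] by blast
      note cl = vP b xP mult_closed bracket_closed
      have vx: "a \<otimes>\<^bsub>P\<^esub> x \<in> As i" "\<lbrakk>a,x\<rbrakk>\<^bsub>P\<^esub> \<in> As i" if "a \<in> As (Suc i)" for a
        using x i that by (auto simp: in_K)
      have bA: "b \<otimes>\<^bsub>P\<^esub> a \<in> As i" "\<lbrakk>b,a\<rbrakk>\<^bsub>P\<^esub> \<in> As i" if "a \<in> As i" for a
        using prods_inD[OF A_inv[OF le(2)] b that] by auto
      have bv: "b \<otimes>\<^bsub>P\<^esub> v \<in> As (Suc i)" "\<lbrakk>b,v\<rbrakk>\<^bsub>P\<^esub> \<in> As (Suc i)"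
        using prods_inD[OF A_inv[OF le(1)] b v] by auto
      then have vb: "v \<otimes>\<^bsub>P\<^esub> b \<in> As (Suc i)" "\<lbrakk>v,b\<rbrakk>\<^bsub>P\<^esub> \<in> As (Suc i)"
        using mult_comm[OF vP b] bracket_swap_in[OF A_sub[OF le(1)] b vP] by auto
      show "v \<otimes>\<^bsub>P\<^esub> (b \<otimes>\<^bsub>P\<^esub> x) \<in> As i" using vx(1)[OF vb(1)] mult_assoc[OF vP b xP] by simp
      show "\<lbrakk>v, b \<otimes>\<^bsub>P\<^esub> x\<rbrakk>\<^bsub>P\<^esub> \<in> As i"
        unfolding bracket_mult_deriv[OF vP b xP]
        by (rule subspaceD(3)[OF A vx(1)[OF vb(2)] bA(1)[OF vx(2)[OF v]]])
      have "\<lbrakk>b,v\<rbrakk>\<^bsub>P\<^esub> \<otimes>\<^bsub>P\<^esub> x \<oplus>\<^bsub>P\<^esub> v \<otimes>\<^bsub>P\<^esub> \<lbrakk>b,x\<rbrakk>\<^bsub>P\<^esub> \<in> As i"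
        using bA(2)[OF vx(1)[OF v]] unfolding bracket_mult_deriv[OF b vP xP] .
      then show "v \<otimes>\<^bsub>P\<^esub> \<lbrakk>b,x\<rbrakk>\<^bsub>P\<^esub> \<in> As i"
        using subspace_cancel_left[OF A _ vx(1)[OF bv(2)]] cl by blast
      show "\<lbrakk>v, \<lbrakk>b,x\<rbrakk>\<^bsub>P\<^esub>\<rbrakk>\<^bsub>P\<^esub> \<in> As i"
        unfolding bracket_bracket_deriv[OF vP b xP]
        by (rule subspaceD(3)[OF A vx(2)[OF vb(2)] bA(2)[OF vx(2)[OF v]]])
    qed
    then show "b \<otimes>\<^bsub>P\<^esub> x \<in> K \<and> \<lbrakk>b,x\<rbrakk>\<^bsub>P\<^esub> \<in> K"
      using b xP by (simp add: in_K mult_closed bracket_closed)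
  qed
  then have "poisson_ideal F P K" using subK by (simp add: ideal_iff)
  moreover have "\<lbrakk>x,y\<rbrakk>\<^bsub>P\<^esub> \<in> K" if x: "x \<in> carrier P" and y: "y \<in> carrier P" for x y
  proof -
    have "v \<otimes>\<^bsub>P\<^esub> \<lbrakk>x,y\<rbrakk>\<^bsub>P\<^esub> \<in> As i \<and> \<lbrakk>v, \<lbrakk>x,y\<rbrakk>\<^bsub>P\<^esub>\<rbrakk>\<^bsub>P\<^esub> \<in> As i" if i: "i < n" and v: "v \<in> As (Suc i)" for i v
    proof -
      have le: "Suc i \<le> n" "i \<le> n" using i by auto
      note A = A_sub[OF le(2)]
      have vP: "v \<in> carrier P" using v AP[OF le(1)] by blast
      note cl = vP x y mult_closed bracket_closed
      have commutator: "w \<in> As i"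
        if S: "S \<in> multiplications" and T: "T \<in> multiplications"
          and w: "w \<in> carrier P" "S (T v) = w \<oplus>\<^bsub>P\<^esub> T (S v)" for S T w
      proof -
        obtain a s where s: "a \<in> carrier F" "s \<in> As i" "S v = a \<odot>\<^bsub>P\<^esub> v \<oplus>\<^bsub>P\<^esub> s"
          using scalar[OF i S] v by blast
        obtain b t where t: "b \<in> carrier F" "t \<in> As i" "T v = b \<odot>\<^bsub>P\<^esub> v \<oplus>\<^bsub>P\<^esub> t"
          using scalar[OF i T] v by blast
        show ?thesis
          using scalar_actions_commute[OF multiplications_hom[OF S] multiplications_hom[OF T] A _ _ vP
              s(1) t(1) s(2) t(2) s(3) t(3) w] A_inv[OF le(2)] S T
          by (auto simp: prods_in_carrier_iff)
      qed
      have ops: "(\<lambda>v. \<lbrakk>x,v\<rbrakk>\<^bsub>P\<^esub>) \<in> multiplications" "(\<lambda>v. \<lbrakk>y,v\<rbrakk>\<^bsub>P\<^esub>) \<in> multiplications"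
        "(\<lambda>v. y \<otimes>\<^bsub>P\<^esub> v) \<in> multiplications"
        using x y by (auto simp: multiplications_def)
      have "\<lbrakk>x,y\<rbrakk>\<^bsub>P\<^esub> \<otimes>\<^bsub>P\<^esub> v \<in> As i"
        by (rule commutator[OF ops(1,3) _ bracket_mult_deriv[OF x y vP]]) (intro cl)
      moreover have "\<lbrakk>\<lbrakk>x,y\<rbrakk>\<^bsub>P\<^esub>, v\<rbrakk>\<^bsub>P\<^esub> \<in> As i"
        by (rule commutator[OF ops(1,2) _ bracket_bracket_deriv[OF x y vP]]) (intro cl)
      ultimately show ?thesis
        using mult_comm[OF vP bracket_closed[OF x y]]
          bracket_swap_in[OF A bracket_closed[OF x y] vP] by simp
    qed
    then show ?thesis using bracket_closed[OF x y] by (simp add: in_K)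
  qed
  moreover have "spectrum_in {\<zero>\<^bsub>F\<^esub>} x {\<zero>\<^bsub>P\<^esub>}" if x: "x \<in> K" for x
  proof -
    have xP: "x \<in> carrier P" using x by (simp add: in_K)
    have "v \<in> roots T {\<zero>\<^bsub>F\<^esub>} {\<zero>\<^bsub>P\<^esub>}"
      if T: "\<And>i v. i < n \<Longrightarrow> v \<in> As (Suc i) \<Longrightarrow> T v \<in> As i" and "i \<le> n" "v \<in> As i" for T i v
      using that(2,3)
    proof (induction i arbitrary: v)
      case 0
      then show ?case using A0 by (blast intro: root_space.base)
    next
      case (Suc i)
      have v: "v \<in> carrier P" using Suc.prems AP by blast
      have TvA: "T v \<in> As i" using T Suc.prems by simp
      then have "T v \<in> carrier P" using AP[of i] Suc.prems by auto
      moreover have "T v \<in> roots T {\<zero>\<^bsub>F\<^esub>} {\<zero>\<^bsub>P\<^esub>}" using Suc TvA by simp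
      ultimately show ?case
        using root_space.step[OF v, of "\<zero>\<^bsub>F\<^esub>" "{\<zero>\<^bsub>F\<^esub>}" "T v" T "{\<zero>\<^bsub>P\<^esub>}"] v by simp
    qed
    from this[of "\<lambda>v. x \<otimes>\<^bsub>P\<^esub> v" n] this[of "\<lambda>v. \<lbrakk>x,v\<rbrakk>\<^bsub>P\<^esub>" n]
    have "spectrum_in {\<zero>\<^bsub>F\<^esub>} x {\<zero>\<^bsub>P\<^esub>}" if "\<And>i v. i < n \<Longrightarrow> v \<in> As (Suc i) \<Longrightarrow> x \<otimes>\<^bsub>P\<^esub> v \<in> As i \<and> \<lbrakk>x,v\<rbrakk>\<^bsub>P\<^esub> \<in> As i"
      using that An unfolding spectrum_in_def by blast
    moreover have "x \<otimes>\<^bsub>P\<^esub> v \<in> As i \<and> \<lbrakk>x,v\<rbrakk>\<^bsub>P\<^esub> \<in> As i" if i: "i < n" and v: "v \<in> As (Suc i)" for i v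
    proof -
      have vP: "v \<in> carrier P" using v i AP[of "Suc i"] by auto
      show ?thesis
        using x i v mult_comm[OF xP vP] bracket_swap_in[OF A_sub vP xP, of i] by (auto simp: in_K)
    qed
    ultimately show ?thesis by blast
  qed
  moreover have "\<forall>x\<in>carrier P. spectrum_in (carrier F) x {\<zero>\<^bsub>P\<^esub>}"
    unfolding spectrum_in_multiplications
  proof
    fix T assume T: "T \<in> multiplications"
    have "v \<in> roots T (carrier F) {\<zero>\<^bsub>P\<^esub>}" if "i \<le> n" "v \<in> As i" for i v
      using that
    proof (induction i arbitrary: v)
      case 0
      then show ?case using A0 by (blast intro: root_space.base)
    next
      case (Suc i)
      obtain l u where "l \<in> carrier F" "u \<in> As i" "T v = l \<odot>\<^bsub>P\<^esub> v \<oplus>\<^bsub>P\<^esub> u"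
        using scalar[OF _ T, of i] Suc.prems by auto
      moreover have "v \<in> carrier P" using Suc.prems AP by blast
      ultimately show ?case using Suc root_space.step[of v P l "carrier F" u T] by simp
    qed
    then show "carrier P \<subseteq> roots T (carrier F) {\<zero>\<^bsub>P\<^esub>}" using An by blast
  qed
  ultimately show "(\<exists>K. supersolvability_ideal K) \<and> (\<forall>x\<in>carrier P. spectrum_in (carrier F) x {\<zero>\<^bsub>P\<^esub>})"
    unfolding supersolvability_ideal_def by blast
next
  assume "(\<exists>K. supersolvability_ideal K) \<and> (\<forall>x\<in>carrier P. spectrum_in (carrier F) x {\<zero>\<^bsub>P\<^esub>})"
  then obtain K where K: "supersolvability_ideal K"
    and spec: "\<And>x. x \<in> carrier P \<Longrightarrow> spectrum_in (carrier F) x {\<zero>\<^bsub>P\<^esub>}" by blast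
  define Q where "Q U \<longleftrightarrow> (\<exists>n As. ideal_flag n As \<and> As n = U)" for U
  have Q_ideal: "poisson_ideal F P U" if "Q U" for U
    using that by (auto simp: Q_def ideal_flag_def)
  have "ideal_flag 0 (\<lambda>_. {\<zero>\<^bsub>P\<^esub>})"
    using ideal_zero dim_zero_subspace by (simp add: ideal_flag_def)
  then have "Q {\<zero>\<^bsub>P\<^esub>}" by (auto simp: Q_def)
  then obtain U where "Q U" and U_max: "\<forall>W. Q W \<longrightarrow> U \<subseteq> W \<longrightarrow> W = U"
    using exists_maximal_subspace[OF fin, of Q "{\<zero>\<^bsub>P\<^esub>}"] Q_ideal by (auto simp: ideal_iff)
  obtain n As where As: "ideal_flag n As" "As n = U" using \<open>Q U\<close> by (auto simp: Q_def)
  have U: "sub U" "prods_in (carrier P) U U" using Q_ideal[OF \<open>Q U\<close>] by (auto simp: ideal_iff)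
  note UP = subspaceD(1)[OF U(1)]
  have "U = carrier P"
  proof (rule ccontr)
    assume "U \<noteq> carrier P"
    then obtain v where v: "v \<in> carrier P" "v \<notin> U" "prods_in (carrier P) {v} (adjoin U v)"
      using common_eigenvector[OF fin K spec Q_ideal[OF \<open>Q U\<close>]] by blast
    note Uv = adjoin_subspace[OF U(1) v(1)] and U_Uv = adjoin_contains[OF U(1) v(1)]
    have "prods_in (carrier P) (adjoin U v) (adjoin U v)"
      using prods_in_adjoin[OF order_refl Uv UP v(1) prods_in_mono[OF U(2) order_refl order_refl U_Uv(1)] v(3)] .
    then have ideal: "poisson_ideal F P (adjoin U v)" using Uv by (simp add: ideal_iff)
    have dim_U: "vectorspace.dim F (P\<lparr>carrier := U\<rparr>) = n" using As by (auto simp: ideal_flag_def)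
    have "ideal_flag (Suc n) (As(Suc n := adjoin U v))"
      unfolding ideal_flag_def
    proof (intro conjI allI impI)
      show "(As(Suc n := adjoin U v)) 0 = {\<zero>\<^bsub>P\<^esub>}" using As by (simp add: ideal_flag_def)
    next
      fix i assume "i < Suc n"
      then show "(As(Suc n := adjoin U v)) i \<subset> (As(Suc n := adjoin U v)) (Suc i)"
        using As U_Uv v(2) by (cases "i = n") (auto simp: ideal_flag_def)
    next
      fix i assume "i \<le> Suc n"
      then show "poisson_ideal F P ((As(Suc n := adjoin U v)) i)"
        and "vectorspace.fin_dim F (P\<lparr>carrier := (As(Suc n := adjoin U v)) i\<rparr>)"
        and "vectorspace.dim F (P\<lparr>carrier := (As(Suc n := adjoin U v)) i\<rparr>) = i"
        using As ideal dim_adjoin[OF fin U(1) v(1,2)] dim_U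
        by (cases "i = Suc n"; simp add: ideal_flag_def)+
    qed
    then have "Q (adjoin U v)" unfolding Q_def by (intro exI[of _ "Suc n"] exI[of _ "As(Suc n := adjoin U v)"]) simp
    then show False using U_max U_Uv v(2) by blast
  qed
  then show "poisson_supersolvable F P"
    using As by (auto simp: poisson_supersolvable_flag)
qed

end

section \<open>Subalgebras and quotients\<close>

lemma root_space_carrier_update:
  "v \<in> root_space (V\<lparr>carrier := W\<rparr>) T L U \<Longrightarrow> W \<subseteq> carrier V \<Longrightarrow> v \<in> root_space V T L U"
  by (induction rule: root_space.induct) (auto intro: root_space.base root_space.step)

lemma (in vectorspace) root_space_restrict:
  assumes v: "v \<in> root_space V T L U" "v \<in> W" and W: "VectorSpace.subspace K W V"
    and U: "U \<subseteq> carrier V" and L: "L \<subseteq> carrier K" and inv: "\<And>w. w \<in> W \<Longrightarrow> T w \<in> W"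
  shows "v \<in> root_space (V\<lparr>carrier := W\<rparr>) T L U"
  using v
proof induction
  case (base v)
  then show ?case by (blast intro: root_space.base)
next
  case (step v l w)
  have "l \<odot>\<^bsub>V\<^esub> v \<oplus>\<^bsub>V\<^esub> w \<in> W" using inv[OF step.prems] step.hyps(4) by simp
  moreover have "l \<odot>\<^bsub>V\<^esub> v \<in> W" using subspaceD(4)[OF W] step L by blast
  ultimately have "w \<in> W"
    using subspace_cancel_left[OF W] root_space_in_carrier[OF step.hyps(3) U] by blast
  then have "w \<in> root_space (V\<lparr>carrier := W\<rparr>) T L U" by (rule step.IH)
  then show ?case
    using root_space.step[of v "V\<lparr>carrier := W\<rparr>" l L w T U] step.hyps(2,4) step.prems by simp
qed

context poisson_algebra
begin

lemma subalgebra_is_poisson_algebra: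
  assumes B: "poisson_subalgebra F P B"
  shows "poisson_algebra F (P\<lparr>carrier := B\<rparr>)"
proof (rule poisson_algebra.intro)
  have sB: "sub B" using B by (simp add: subalgebra_iff)
  show "vectorspace F (P\<lparr>carrier := B\<rparr>)" using subspace_is_vs[OF sB] .
  have c: "x \<in> carrier P" if "x \<in> B" for x using subspaceD(5)[OF sB that] .
  show "poisson_algebra_axioms F (P\<lparr>carrier := B\<rparr>)"
    using B by unfold_locales
      (auto simp: poisson_subalgebra_def c mult_add_left mult_smult_left mult_assoc
        bracket_add_left bracket_add_right bracket_smult_left bracket_smult_right
        bracket_alternating jacobi leibniz intro: mult_comm)
qed

text \<open>The operators on \<open>P\<close> are restricted to the algebra \<open>B\<close>, where the characterizations of
  nilpotency and supersolvability will be applied.\<close>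

lemma spectrum_in_subideal_lift:
  assumes fin: fin_dim and B: "poisson_subideal F P B"
    and A: "poisson_algebra F (P\<lparr>carrier := B\<rparr>)"
    and C: "poisson_ideal F (P\<lparr>carrier := B\<rparr>) C" "C \<subseteq> frattini_ideal F P"
    and x: "x \<in> B"
    and L: "L \<subseteq> carrier F" "\<zero>\<^bsub>F\<^esub> \<in> L" "\<And>l m. l \<in> L \<Longrightarrow> m \<in> L \<Longrightarrow> l \<oplus>\<^bsub>F\<^esub> m \<in> L"
    and spec: "poisson_algebra.spectrum_in (P\<lparr>carrier := B\<rparr>) L x C"
  shows "poisson_algebra.spectrum_in (P\<lparr>carrier := B\<rparr>) L x {\<zero>\<^bsub>P\<^esub>}"
proof -
  interpret A: poisson_algebra F "P\<lparr>carrier := B\<rparr>" by (rule A)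
  have sB: "sub B" and BB: "prods_in B B B"
    using B unfolding poisson_subideal_def subalgebra_iff by blast+
  note BP = subspaceD(1)[OF sB]
  have xP: "x \<in> carrier P" using x BP by blast
  have "A.sub C" "A.prods_in B C C" using C(1) A.ideal_iff by simp_all
  then have sC: "sub C" and BC: "prods_in B C C"
    using BP by (auto simp: A.subspace_iff subspace_iff A.prods_in_def prods_in_def)
  have "B \<subseteq> roots (\<lambda>v. x \<otimes>\<^bsub>P\<^esub> v) L C" "B \<subseteq> roots (\<lambda>v. \<lbrakk>x,v\<rbrakk>\<^bsub>P\<^esub>) L C"
    using spec root_space_carrier_update[OF _ BP] by (auto simp: A.spectrum_in_def)
  then have *: "spectrum_in L x {\<zero>\<^bsub>P\<^esub>}"
    using spectrum_in_frattini_lift[OF fin B sC BC C(2) x xP L] by blast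
  show ?thesis
    unfolding A.spectrum_in_def
  proof (intro conjI subsetI)
    fix v assume v: "v \<in> carrier (P\<lparr>carrier := B\<rparr>)"
    then have vB: "v \<in> B" by simp
    then have vP: "v \<in> carrier P" using BP by blast
    show "v \<in> root_space (P\<lparr>carrier := B\<rparr>) (\<lambda>v. x \<otimes>\<^bsub>P\<lparr>carrier := B\<rparr>\<^esub> v) L {\<zero>\<^bsub>P\<^esub>}"
      using root_space_restrict[OF _ vB sB _ L(1), of "\<lambda>v. x \<otimes>\<^bsub>P\<^esub> v" "{\<zero>\<^bsub>P\<^esub>}"] * vP prods_inD(1)[OF BB x]
      by (auto simp: spectrum_in_def)
    show "v \<in> root_space (P\<lparr>carrier := B\<rparr>) (\<lambda>v. \<lbrakk>x,v\<rbrakk>\<^bsub>P\<lparr>carrier := B\<rparr>\<^esub>) L {\<zero>\<^bsub>P\<^esub>}"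
      using root_space_restrict[OF _ vB sB _ L(1), of "\<lambda>v. \<lbrakk>x,v\<rbrakk>\<^bsub>P\<^esub>" "{\<zero>\<^bsub>P\<^esub>}"] * vP prods_inD(2)[OF BB x]
      by (auto simp: spectrum_in_def)
  qed
qed

end

locale poisson_ideal_quotient = poisson_algebra +
  fixes C :: "'c set"
  assumes C_ideal: "poisson_ideal F P C"
begin

abbreviation coset :: "'c \<Rightarrow> 'c set" where
  "coset x \<equiv> C +>\<^bsub>P\<^esub> x"

abbreviation quotient :: "('a, 'c set) poisson" where
  "quotient \<equiv> poisson_quotient P C"

lemma C_sub: "sub C" and C_prods: "prods_in (carrier P) C C"
  using C_ideal by (auto simp: ideal_iff)

lemma C_abelian_subgroup: "abelian_subgroup C P"
proof (rule abelian_subgroupI3)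
  have "Module.submodule C F P"
    by (rule Module.module.submoduleI[OF module_axioms])
      (use subspaceD[OF C_sub] subspace_uminus[OF C_sub] in auto)
  then show "additive_subgroup C P"
    by (intro additive_subgroupI) (rule Module.submodule.axioms(1))
qed (rule M.abelian_group_axioms)

sublocale C: abelian_subgroup C P
  by (rule C_abelian_subgroup)

lemma coset_add_ideal: "c \<in> C \<Longrightarrow> x \<in> carrier P \<Longrightarrow> coset (c \<oplus>\<^bsub>P\<^esub> x) = coset x"
  by (rule C.a_repr_independence'[symmetric]) (auto simp: a_r_coset_def')

lemma coset_memE:
  assumes "y \<in> coset x"
  obtains c where "c \<in> C" "y = c \<oplus>\<^bsub>P\<^esub> x"
  using assms by (auto simp: a_r_coset_def')

lemma coset_eq_iff:
  assumes "x \<in> carrier P" "y \<in> carrier P"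
  shows "coset x = coset y \<longleftrightarrow> (\<exists>c\<in>C. x = c \<oplus>\<^bsub>P\<^esub> y)"
proof
  assume "coset x = coset y"
  then have "x \<in> coset y" using C.a_rcos_self[OF assms(1)] by simp
  then show "\<exists>c\<in>C. x = c \<oplus>\<^bsub>P\<^esub> y" by (auto elim: coset_memE)
qed (use coset_add_ideal assms in auto)

lemma carrier_quotient: "carrier quotient = coset ` carrier P"
  by (auto simp: poisson_quotient_def A_RCOSETS_def')

lemma zero_quotient: "\<zero>\<^bsub>quotient\<^esub> = C" "coset \<zero>\<^bsub>P\<^esub> = C"
  using subspaceD(1)[OF C_sub] by (simp_all add: poisson_quotient_def)

lemma coset_eq_C_iff:
  assumes "x \<in> carrier P"
  shows "coset x = C \<longleftrightarrow> x \<in> C"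
proof -
  have "coset x = C \<longleftrightarrow> (\<exists>c\<in>C. x = c \<oplus>\<^bsub>P\<^esub> \<zero>\<^bsub>P\<^esub>)"
    using coset_eq_iff[OF assms M.zero_closed] zero_quotient by simp
  then show ?thesis using subspaceD(5)[OF C_sub] by auto
qed

lemma add_quotient:
  assumes "x \<in> carrier P" "y \<in> carrier P"
  shows "coset x \<oplus>\<^bsub>quotient\<^esub> coset y = coset (x \<oplus>\<^bsub>P\<^esub> y)"
  using C.a_rcos_sum[OF assms] by (simp add: poisson_quotient_def)

lemma smult_quotient:
  assumes a: "a \<in> carrier F" and x: "x \<in> carrier P"
  shows "a \<odot>\<^bsub>quotient\<^esub> coset x = coset (a \<odot>\<^bsub>P\<^esub> x)"
proof -
  have "coset (a \<odot>\<^bsub>P\<^esub> y) = coset (a \<odot>\<^bsub>P\<^esub> x)" if y: "y \<in> coset x" for y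
  proof -
    obtain c where c: "c \<in> C" "y = c \<oplus>\<^bsub>P\<^esub> x" using y by (rule coset_memE)
    then have "a \<odot>\<^bsub>P\<^esub> y = a \<odot>\<^bsub>P\<^esub> c \<oplus>\<^bsub>P\<^esub> a \<odot>\<^bsub>P\<^esub> x" using a x subspaceD(5)[OF C_sub] by (simp add: smult_r_distr)
    then show ?thesis using coset_add_ideal[OF subspaceD(4)[OF C_sub a c(1)]] a x by simp
  qed
  then have "(\<Union>y\<in>coset x. coset (a \<odot>\<^bsub>P\<^esub> y)) = (\<Union>y\<in>coset x. coset (a \<odot>\<^bsub>P\<^esub> x))" by (intro SUP_cong) auto
  also have "\<dots> = coset (a \<odot>\<^bsub>P\<^esub> x)" by (rule UN_constant_eq[OF C.a_rcos_self[OF x]]) simp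
  finally show ?thesis by (simp add: poisson_quotient_def)
qed

text \<open>Both products of cosets are defined as unions over all representatives; the ideal property
  makes the sets in this union equal.\<close>

lemma product_coset:
  assumes left: "\<And>y. y \<in> carrier P \<Longrightarrow> (\<lambda>x. f x y) \<in> module_hom F P P"
    and right: "\<And>x. x \<in> carrier P \<Longrightarrow> f x \<in> module_hom F P P"
    and CC: "\<And>x c. x \<in> carrier P \<Longrightarrow> c \<in> C \<Longrightarrow> f x c \<in> C" "\<And>x c. x \<in> carrier P \<Longrightarrow> c \<in> C \<Longrightarrow> f c x \<in> C"
    and xy: "x \<in> carrier P" "y \<in> carrier P"
  shows "(\<Union>x'\<in>coset x. \<Union>y'\<in>coset y. coset (f x' y')) = coset (f x y)"
proof -
  have "coset (f x' y') = coset (f x y)" if x': "x' \<in> coset x" and y': "y' \<in> coset y" for x' y'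
  proof -
    obtain c where c: "c \<in> C" "x' = c \<oplus>\<^bsub>P\<^esub> x" using x' by (rule coset_memE)
    obtain d where d: "d \<in> C" "y' = d \<oplus>\<^bsub>P\<^esub> y" using y' by (rule coset_memE)
    have cl: "c \<in> carrier P" "d \<in> carrier P" "x' \<in> carrier P" "y' \<in> carrier P"
      using c d xy subspaceD(5)[OF C_sub] by auto
    have fxy: "f x y \<in> carrier P" "f x d \<in> C" "f c y' \<in> C"
      using module_hom_closed[OF right[OF xy(1)]] xy CC c d cl by auto
    have "f x' y' = f c y' \<oplus>\<^bsub>P\<^esub> f x y'" using module_hom_add[OF left[OF cl(4)] cl(1) xy(1)] c by simp
    also have "f x y' = f x d \<oplus>\<^bsub>P\<^esub> f x y" using module_hom_add[OF right[OF xy(1)] cl(2) xy(2)] d by simp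
    also have "f c y' \<oplus>\<^bsub>P\<^esub> (f x d \<oplus>\<^bsub>P\<^esub> f x y) = (f c y' \<oplus>\<^bsub>P\<^esub> f x d) \<oplus>\<^bsub>P\<^esub> f x y"
      using fxy subspaceD(5)[OF C_sub] by (simp add: M.a_assoc)
    finally show ?thesis
      using coset_add_ideal[OF subspaceD(3)[OF C_sub fxy(3,2)] fxy(1)] by simp
  qed
  then have "(\<Union>x'\<in>coset x. \<Union>y'\<in>coset y. coset (f x' y'))
      = (\<Union>x'\<in>coset x. \<Union>y'\<in>coset y. coset (f x y))"
    by (intro SUP_cong) auto
  also have "\<dots> = coset (f x y)"
    using C.a_rcos_self[OF xy(1)] C.a_rcos_self[OF xy(2)] by blast
  finally show ?thesis .
qed

lemma mult_quotient:
  assumes "x \<in> carrier P" "y \<in> carrier P"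
  shows "coset x \<otimes>\<^bsub>quotient\<^esub> coset y = coset (x \<otimes>\<^bsub>P\<^esub> y)"
proof -
  have "coset x \<otimes>\<^bsub>quotient\<^esub> coset y = (\<Union>x'\<in>coset x. \<Union>y'\<in>coset y. coset (x' \<otimes>\<^bsub>P\<^esub> y'))"
    by (simp add: poisson_quotient_def rcoset_mult_def)
  also have "\<dots> = coset (x \<otimes>\<^bsub>P\<^esub> y)"
  proof (rule product_coset[where f = "\<lambda>x y. x \<otimes>\<^bsub>P\<^esub> y"])
    show "x \<otimes>\<^bsub>P\<^esub> c \<in> C" if "x \<in> carrier P" "c \<in> C" for x c
      using prods_inD(1)[OF C_prods that] .
    show "c \<otimes>\<^bsub>P\<^esub> x \<in> C" if "x \<in> carrier P" "c \<in> C" for x c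
      using prods_inD(1)[OF prods_in_swap[OF C_sub order_refl subspaceD(1)[OF C_sub] C_prods] that(2,1)] .
  qed (use assms mult_left_hom mult_right_hom in auto)
  finally show ?thesis .
qed

lemma bracket_quotient:
  assumes "x \<in> carrier P" "y \<in> carrier P"
  shows "\<lbrakk>coset x, coset y\<rbrakk>\<^bsub>quotient\<^esub> = coset \<lbrakk>x,y\<rbrakk>\<^bsub>P\<^esub>"
proof -
  have "\<lbrakk>coset x, coset y\<rbrakk>\<^bsub>quotient\<^esub> = (\<Union>x'\<in>coset x. \<Union>y'\<in>coset y. coset \<lbrakk>x',y'\<rbrakk>\<^bsub>P\<^esub>)"
    by (simp add: poisson_quotient_def)
  also have "\<dots> = coset \<lbrakk>x,y\<rbrakk>\<^bsub>P\<^esub>"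
  proof (rule product_coset[where f = "\<lambda>x y. \<lbrakk>x,y\<rbrakk>\<^bsub>P\<^esub>"])
    show "\<lbrakk>x,c\<rbrakk>\<^bsub>P\<^esub> \<in> C" if "x \<in> carrier P" "c \<in> C" for x c
      using prods_inD(2)[OF C_prods that] .
    show "\<lbrakk>c,x\<rbrakk>\<^bsub>P\<^esub> \<in> C" if "x \<in> carrier P" "c \<in> C" for x c
      using prods_inD(2)[OF prods_in_swap[OF C_sub order_refl subspaceD(1)[OF C_sub] C_prods] that(2,1)] .
  qed (use assms bracket_left_hom bracket_right_hom in auto)
  finally show ?thesis .
qed

lemmas quotient_simps = add_quotient smult_quotient mult_quotient bracket_quotient

lemma quotient_vectorspace: "vectorspace F quotient"
proof (rule vs_criteria)
  show "field F" by (rule field_axioms)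
  show "\<zero>\<^bsub>quotient\<^esub> \<in> carrier quotient"
    unfolding zero_quotient(1) carrier_quotient using zero_quotient(2) by (metis M.zero_closed imageI)
  show "\<forall>v\<in>carrier quotient. \<exists>w\<in>carrier quotient. v \<oplus>\<^bsub>quotient\<^esub> w = \<zero>\<^bsub>quotient\<^esub>"
  proof
    fix v assume "v \<in> carrier quotient"
    then obtain x where x: "x \<in> carrier P" "v = coset x" by (auto simp: carrier_quotient)
    then have "v \<oplus>\<^bsub>quotient\<^esub> coset (\<ominus>\<^bsub>P\<^esub> x) = \<zero>\<^bsub>quotient\<^esub>"
      using add_quotient[of x "\<ominus>\<^bsub>P\<^esub> x"] zero_quotient by (simp add: M.r_neg)
    then show "\<exists>w\<in>carrier quotient. v \<oplus>\<^bsub>quotient\<^esub> w = \<zero>\<^bsub>quotient\<^esub>"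
      using x by (auto simp: carrier_quotient)
  qed
  show "\<forall>v\<in>carrier quotient. v \<oplus>\<^bsub>quotient\<^esub> \<zero>\<^bsub>quotient\<^esub> = v"
  proof
    fix v assume "v \<in> carrier quotient"
    then obtain x where x: "x \<in> carrier P" "v = coset x" by (auto simp: carrier_quotient)
    then show "v \<oplus>\<^bsub>quotient\<^esub> \<zero>\<^bsub>quotient\<^esub> = v"
      using add_quotient[OF x(1) M.zero_closed] zero_quotient by simp
  qed
qed (auto simp: carrier_quotient quotient_simps M.a_ac smult_assoc1 smult_l_distr
    smult_r_distr)

lemma quotient_poisson_algebra: "poisson_algebra F quotient"
proof (rule poisson_algebra.intro)
  show "vectorspace F quotient" by (rule quotient_vectorspace)
  show "poisson_algebra_axioms F quotient"
  proof
    fix x y z assume xyz: "x \<in> carrier quotient" "y \<in> carrier quotient" "z \<in> carrier quotient"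
    then obtain x' y' z' where "x' \<in> carrier P" "x = coset x'" "y' \<in> carrier P" "y = coset y'"
      "z' \<in> carrier P" "z = coset z'" by (auto simp: carrier_quotient)
    then show "\<lbrakk>x, \<lbrakk>y,z\<rbrakk>\<^bsub>quotient\<^esub>\<rbrakk>\<^bsub>quotient\<^esub> \<oplus>\<^bsub>quotient\<^esub> \<lbrakk>y, \<lbrakk>z,x\<rbrakk>\<^bsub>quotient\<^esub>\<rbrakk>\<^bsub>quotient\<^esub>
        \<oplus>\<^bsub>quotient\<^esub> \<lbrakk>z, \<lbrakk>x,y\<rbrakk>\<^bsub>quotient\<^esub>\<rbrakk>\<^bsub>quotient\<^esub> = \<zero>\<^bsub>quotient\<^esub>"
      using zero_quotient by (simp add: quotient_simps bracket_closed jacobi)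
  next
    fix x assume "x \<in> carrier quotient"
    then show "\<lbrakk>x,x\<rbrakk>\<^bsub>quotient\<^esub> = \<zero>\<^bsub>quotient\<^esub>"
      using zero_quotient by (auto simp: carrier_quotient quotient_simps bracket_alternating)
  next
    fix x y assume "x \<in> carrier quotient" "y \<in> carrier quotient"
    then show "x \<otimes>\<^bsub>quotient\<^esub> y = y \<otimes>\<^bsub>quotient\<^esub> x"
      using mult_comm by (auto simp: carrier_quotient mult_quotient)
  qed (auto simp: carrier_quotient quotient_simps mult_closed bracket_closed mult_add_left
      mult_smult_left mult_assoc bracket_add_left bracket_add_right bracket_smult_left
      bracket_smult_right leibniz)
qed

sublocale Q: poisson_algebra F quotient
  by (rule quotient_poisson_algebra)

lemma coset_hom: "coset \<in> module_hom F P quotient"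
  by (auto simp: module_hom_def carrier_quotient quotient_simps)

lemma quotient_fin_dim: "fin_dim \<Longrightarrow> Q.fin_dim"
proof -
  interpret linear_map F P quotient coset
    using coset_hom by unfold_locales
  show "fin_dim \<Longrightarrow> Q.fin_dim"
    using image_fin_dim carrier_quotient by simp
qed

text \<open>Lift the chain of factors from the quotient: each equation \<open>T v = l v + w\<close> between cosets
  holds in \<open>P\<close> after adding an element of \<open>C\<close> to the representative of \<open>w\<close>.\<close>

lemma root_space_pullback:
  assumes T: "T \<in> module_hom F P P" and L: "L \<subseteq> carrier F"
    and T': "\<And>v. v \<in> carrier P \<Longrightarrow> T' (coset v) = coset (T v)"
    and v: "coset v \<in> root_space quotient T' L {C}" "v \<in> carrier P"
  shows "v \<in> roots T L C"
  using v
proof (induction "coset v" arbitrary: v)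
  case base
  then show ?case using coset_eq_C_iff by (blast intro: root_space.base)
next
  case (step l w v)
  have l: "l \<in> carrier F" using step L by blast
  have Tv: "T v \<in> carrier P" using module_hom_closed[OF T] step.prems by blast
  have "w \<in> carrier quotient"
    using Q.root_space_in_carrier[OF step(3)] zero_quotient Q.M.zero_closed by simp
  then obtain y where y: "y \<in> carrier P" "w = coset y" by (auto simp: carrier_quotient)
  have "coset (T v) = coset (l \<odot>\<^bsub>P\<^esub> v \<oplus>\<^bsub>P\<^esub> y)"
    using step y T' l by (simp add: quotient_simps)
  then obtain c where c: "c \<in> C" "T v = c \<oplus>\<^bsub>P\<^esub> (l \<odot>\<^bsub>P\<^esub> v \<oplus>\<^bsub>P\<^esub> y)"
    using coset_eq_iff[OF Tv] y l step.prems by auto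
  have cP: "c \<in> carrier P" using subspaceD(5)[OF C_sub c(1)] .
  have eq: "T v = l \<odot>\<^bsub>P\<^esub> v \<oplus>\<^bsub>P\<^esub> (c \<oplus>\<^bsub>P\<^esub> y)"
    using c cP y l step.prems by (simp add: M.a_lcomm)
  have "w = coset (c \<oplus>\<^bsub>P\<^esub> y)" using coset_add_ideal[OF c(1) y(1)] y(2) by simp
  then have "c \<oplus>\<^bsub>P\<^esub> y \<in> roots T L C" using step.hyps(4) cP y(1) by simp
  then show ?case
    by (rule root_space.step[where T = T, OF step.prems step.hyps(2) _ eq])
qed

lemma spectrum_in_pullback:
  assumes "L \<subseteq> carrier F" "x \<in> carrier P" "Q.spectrum_in L (coset x) {\<zero>\<^bsub>quotient\<^esub>}"
  shows "spectrum_in L x C"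
  unfolding spectrum_in_def
proof (intro conjI subsetI)
  fix v assume v: "v \<in> carrier P"
  then have cv: "coset v \<in> carrier quotient" by (auto simp: carrier_quotient)
  show "v \<in> roots (\<lambda>v. x \<otimes>\<^bsub>P\<^esub> v) L C"
    using root_space_pullback[OF mult_right_hom[OF assms(2)] assms(1) mult_quotient[OF assms(2)] _ v]
      assms(3) cv zero_quotient by (auto simp: Q.spectrum_in_def)
  show "v \<in> roots (\<lambda>v. \<lbrakk>x,v\<rbrakk>\<^bsub>P\<^esub>) L C"
    using root_space_pullback[OF bracket_right_hom[OF assms(2)] assms(1) bracket_quotient[OF assms(2)] _ v]
      assms(3) cv zero_quotient by (auto simp: Q.spectrum_in_def)
qed

lemma ideal_pullback:
  assumes "poisson_ideal F quotient I"
  shows "poisson_ideal F P {x \<in> carrier P. coset x \<in> I}"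
  unfolding ideal_iff
proof
  have I: "Q.sub I" and QI: "Q.prods_in (carrier quotient) I I"
    using assms by (auto simp: Q.ideal_iff)
  show "sub {x \<in> carrier P. coset x \<in> I}"
  proof (rule subspaceI)
    show "\<zero>\<^bsub>P\<^esub> \<in> {x \<in> carrier P. coset x \<in> I}"
      using Q.subspaceD(2)[OF I] zero_quotient by simp
  next
    fix u v assume "u \<in> {x \<in> carrier P. coset x \<in> I}" "v \<in> {x \<in> carrier P. coset x \<in> I}"
    then show "u \<oplus>\<^bsub>P\<^esub> v \<in> {x \<in> carrier P. coset x \<in> I}"
      using Q.subspaceD(3)[OF I] add_quotient by fastforce
  next
    fix a v assume "a \<in> carrier F" "v \<in> {x \<in> carrier P. coset x \<in> I}"
    then show "a \<odot>\<^bsub>P\<^esub> v \<in> {x \<in> carrier P. coset x \<in> I}"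
      using Q.subspaceD(4)[OF I] smult_quotient by fastforce
  qed auto
  show "prods_in (carrier P) {x \<in> carrier P. coset x \<in> I} {x \<in> carrier P. coset x \<in> I}"
    unfolding prods_in_def
  proof (intro ballI)
    fix x y assume x: "x \<in> carrier P" and y: "y \<in> {x \<in> carrier P. coset x \<in> I}"
    have "coset x \<in> carrier quotient" using x by (auto simp: carrier_quotient)
    then show "x \<otimes>\<^bsub>P\<^esub> y \<in> {x \<in> carrier P. coset x \<in> I} \<and> \<lbrakk>x,y\<rbrakk>\<^bsub>P\<^esub> \<in> {x \<in> carrier P. coset x \<in> I}"
      using Q.prods_inD[OF QI, of "coset x" "coset y"] x y
      by (simp add: mult_quotient bracket_quotient mult_closed bracket_closed)
  qed
qed

end

section \<open>Subideals and the Frattini ideal\<close>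

theorem theorem4p1:
  fixes F :: "('f, 'm) ring_scheme" and P :: "('f, 'p, 'n) poisson_scheme"
    and B C :: "'p set"
  assumes "poisson_algebra F P"
    and "vectorspace.fin_dim F P"
    and "poisson_subideal F P B"
    and "poisson_ideal F (P\<lparr>carrier := B\<rparr>) C"
    and "C \<subseteq> frattini_ideal F P"
  shows "(poisson_nilpotent F (poisson_quotient (P\<lparr>carrier := B\<rparr>) C)
            \<longrightarrow> poisson_nilpotent F (P\<lparr>carrier := B\<rparr>)) \<and>
         (poisson_supersolvable F (poisson_quotient (P\<lparr>carrier := B\<rparr>) C)
            \<longrightarrow> poisson_supersolvable F (P\<lparr>carrier := B\<rparr>))"
proof -
  interpret P: poisson_algebra F P by (rule assms(1))
  have B: "poisson_subalgebra F P B"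
    using assms(3) unfolding poisson_subideal_def by blast
  then have sB: "P.sub B" by (simp add: P.subalgebra_iff)
  note A = P.subalgebra_is_poisson_algebra[OF B]
  interpret A: poisson_algebra F "P\<lparr>carrier := B\<rparr>" by (rule A)
  interpret A: poisson_ideal_quotient F "P\<lparr>carrier := B\<rparr>" C
    by unfold_locales (rule assms(4))
  have fin_A: A.fin_dim
    using P.subspace_has_basis[OF assms(2) sB] P.dim_subspace_eq_card(1)[OF sB] by blast
  note fin_Q = A.quotient_fin_dim[OF fin_A]
  have lift: "A.spectrum_in L x {\<zero>\<^bsub>P\<^esub>}"
    if "x \<in> B" "L = {\<zero>\<^bsub>F\<^esub>} \<or> L = carrier F"
      "A.Q.spectrum_in L (A.coset x) {\<zero>\<^bsub>A.quotient\<^esub>}" for x L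
  proof (rule P.spectrum_in_subideal_lift[OF assms(2,3) A assms(4,5) that(1)])
    show L: "L \<subseteq> carrier F" "\<zero>\<^bsub>F\<^esub> \<in> L" using that(2) by auto
    show "l \<oplus>\<^bsub>F\<^esub> m \<in> L" if "l \<in> L" "m \<in> L" for l m
      using \<open>L = {\<zero>\<^bsub>F\<^esub>} \<or> L = carrier F\<close> that by auto
    show "A.spectrum_in L x C" using A.spectrum_in_pullback[OF L(1) _ that(3)] that(1) by simp
  qed
  have cosets: "A.coset x \<in> carrier A.quotient" if "x \<in> B" for x
    using that A.carrier_quotient by auto
  have "poisson_nilpotent F (P\<lparr>carrier := B\<rparr>)" if Q: "poisson_nilpotent F A.quotient"
  proof -
    have "A.Q.spectrum_in {\<zero>\<^bsub>F\<^esub>} (A.coset x) {\<zero>\<^bsub>A.quotient\<^esub>}" if "x \<in> B" for x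
      using Q A.Q.poisson_nilpotent_iff[OF fin_Q] cosets[OF that]
      by blast
    then show ?thesis using A.poisson_nilpotent_iff[OF fin_A] lift by simp
  qed
  moreover have "poisson_supersolvable F (P\<lparr>carrier := B\<rparr>)" if Q: "poisson_supersolvable F A.quotient"
  proof -
    obtain K where K: "A.Q.supersolvability_ideal K"
      and split: "\<And>X. X \<in> carrier A.quotient \<Longrightarrow> A.Q.spectrum_in (carrier F) X {\<zero>\<^bsub>A.quotient\<^esub>}"
      using Q A.Q.poisson_supersolvable_iff[OF fin_Q] by blast
    let ?K = "{x \<in> carrier (P\<lparr>carrier := B\<rparr>). A.coset x \<in> K}"
    have "A.supersolvability_ideal ?K"
      unfolding A.supersolvability_ideal_def
    proof (intro conjI ballI)
      show "poisson_ideal F (P\<lparr>carrier := B\<rparr>) ?K"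
        using K A.ideal_pullback by (simp add: A.Q.supersolvability_ideal_def)
    next
      fix x y assume xy: "x \<in> carrier (P\<lparr>carrier := B\<rparr>)" "y \<in> carrier (P\<lparr>carrier := B\<rparr>)"
      have "\<lbrakk>A.coset x, A.coset y\<rbrakk>\<^bsub>A.quotient\<^esub> \<in> K"
        using K cosets xy by (simp add: A.Q.supersolvability_ideal_def)
      then show "\<lbrakk>x,y\<rbrakk>\<^bsub>P\<lparr>carrier := B\<rparr>\<^esub> \<in> ?K"
        using A.bracket_quotient[OF xy] A.bracket_closed[OF xy] by simp
    next
      fix x assume "x \<in> ?K"
      then show "A.spectrum_in {\<zero>\<^bsub>F\<^esub>} x {\<zero>\<^bsub>P\<lparr>carrier := B\<rparr>\<^esub>}"
        using lift K by (simp add: A.Q.supersolvability_ideal_def)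
    qed
    moreover have "A.spectrum_in (carrier F) x {\<zero>\<^bsub>P\<^esub>}" if "x \<in> B" for x
      using lift[OF that] split[OF cosets[OF that]] by simp
    ultimately show ?thesis using A.poisson_supersolvable_iff[OF fin_A] by auto
  qed
  ultimately show ?thesis by blast
qed

end
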